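(* Let $(W,S)$ be a Coxeter system, let $H$ be an even quasiparabolic subgroup of $W$, and let $X=W/H$. Let $I_X\subset H_W(q)$ be the left ideal annihilating the element $T(H)\in H_X(q)$. Then the left ideal $I_X$ has a generating set consisting of dihedral generators, in such a way that for each $x\in X$ with $x\neq H$, the number of dihedral generators based at $x$ in the generating set is one less than the number of connected components of the graph $\Gamma_x$ (and there are none based at the minimal element $H$).
   Context: Coxeter systems $(W,S)$ have finite rank; $R(W)$ is the set of reflections, i.e. conjugates in $W$ of elements of $S$; $\ell$ is the length function; $m(s,t)$ is the order of $st$. A quasiparabolic $W$-set is a $W$-set $X$ with $\mathrm{ht}:X\to\mathbb Z$ satisfying $|\mathrm{ht}(sx)-\mathrm{ht}(x)|\le1$ for $s\in S$, $x\in X$, and: (QP1) for $r\in R(W)$, $x\in X$, if $\mathrm{ht}(rx)=\mathrm{ht}(x)$ then $rx=x$; (QP2) for $r\in R(W)$, $x\in X$, $s\in S$, if $\mathrm{ht}(rx)>\mathrm{ht}(x)$ and $\mathrm{ht}(srx)<\mathrm{ht}(sx)$, then $rx=sx$. A subgroup $H\subset W$ is quasiparabolic if $W/H$ (left cosets) with $\mathrm{ht}(wH)=\min_{v\in wH}\ell(v)$ is a quasiparabolic $W$-set; it is even if all its elements have even length. The Hecke algebra $H_W(q)$ is the $\mathbb Z[q]$-algebra with generators $T(s)$, $s\in S$, subject to the braid relations of $W$ and $(T(s)-q)(T(s)+1)=0$; for a reduced expression $w=s_1\cdots s_k$ put $T(w)=T(s_1)\cdots T(s_k)$. For $H$ even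 and quasiparabolic and $X=W/H$, the $H_W(q)$-module $H_X(q)$ is the free $\mathbb Z[q]$-module with basis $T(x)$, $x\in X$, with $T(s)T(x)=T(sx)$ if $\mathrm{ht}(sx)>\mathrm{ht}(x)$ and $T(s)T(x)=(q-1)T(x)+qT(sx)$ if $\mathrm{ht}(sx)<\mathrm{ht}(x)$ (one of these always holds since $H$ is even). For $x\in X$, $\Gamma_x$ is the graph whose vertices are the $s\in S$ with $\mathrm{ht}(sx)=\mathrm{ht}(x)-1$, and whose edges are the pairs $\{s,t\}$ of distinct vertices such that the $\langle s,t\rangle$-orbit of $x$ has size $2m(s,t)$. Given distinct vertices $s,t$ of $\Gamma_x$ not forming an edge, the $\langle s,t\rangle$-orbit of $x$ has some finite size $2k$ (with $k$ a proper divisor of $m(s,t)$ if $m(s,t)<\infty$); let $y$ be its unique element of minimal height, $\mathrm{ht}(y)=\mathrm{ht}(x)-k$, and let $w\in W$ be such that $y=wH$ and $\ell(w)=\mathrm{ht}(y)$. Writing $(st)^{k/2}$ for the alternating product $sts\cdots$ with $k$ factors starting with $s$, and $(ts)^{k/2}$ for the alternating product $tst\cdots$ with $k$ factors starting with $t$, the element $T((st)^{k/2}w)-T((ts)^{k/2}w)$ of $I_X$ is called a dihedral generator based at $x$. *)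

theory Defs
  imports
    "HOL-Computational_Algebra.Polynomial"
    "HOL-Algebra.Left_Coset"
    "HOL-Algebra.Generated_Groups"
    "HOL-Algebra.Group_Action"
    "HOL-Algebra.Multiplicative_Group"
    "HOL-Algebra.QuotRing"
begin

section \<open>Coxeter systems\<close>

fun alternating :: "nat \<Rightarrow> 'a \<Rightarrow> 'a \<Rightarrow> 'a list" where
  "alternating 0 s t = []"
| "alternating (Suc n) s t = s # alternating n t s"

lemma set_alternating: "set (alternating n s t) \<subseteq> {s, t}"
  by (induction n s t rule: alternating.induct) auto

definition word_prod :: "('a, 'b) monoid_scheme \<Rightarrow> 'a list \<Rightarrow> 'a" where
  "word_prod G u = foldr (\<lambda>a b. a \<otimes>\<^bsub>G\<^esub> b) u \<one>\<^bsub>G\<^esub>"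

text \<open>The library's order of an element is \<open>0\<close> for elements of infinite order,
  so \<open>cox_m G s t = 0\<close> encodes \<open>m(s,t) = \<infinity>\<close>.\<close>

definition cox_m :: "('a, 'b) monoid_scheme \<Rightarrow> 'a \<Rightarrow> 'a \<Rightarrow> nat" where
  "cox_m G s t = group.ord G (s \<otimes>\<^bsub>G\<^esub> t)"

text \<open>Equality of words in the group presented by the generators \<open>S\<close> and the relators
  \<open>(st)\<^sup>m\<close>, where \<open>m = m(s,t) < \<infinity>\<close>.  When the elements of \<open>S\<close> are involutions, \<open>m(s,s) = 1\<close>
  supplies the relator \<open>ss\<close>, so formal inverses of the generators are not needed.
  For \<open>m(s,t) = \<infinity>\<close> the relator below is the empty word, that is, there is no relation.\<close>

inductive coxeter_eq :: "('a, 'b) monoid_scheme \<Rightarrow> 'a set \<Rightarrow> 'a list \<Rightarrow> 'a list \<Rightarrow> bool"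
  for G S where
  refl: "u \<in> lists S \<Longrightarrow> coxeter_eq G S u u"
| sym: "coxeter_eq G S u v \<Longrightarrow> coxeter_eq G S v u"
| trans: "coxeter_eq G S u v \<Longrightarrow> coxeter_eq G S v w \<Longrightarrow> coxeter_eq G S u w"
| relator: "u \<in> lists S \<Longrightarrow> v \<in> lists S \<Longrightarrow> s \<in> S \<Longrightarrow> t \<in> S \<Longrightarrow>
    coxeter_eq G S (u @ concat (replicate (cox_m G s t) [s, t]) @ v) (u @ v)"

locale coxeter_system = group G for G (structure) +
  fixes S :: "'a set"
  assumes finite_rank: "finite S"
    and S_subset: "S \<subseteq> carrier G"
    and involution: "s \<in> S \<Longrightarrow> s \<noteq> \<one> \<and> s \<otimes> s = \<one>"
    and generates: "generate G S = carrier G"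
    and presentation: "u \<in> lists S \<Longrightarrow> word_prod G u = \<one> \<Longrightarrow> coxeter_eq G S u []"

definition cox_length :: "('a, 'b) monoid_scheme \<Rightarrow> 'a set \<Rightarrow> 'a \<Rightarrow> nat" where
  "cox_length G S w = (LEAST n. \<exists>u\<in>lists S. length u = n \<and> word_prod G u = w)"

definition reduced_word :: "('a, 'b) monoid_scheme \<Rightarrow> 'a set \<Rightarrow> 'a list \<Rightarrow> 'a \<Rightarrow> bool" where
  "reduced_word G S u w \<longleftrightarrow>
     u \<in> lists S \<and> word_prod G u = w \<and> length u = cox_length G S w"

definition reflections :: "('a, 'b) monoid_scheme \<Rightarrow> 'a set \<Rightarrow> 'a set" where
  "reflections G S = {w \<otimes>\<^bsub>G\<^esub> s \<otimes>\<^bsub>G\<^esub> inv\<^bsub>G\<^esub> w | w s. w \<in> carrier G \<and> s \<in> S}"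


section \<open>Quasiparabolic sets and subgroups\<close>

locale quasiparabolic_set = coxeter_system G S + group_action G X \<phi>
  for G (structure) and S and X :: "'x set" and \<phi> +
  fixes ht :: "'x \<Rightarrow> int"
  assumes ht_step: "s \<in> S \<Longrightarrow> x \<in> X \<Longrightarrow> \<bar>ht (\<phi> s x) - ht x\<bar> \<le> 1"
    and QP1: "r \<in> reflections G S \<Longrightarrow> x \<in> X \<Longrightarrow> ht (\<phi> r x) = ht x \<Longrightarrow> \<phi> r x = x"
    and QP2: "r \<in> reflections G S \<Longrightarrow> x \<in> X \<Longrightarrow> s \<in> S \<Longrightarrow>
      ht (\<phi> r x) > ht x \<Longrightarrow> ht (\<phi> s (\<phi> r x)) < ht (\<phi> s x) \<Longrightarrow> \<phi> r x = \<phi> s x"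

text \<open>Left translation on \<open>W/H\<close>.  The restriction is needed because the library's group of
  permutations of a set consists of extensional functions.\<close>

definition coset_action :: "('a, 'b) monoid_scheme \<Rightarrow> 'a set \<Rightarrow> 'a \<Rightarrow> 'a set \<Rightarrow> 'a set" where
  "coset_action G H g = (\<lambda>x \<in> lcosets\<^bsub>G\<^esub> H. g <#\<^bsub>G\<^esub> x)"

lemma (in group) coset_group_action:
  assumes "subgroup H G"
  shows "group_action G (lcosets H) (coset_action G H)"
proof -
  have H: "H \<subseteq> carrier G" using assms subgroup.subset by blast
  have sub: "x \<subseteq> carrier G" if "x \<in> lcosets H" for x
    using that lcosets_subset_PowG[OF assms] by blast
  have cl: "g <# x \<in> lcosets H" if "g \<in> carrier G" "x \<in> lcosets H" for g x
    using that H by (auto simp: LCOSETS_def lcos_m_assoc)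
  have Bij: "coset_action G H g \<in> Bij (lcosets H)" if g: "g \<in> carrier G" for g
  proof -
    have "bij_betw (\<lambda>x. g <# x) (lcosets H) (lcosets H)"
      by (rule bij_betw_byWitness[where f' = "\<lambda>x. inv g <# x"])
         (use g sub cl in \<open>auto simp: lcos_m_assoc lcos_mult_one\<close>)
    then show ?thesis
      unfolding Bij_def coset_action_def
      by (auto simp: bij_betw_def inj_on_def)
  qed
  show ?thesis
  proof (intro group_action.intro group_hom.intro group_hom_axioms.intro group_BijGroup is_group)
    show "coset_action G H \<in> hom G (BijGroup (lcosets H))"
    proof (rule homI)
      fix g assume "g \<in> carrier G" then show "coset_action G H g \<in> carrier (BijGroup (lcosets H))"
        using Bij by (simp add: BijGroup_def)
    next
      fix g h assume gh: "g \<in> carrier G" "h \<in> carrier G"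
      have "coset_action G H (g \<otimes> h) = compose (lcosets H) (coset_action G H g) (coset_action G H h)"
        using gh sub cl by (intro ext) (simp add: coset_action_def compose_def lcos_m_assoc restrict_def)
      then show "coset_action G H (g \<otimes> h) =
          coset_action G H g \<otimes>\<^bsub>BijGroup (lcosets H)\<^esub> coset_action G H h"
        using Bij gh by (simp add: BijGroup_def)
    qed
  qed
qed

definition coset_ht :: "('a, 'b) monoid_scheme \<Rightarrow> 'a set \<Rightarrow> 'a set \<Rightarrow> int" where
  "coset_ht G S x = int (LEAST n. n \<in> cox_length G S ` x)"

definition quasiparabolic_subgroup ::
    "('a, 'b) monoid_scheme \<Rightarrow> 'a set \<Rightarrow> 'a set \<Rightarrow> bool" where
  "quasiparabolic_subgroup G S H \<longleftrightarrow>
     subgroup H G \<and>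
     quasiparabolic_set G S (lcosets\<^bsub>G\<^esub> H) (coset_action G H) (coset_ht G S)"

definition even_subgroup :: "('a, 'b) monoid_scheme \<Rightarrow> 'a set \<Rightarrow> 'a set \<Rightarrow> bool" where
  "even_subgroup G S H \<longleftrightarrow> subgroup H G \<and> (\<forall>h\<in>H. even (cox_length G S h))"


section \<open>The Hecke algebra\<close>

text \<open>\<open>\<int>[q]\<close> is the type \<open>int poly\<close>.\<close>

abbreviation q :: "int poly" where
  "q \<equiv> [:0, 1:]"

text \<open>The free associative \<open>\<int>[q]\<close>-algebra on \<open>S\<close>: finitely supported functions on words
  over \<open>S\<close>, with the convolution product for concatenation.  The scalars \<open>c\<close> are the
  elements \<open>word_monom c []\<close>.\<close>

definition free_algebra :: "'a set \<Rightarrow> ('a list \<Rightarrow> int poly) ring" where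
  "free_algebra S =
    \<lparr>carrier = {f. finite {u. f u \<noteq> 0} \<and> {u. f u \<noteq> 0} \<subseteq> lists S},
     mult = (\<lambda>f g w. \<Sum>k\<le>length w. f (take k w) * g (drop k w)),
     one = (\<lambda>w. if w = [] then 1 else 0),
     zero = (\<lambda>w. 0),
     add = (\<lambda>f g w. f w + g w)\<rparr>"

lemma free_assoc:
  fixes f g h :: "'a list \<Rightarrow> int poly"
  shows "(\<Sum>k\<le>length w. (\<Sum>j\<le>length (take k w). f (take j (take k w)) * g (drop j (take k w))) * h (drop k w))
   = (\<Sum>k\<le>length w. f (take k w) * (\<Sum>j\<le>length (drop k w). g (take j (drop k w)) * h (drop j (drop k w))))"
proof -
  have "(\<Sum>k\<le>length w. (\<Sum>j\<le>length (take k w). f (take j (take k w)) * g (drop j (take k w))) * h (drop k w))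
    = (\<Sum>k\<le>length w. \<Sum>j\<le>k. f (take j w) * g (take (k - j) (drop j w)) * h (drop (j + (k - j)) w))"
    by (auto simp: sum_distrib_right drop_take min_def intro!: sum.cong)
  also have "\<dots> = (\<Sum>k\<le>length w. \<Sum>j\<le>length w - k. f (take k w) * g (take j (drop k w)) * h (drop (k + j) w))"
    using sum.triangle_reindex_eq[of "\<lambda>i j. f (take i w) * g (take j (drop i w)) * h (drop (i + j) w)" "length w"]
    by (simp add: sum.Sigma) (auto intro!: sum.reindex_bij_witness[where i="\<lambda>(k,j). (k + j, k)" and j="\<lambda>(k,j). (j, k - j)"])
  finally show ?thesis
    by (auto simp: sum_distrib_left mult.assoc add.commute intro!: sum.cong)
qed

lemma free_algebra_ring: "ring (free_algebra S)"
proof (rule ringI)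
  let ?C = "{f :: 'a list \<Rightarrow> int poly. finite {u. f u \<noteq> 0} \<and> {u. f u \<noteq> 0} \<subseteq> lists S}"
  have addc: "(\<lambda>w. f w + g w) \<in> ?C" if "f \<in> ?C" "g \<in> ?C" for f g
  proof -
    have "{u. f u + g u \<noteq> 0} \<subseteq> {u. f u \<noteq> 0} \<union> {u. g u \<noteq> 0}" by auto
    moreover have "finite ({u. f u \<noteq> 0} \<union> {u. g u \<noteq> 0})" using that by auto
    ultimately show ?thesis using that finite_subset by blast
  qed
  show "abelian_group (free_algebra S)"
  proof (rule abelian_groupI)
    fix f assume "f \<in> carrier (free_algebra S)"
    then show "\<exists>y\<in>carrier (free_algebra S). y \<oplus>\<^bsub>free_algebra S\<^esub> f = \<zero>\<^bsub>free_algebra S\<^esub>"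
      by (intro bexI[of _ "\<lambda>u. - f u"]) (auto simp: free_algebra_def)
  qed (use addc in \<open>auto simp: free_algebra_def ac_simps\<close>)
  show "monoid (free_algebra S)"
  proof (rule monoidI)
    fix f g assume fg: "f \<in> carrier (free_algebra S)" "g \<in> carrier (free_algebra S)"
    let ?p = "f \<otimes>\<^bsub>free_algebra S\<^esub> g"
    have "{w. ?p w \<noteq> 0} \<subseteq> (\<lambda>(u, v). u @ v) ` ({u. f u \<noteq> 0} \<times> {u. g u \<noteq> 0})"
    proof
      fix w assume "w \<in> {w. ?p w \<noteq> 0}"
      then obtain k where "f (take k w) * g (drop k w) \<noteq> 0"
        by (auto simp: free_algebra_def elim: sum.not_neutral_contains_not_neutral)
      then show "w \<in> (\<lambda>(u, v). u @ v) ` ({u. f u \<noteq> 0} \<times> {u. g u \<noteq> 0})"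
        by (intro image_eqI[of _ _ "(take k w, drop k w)"]) auto
    qed
    moreover have "finite ({u. f u \<noteq> 0} \<times> {u. g u \<noteq> 0})"
      using fg by (auto simp: free_algebra_def)
    moreover have "(\<lambda>(u, v). u @ v) ` ({u. f u \<noteq> 0} \<times> {u. g u \<noteq> 0}) \<subseteq> lists S"
      using fg by (force simp: free_algebra_def)
    ultimately have "finite {w. ?p w \<noteq> 0}" "{w. ?p w \<noteq> 0} \<subseteq> lists S"
      by (meson finite_imageI finite_subset, order)
    then show "?p \<in> carrier (free_algebra S)"
      by (simp add: free_algebra_def)
  next
    fix f assume "f \<in> carrier (free_algebra S)"
    have "(\<Sum>k\<le>length w. (if take k w = [] then 1 else 0) * f (drop k w)) = f w" for w
    proof -
      have "(\<Sum>k\<le>length w. (if take k w = [] then 1 else 0) * f (drop k w))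
          = (\<Sum>k\<le>length w. if k = 0 then f w else 0)"
        by (rule sum.cong) auto
      then show ?thesis by simp
    qed
    then show "\<one>\<^bsub>free_algebra S\<^esub> \<otimes>\<^bsub>free_algebra S\<^esub> f = f"
      by (simp add: free_algebra_def)
    have "(\<Sum>k\<le>length w. f (take k w) * (if drop k w = [] then 1 else 0)) = f w" for w
    proof -
      have "(\<Sum>k\<le>length w. f (take k w) * (if drop k w = [] then 1 else 0))
          = (\<Sum>k\<le>length w. if k = length w then f w else 0)"
        by (rule sum.cong) auto
      then show ?thesis by simp
    qed
    then show "f \<otimes>\<^bsub>free_algebra S\<^esub> \<one>\<^bsub>free_algebra S\<^esub> = f"
      by (simp add: free_algebra_def)
  next
    show "\<one>\<^bsub>free_algebra S\<^esub> \<in> carrier (free_algebra S)"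
      by (auto simp: free_algebra_def split: if_splits)
  next
    fix f g h assume "f \<in> carrier (free_algebra S)" "g \<in> carrier (free_algebra S)" "h \<in> carrier (free_algebra S)"
    show "f \<otimes>\<^bsub>free_algebra S\<^esub> g \<otimes>\<^bsub>free_algebra S\<^esub> h = f \<otimes>\<^bsub>free_algebra S\<^esub> (g \<otimes>\<^bsub>free_algebra S\<^esub> h)"
      unfolding free_algebra_def using free_assoc[where f = f and g = g and h = h] by simp
  qed
qed (auto simp: free_algebra_def ring_distribs sum.distrib)

definition word_monom :: "int poly \<Rightarrow> 'a list \<Rightarrow> 'a list \<Rightarrow> int poly" where
  "word_monom c u = (\<lambda>w. if w = u then c else 0)"

definition hecke_relators ::
    "('a, 'b) monoid_scheme \<Rightarrow> 'a set \<Rightarrow> ('a list \<Rightarrow> int poly) set" where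
  "hecke_relators G S =
     {word_monom 1 (alternating (cox_m G s t) s t)
        \<ominus>\<^bsub>free_algebra S\<^esub> word_monom 1 (alternating (cox_m G s t) t s)
        | s t. s \<in> S \<and> t \<in> S \<and> s \<noteq> t \<and> cox_m G s t \<noteq> 0} \<union>
     {(word_monom 1 [s] \<ominus>\<^bsub>free_algebra S\<^esub> word_monom q [])
        \<otimes>\<^bsub>free_algebra S\<^esub> (word_monom 1 [s] \<oplus>\<^bsub>free_algebra S\<^esub> \<one>\<^bsub>free_algebra S\<^esub>)
        | s. s \<in> S}"

definition hecke_ideal ::
    "('a, 'b) monoid_scheme \<Rightarrow> 'a set \<Rightarrow> ('a list \<Rightarrow> int poly) set" where
  "hecke_ideal G S = genideal (free_algebra S) (hecke_relators G S)"

definition hecke ::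
    "('a, 'b) monoid_scheme \<Rightarrow> 'a set \<Rightarrow> ('a list \<Rightarrow> int poly) set ring" where
  "hecke G S = free_algebra S Quot hecke_ideal G S"

lemma word_monom_closed: "u \<in> lists S \<Longrightarrow> word_monom c u \<in> carrier (free_algebra S)"
  by (auto simp: word_monom_def free_algebra_def)

lemma hecke_ring: "ring (hecke G S)"
proof -
  interpret ring "free_algebra S" by (rule free_algebra_ring)
  have "hecke_relators G S \<subseteq> carrier (free_algebra S)"
    unfolding hecke_relators_def
    by (auto intro!: minus_closed m_closed a_closed word_monom_closed one_closed
        dest!: set_alternating[THEN subsetD])
  then show ?thesis
    unfolding hecke_def hecke_ideal_def by (intro ideal.quotient_is_ring genideal_ideal)
qed

definition hecke_gen ::
    "('a, 'b) monoid_scheme \<Rightarrow> 'a set \<Rightarrow> 'a \<Rightarrow> ('a list \<Rightarrow> int poly) set" where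
  "hecke_gen G S s = hecke_ideal G S +>\<^bsub>free_algebra S\<^esub> word_monom 1 [s]"

text \<open>By Matsumoto's theorem the image below is a singleton.\<close>

definition hecke_T ::
    "('a, 'b) monoid_scheme \<Rightarrow> 'a set \<Rightarrow> 'a \<Rightarrow> ('a list \<Rightarrow> int poly) set" where
  "hecke_T G S w = the_elem
     ((\<lambda>u. word_prod (hecke G S) (map (hecke_gen G S) u)) ` {u. reduced_word G S u w})"


section \<open>The module \<open>H\<^sub>X(q)\<close> and the annihilator of \<open>T(H)\<close>\<close>

text \<open>Elements of the free \<open>\<int>[q]\<close>-module with basis \<open>T(x)\<close>, \<open>x \<in> X = W/H\<close>, are finitely
  supported functions on \<open>X\<close>.\<close>

definition module_basis :: "'x \<Rightarrow> 'x \<Rightarrow> int poly" where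
  "module_basis x = (\<lambda>z. if z = x then 1 else 0)"

text \<open>Since \<open>H\<close> is even, \<open>x\<close> and \<open>sx\<close> never have the same height.\<close>

definition gen_act_basis ::
    "('a, 'b) monoid_scheme \<Rightarrow> 'a set \<Rightarrow> 'a set \<Rightarrow> 'a \<Rightarrow> 'a set \<Rightarrow> 'a set \<Rightarrow> int poly" where
  "gen_act_basis G S H s x =
     (let sx = coset_action G H s x in
      if coset_ht G S sx > coset_ht G S x then module_basis sx
      else (\<lambda>z. (q - 1) * module_basis x z + q * module_basis sx z))"

definition gen_act ::
    "('a, 'b) monoid_scheme \<Rightarrow> 'a set \<Rightarrow> 'a set \<Rightarrow> 'a \<Rightarrow> ('a set \<Rightarrow> int poly) \<Rightarrow>
      'a set \<Rightarrow> int poly" where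
  "gen_act G S H s v = (\<lambda>z. \<Sum>x | v x \<noteq> 0. v x * gen_act_basis G S H s x z)"

definition free_act ::
    "('a, 'b) monoid_scheme \<Rightarrow> 'a set \<Rightarrow> 'a set \<Rightarrow> ('a list \<Rightarrow> int poly) \<Rightarrow>
      ('a set \<Rightarrow> int poly) \<Rightarrow> 'a set \<Rightarrow> int poly" where
  "free_act G S H f v = (\<lambda>z. \<Sum>u | f u \<noteq> 0. f u * foldr (gen_act G S H) u v z)"

text \<open>An element of the Hecke algebra is a coset of the ideal of relations, and it acts through
  any of its representatives.  The action is independent of the representative for even
  quasiparabolic \<open>H\<close>.\<close>

definition hecke_act ::
    "('a, 'b) monoid_scheme \<Rightarrow> 'a set \<Rightarrow> 'a set \<Rightarrow> ('a list \<Rightarrow> int poly) set \<Rightarrow>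
      ('a set \<Rightarrow> int poly) \<Rightarrow> 'a set \<Rightarrow> int poly" where
  "hecke_act G S H a v = the_elem ((\<lambda>f. free_act G S H f v) ` a)"

definition ann_ideal ::
    "('a, 'b) monoid_scheme \<Rightarrow> 'a set \<Rightarrow> 'a set \<Rightarrow> ('a list \<Rightarrow> int poly) set set" where
  "ann_ideal G S H =
     {a \<in> carrier (hecke G S). hecke_act G S H a (module_basis H) = (\<lambda>z. 0)}"

definition left_ideal :: "'r set \<Rightarrow> ('r, 'c) ring_scheme \<Rightarrow> bool" where
  "left_ideal I R \<longleftrightarrow>
     additive_subgroup I R \<and> (\<forall>a\<in>I. \<forall>r\<in>carrier R. r \<otimes>\<^bsub>R\<^esub> a \<in> I)"

definition gen_left_ideal :: "('r, 'c) ring_scheme \<Rightarrow> 'r set \<Rightarrow> 'r set" where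
  "gen_left_ideal R D = \<Inter>{I. left_ideal I R \<and> D \<subseteq> I}"


section \<open>The graph \<open>\<Gamma>\<^sub>x\<close> and dihedral generators\<close>

definition dihedral_orbit ::
    "('a, 'b) monoid_scheme \<Rightarrow> 'a set \<Rightarrow> 'a \<Rightarrow> 'a \<Rightarrow> 'a set \<Rightarrow> 'a set set" where
  "dihedral_orbit G H s t x = orbit (G\<lparr>carrier := generate G {s, t}\<rparr>) (coset_action G H) x"

definition Gamma_verts ::
    "('a, 'b) monoid_scheme \<Rightarrow> 'a set \<Rightarrow> 'a set \<Rightarrow> 'a set \<Rightarrow> 'a set" where
  "Gamma_verts G S H x = {s \<in> S. coset_ht G S (coset_action G H s x) = coset_ht G S x - 1}"

text \<open>An infinite orbit has \<open>card\<close> equal to \<open>0\<close>, so that in the case \<open>m(s,t) = \<infinity>\<close>, encoded by \<open>0\<close>,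
  the condition below says that the orbit is infinite.\<close>

definition Gamma_edges ::
    "('a, 'b) monoid_scheme \<Rightarrow> 'a set \<Rightarrow> 'a set \<Rightarrow> 'a set \<Rightarrow> ('a \<times> 'a) set" where
  "Gamma_edges G S H x =
     {(s, t). s \<in> Gamma_verts G S H x \<and> t \<in> Gamma_verts G S H x \<and> s \<noteq> t \<and>
        card (dihedral_orbit G H s t x) = 2 * cox_m G s t}"

definition Gamma_components ::
    "('a, 'b) monoid_scheme \<Rightarrow> 'a set \<Rightarrow> 'a set \<Rightarrow> 'a set \<Rightarrow> 'a set set" where
  "Gamma_components G S H x =
     Gamma_verts G S H x //
       {(s, t). s \<in> Gamma_verts G S H x \<and> t \<in> Gamma_verts G S H x \<and>
          (s, t) \<in> (Gamma_edges G S H x)\<^sup>*}"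

definition dihedral_generator ::
    "('a, 'b) monoid_scheme \<Rightarrow> 'a set \<Rightarrow> 'a set \<Rightarrow> 'a set \<Rightarrow> ('a list \<Rightarrow> int poly) set \<Rightarrow> bool" where
  "dihedral_generator G S H x a \<longleftrightarrow>
     (\<exists>s t k y w.
        s \<in> Gamma_verts G S H x \<and> t \<in> Gamma_verts G S H x \<and> s \<noteq> t \<and>
        (s, t) \<notin> Gamma_edges G S H x \<and>
        finite (dihedral_orbit G H s t x) \<and> card (dihedral_orbit G H s t x) = 2 * k \<and>
        y \<in> dihedral_orbit G H s t x \<and>
        (\<forall>z \<in> dihedral_orbit G H s t x. z \<noteq> y \<longrightarrow> coset_ht G S y < coset_ht G S z) \<and>
        w \<in> carrier G \<and> y = w <#\<^bsub>G\<^esub> H \<and> int (cox_length G S w) = coset_ht G S y \<and>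
        a = hecke_T G S (word_prod G (alternating k s t) \<otimes>\<^bsub>G\<^esub> w)
              \<ominus>\<^bsub>hecke G S\<^esub> hecke_T G S (word_prod G (alternating k t s) \<otimes>\<^bsub>G\<^esub> w))"

end

theory Submission
  imports Defs
begin

text \<open>Every word of length \<open>ht(x)\<close> representing an element of \<open>x\<close> gives an element of the Hecke
  algebra that sends \<open>T(H)\<close> to \<open>T(x)\<close>.  If a left ideal \<open>L \<subseteq> I\<^sub>X\<close> identifies all such words for each
  \<open>x\<close>, then the Hecke algebra modulo \<open>L\<close> is spanned by one element for each \<open>x\<close>, so \<open>L = I\<^sub>X\<close>.  By induction
  on \<open>ht(x)\<close>, two words with the same first letter are identified; the first letters of the words
  are the vertices of \<open>\<Gamma>\<^sub>x\<close>.  At an edge of \<open>\<Gamma>\<^sub>x\<close> the braid relation identifies a word starting with \<open>s\<close>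
  with a word starting with \<open>t\<close>, and a dihedral generator does the same for a non-edge.  Hence it
  suffices that the generators based at \<open>x\<close> form a spanning tree on the components of \<open>\<Gamma>\<^sub>x\<close>.

  The same argument for the trivial subgroup, which is quasiparabolic by the strong exchange
  property, proves Matsumoto's theorem and makes the elements \<open>T(w)\<close> linearly independent, so that
  distinct choices give distinct generators and each generator determines \<open>x\<close>.\<close>

section \<open>Words and parity\<close>

text \<open>Evenness enters through parity: the lengths of the elements of a coset have equal
  parity, so a generator never preserves a height, and an element that does preserve one has even
  length. A word in s and t for such an element becomes a reflection when one letter is added, and
  (QP2) can be applied to it. It follows that an orbit with a top consists of two chains of k
  descents that meet at the bottom, with k dividing m(s,t). The same picture gives the braid
  relations on the module: from the bottom, both words of length k lead to the top. The counting
  clause concerns a set of elements, so no element may be a generator at two base points and no two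
  edges of a tree may give the same element. This requires the two words of a generator to represent
  different elements of W, which holds because the pair is a non-edge: an element of W with both
  descents would force an orbit of full size. The tree is a star, so that all generators at a point
  begin with the same letter and injectivity is decided by their second words alone.\<close>

lemma word_prod_Nil [simp]: "word_prod G [] = \<one>\<^bsub>G\<^esub>"
  by (simp add: word_prod_def)

lemma word_prod_Cons [simp]: "word_prod G (a # u) = a \<otimes>\<^bsub>G\<^esub> word_prod G u"
  by (simp add: word_prod_def)

lemma length_alternating [simp]: "length (alternating n s t) = n"
  by (induction n s t rule: alternating.induct) auto

lemma alternating_lists: "s \<in> A \<Longrightarrow> t \<in> A \<Longrightarrow> alternating n s t \<in> lists A"
  using set_alternating[of n s t] by auto

lemma alternating_snoc:
  "alternating (Suc n) s t = alternating n s t @ [if even n then s else t]"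
  by (induction n arbitrary: s t) auto

lemma alternating_add:
  "alternating (m + n) s t =
     alternating m s t @ (if even m then alternating n s t else alternating n t s)"
  by (induction m arbitrary: s t) auto

context group
begin

lemma word_prod_closed [simp]: "u \<in> lists (carrier G) \<Longrightarrow> word_prod G u \<in> carrier G"
  by (induction u) auto

lemma word_prod_append:
  "u \<in> lists (carrier G) \<Longrightarrow> v \<in> lists (carrier G) \<Longrightarrow>
     word_prod G (u @ v) = word_prod G u \<otimes> word_prod G v"
  by (induction u) (auto simp: m_assoc)

lemma word_prod_replicate:
  "s \<in> carrier G \<Longrightarrow> t \<in> carrier G \<Longrightarrow>
     word_prod G (concat (replicate n [s, t])) = (s \<otimes> t) [^] n"
proof (induction n)
  case (Suc n)
  then show ?case using nat_pow_Suc2[of "s \<otimes> t" n] by (simp add: m_assoc del: nat_pow_Suc)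
qed simp

end

lemma concat_replicate_lists: "s \<in> A \<Longrightarrow> t \<in> A \<Longrightarrow> concat (replicate n [s, t]) \<in> lists A"
  by (induction n) auto

context coxeter_system
begin

lemma S_carrier [simp]: "s \<in> S \<Longrightarrow> s \<in> carrier G"
  using S_subset by blast

lemma S_square [simp]: "s \<in> S \<Longrightarrow> s \<otimes> s = \<one>"
  using involution by blast

lemma S_cancel [simp]: "s \<in> S \<Longrightarrow> g \<in> carrier G \<Longrightarrow> s \<otimes> (s \<otimes> g) = g"
  by (simp flip: m_assoc)

lemma S_inv [simp]: "s \<in> S \<Longrightarrow> inv s = s"
  by (simp add: inv_equality)

lemma S_lists_carrier: "u \<in> lists S \<Longrightarrow> u \<in> lists (carrier G)"
  using S_subset by auto

lemma word_closed [simp]: "u \<in> lists S \<Longrightarrow> word_prod G u \<in> carrier G"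
  by (simp add: S_lists_carrier)

lemma word_append [simp]:
  "u \<in> lists S \<Longrightarrow> v \<in> lists S \<Longrightarrow> word_prod G (u @ v) = word_prod G u \<otimes> word_prod G v"
  by (simp add: S_lists_carrier word_prod_append)

lemma rev_lists: "u \<in> lists A \<Longrightarrow> rev u \<in> lists A"
  by auto

lemma word_rev: "u \<in> lists S \<Longrightarrow> word_prod G (rev u) = inv (word_prod G u)"
  by (induction u) (auto simp: inv_mult_group rev_lists)

text \<open>The letters are involutions, so inverses add no letters and words over \<open>A\<close>
  suffice.\<close>

lemma generate_words:
  assumes "A \<subseteq> S" shows "generate G A = word_prod G ` lists A"
proof -
  have AS: "u \<in> lists S" if "u \<in> lists A" for u using that assms by auto
  have "g \<in> word_prod G ` lists A" if "g \<in> generate G A" for g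
    using that
  proof induction
    case one then show ?case by (intro image_eqI[of _ _ "[]"]) auto
  next
    case (incl h) then show ?case using assms by (intro image_eqI[of _ _ "[h]"]) auto
  next
    case (inv h) then show ?case using assms by (intro image_eqI[of _ _ "[h]"]) auto
  next
    case (eng g h)
    then obtain u v where "u \<in> lists A" "v \<in> lists A" "g = word_prod G u" "h = word_prod G v" by auto
    then show ?case using AS by (intro image_eqI[of _ _ "u @ v"]) auto
  qed
  moreover have "word_prod G u \<in> generate G A" if "u \<in> lists A" for u
    using that by (induction u) (auto intro: generate.intros)
  ultimately show ?thesis by blast
qed

lemma ex_word: "w \<in> carrier G \<Longrightarrow> \<exists>u\<in>lists S. word_prod G u = w"
  using generate_words[OF subset_refl] generates by force

text \<open>A relator has 2m letters, so the parity of the length is an invariant of the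
  presentation: this is the sign character.\<close>

lemma cox_eq_length: "coxeter_eq G S u v \<Longrightarrow> even (length u + length v)"
  by (induction rule: coxeter_eq.induct) (auto simp: length_concat sum_list_replicate)

lemma word_eq_cox_eq:
  assumes "u \<in> lists S" "v \<in> lists S" "word_prod G u = word_prod G v"
  shows "coxeter_eq G S (u @ rev v) []"
  using assms by (intro presentation) (simp_all add: word_rev rev_lists)

lemma word_eq_parity:
  assumes "u \<in> lists S" "v \<in> lists S" "word_prod G u = word_prod G v"
  shows "even (length u + length v)"
  using cox_eq_length[OF word_eq_cox_eq[OF assms]] by simp

abbreviation len where "len \<equiv> cox_length G S"

lemma ex_reduced: 
  assumes "w \<in> carrier G" shows "\<exists>u. reduced_word G S u w"
proof -
  have "\<exists>n. \<exists>u\<in>lists S. length u = n \<and> word_prod G u = w" using ex_word[OF assms] by blast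
  then have "\<exists>u\<in>lists S. length u = len w \<and> word_prod G u = w"
    unfolding cox_length_def by (rule LeastI_ex)
  then show ?thesis by (auto simp: reduced_word_def)
qed

lemma len_le: "u \<in> lists S \<Longrightarrow> len (word_prod G u) \<le> length u"
  unfolding cox_length_def by (rule Least_le) blast

lemma len_parity: "u \<in> lists S \<Longrightarrow> even (len (word_prod G u) + length u)"
proof -
  assume u: "u \<in> lists S"
  obtain v where "v \<in> lists S" "length v = len (word_prod G u)" "word_prod G v = word_prod G u"
    using ex_reduced[OF word_closed[OF u]] by (auto simp: reduced_word_def)
  then show ?thesis using word_eq_parity[of v u] u by simp
qed

lemma len_mult_parity: 
  assumes "g \<in> carrier G" "h \<in> carrier G" shows "even (len (g \<otimes> h) + len g + len h)"
proof -
  obtain u v where u: "reduced_word G S u g" "reduced_word G S v h" using ex_reduced assms by meson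
  then have "u \<in> lists S" "v \<in> lists S" "word_prod G (u @ v) = g \<otimes> h"
    by (simp_all add: reduced_word_def)
  then show ?thesis using len_parity[of "u @ v"] u by (auto simp: reduced_word_def)
qed

lemma len_step: "s \<in> S \<Longrightarrow> w \<in> carrier G \<Longrightarrow> len (s \<otimes> w) \<le> len w + 1"
proof -
  assume s: "s \<in> S" and w: "w \<in> carrier G"
  obtain u where u: "u \<in> lists S" "length u = len w" "word_prod G u = w"
    using ex_reduced[OF w] by (auto simp: reduced_word_def)
  show ?thesis using len_le[of "s # u"] u s by simp
qed

lemma len_one [simp]: "len \<one> = 0"
  using len_le[of "[]"] by simp

lemma len_eq_0: "w \<in> carrier G \<Longrightarrow> len w = 0 \<Longrightarrow> w = \<one>"
  using ex_reduced[of w] by (auto simp: reduced_word_def)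

lemma len_S [simp]: "s \<in> S \<Longrightarrow> len s = 1"
  using len_le[of "[s]"] len_eq_0[of s] involution[of s] by (cases "len s") auto

lemma reflectionsI: "w \<in> carrier G \<Longrightarrow> s \<in> S \<Longrightarrow> w \<otimes> s \<otimes> inv w \<in> reflections G S"
  by (auto simp: reflections_def)

lemma reflection_closed: "r \<in> reflections G S \<Longrightarrow> r \<in> carrier G"
  by (auto simp: reflections_def)

lemma reflection_conj:
  assumes "r \<in> reflections G S" "a \<in> S" shows "a \<otimes> r \<otimes> a \<in> reflections G S"
proof -
  obtain w s where w: "w \<in> carrier G" "s \<in> S" "r = w \<otimes> s \<otimes> inv w"
    using assms by (auto simp: reflections_def)
  then have "a \<otimes> r \<otimes> a = (a \<otimes> w) \<otimes> s \<otimes> inv (a \<otimes> w)"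
    using assms by (simp add: inv_mult_group m_assoc)
  then show ?thesis using w assms reflectionsI[of "a \<otimes> w" s] by simp
qed

lemma reflection_square: 
  assumes "r \<in> reflections G S" shows "r \<otimes> r = \<one>"
proof -
  obtain w s where w: "w \<in> carrier G" "s \<in> S" "r = w \<otimes> s \<otimes> inv w"
    using assms by (auto simp: reflections_def)
  have "r \<otimes> r = w \<otimes> s \<otimes> (inv w \<otimes> w) \<otimes> s \<otimes> inv w"
    using w by (simp only: m_assoc m_closed inv_closed S_carrier)
  also have "\<dots> = \<one>" using w by (simp add: m_assoc)
  finally show ?thesis .
qed

lemma S_reflection: "s \<in> S \<Longrightarrow> s \<in> reflections G S"
  using reflectionsI[of \<one> s] by simp

lemma reflection_len_odd: 
  assumes "r \<in> reflections G S" shows "odd (len r)"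
proof -
  obtain w s where w: "w \<in> carrier G" "s \<in> S" "r = w \<otimes> s \<otimes> inv w"
    using assms by (auto simp: reflections_def)
  show ?thesis
    using w len_mult_parity[of "w \<otimes> s" "inv w"] len_mult_parity[of w s] len_mult_parity[of w "inv w"]
    by auto
qed

text \<open>A letter put in front of an alternating word either prolongs it or cancels its first
  letter; both change the length by one, so the parity of the number of letters survives.\<close>

lemma dihedral_word:
  assumes "s \<in> S" "t \<in> S" "u \<in> lists {s, t}"
  shows "\<exists>n. (word_prod G u = word_prod G (alternating n s t) \<or>
               word_prod G u = word_prod G (alternating n t s)) \<and> even (n + length u)"
  using assms(3)
proof (induction u)
  case Nil show ?case by (rule exI[of _ 0]) simp
next
  case (Cons a u)
  have ind: "\<exists>n. (a \<otimes> g = word_prod G (alternating n a b) \<or>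
               a \<otimes> g = word_prod G (alternating n b a)) \<and> even (n + Suc l)"
    if "a \<in> S" "b \<in> S" and g: "g = word_prod G (alternating n a b) \<or> g = word_prod G (alternating n b a)"
      and "even (n + l)"  for g a b n l
    using g
  proof
    assume "g = word_prod G (alternating n b a)"
    then show ?thesis using that by (intro exI[of _ "Suc n"]) auto
  next
    assume *: "g = word_prod G (alternating n a b)"
    show ?thesis
    proof (cases n)
      case 0 then show ?thesis using that * by (intro exI[of _ 1]) auto
    next
      case (Suc k)
      then have "a \<otimes> g = word_prod G (alternating k b a)"
        using * that by (simp add: alternating_lists)
      then show ?thesis using that Suc by (intro exI[of _ k]) auto
    qed
  qed
  obtain n where n: "word_prod G u = word_prod G (alternating n s t) \<or>
      word_prod G u = word_prod G (alternating n t s)" "even (n + length u)"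
    using Cons.IH by blast
  from Cons.hyps consider "a = s" | "a = t" by auto
  then show ?case
  proof cases
    case 1
    then show ?thesis using ind[OF assms(1,2) n] by simp
  next
    case 2
    then show ?thesis using ind[OF assms(2,1) n(1)[THEN disj_commute[THEN iffD1]] n(2)] by (simp add: disj_commute)
  qed
qed

text \<open>An alternating word of odd length is a palindrome, hence a conjugate of its middle
  letter.\<close>

lemma alternating_reflection:
  "s \<in> S \<Longrightarrow> t \<in> S \<Longrightarrow> word_prod G (alternating (Suc (2 * n)) s t) \<in> reflections G S"
proof (induction n arbitrary: s t)
  case 0 then show ?case by (simp add: S_reflection)
next
  case (Suc n)
  have "alternating (Suc (2 * Suc n)) s t = s # alternating (Suc (2 * n)) t s @ [s]"
    using alternating_snoc[of "Suc (2 * n)" t s] by simp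
  then have "word_prod G (alternating (Suc (2 * Suc n)) s t)
      = s \<otimes> word_prod G (alternating (Suc (2 * n)) t s) \<otimes> s"
    using Suc.prems by (simp add: alternating_lists m_assoc del: alternating.simps)
  then show ?case using reflection_conj[OF Suc.IH[OF Suc.prems(2,1)] Suc.prems(1)] by simp
qed

lemma dihedral_reflection:
  assumes "s \<in> S" "t \<in> S" "u \<in> lists {s, t}" "odd (length u)"
  shows "word_prod G u \<in> reflections G S"
proof -
  obtain n where n: "word_prod G u = word_prod G (alternating n s t) \<or>
      word_prod G u = word_prod G (alternating n t s)" "even (n + length u)"
    using dihedral_word[OF assms(1-3)] by blast
  then have "odd n" using assms(4) by simp
  then obtain k where "n = Suc (2 * k)" by (auto elim: oddE)
  then show ?thesis using n(1) alternating_reflection[of s t k] alternating_reflection[of t s k] assms(1,2) by auto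
qed

text \<open>The two alternating products differ by a rotation, because (st)^n s = s (ts)^n. Equality
  of two chain ends thereby becomes a question about fixed points of (st)^n.\<close>

lemma alternating_swap:
  "s \<in> S \<Longrightarrow> t \<in> S \<Longrightarrow>
     word_prod G (alternating n s t) = (s \<otimes> t) [^] n \<otimes> word_prod G (alternating n t s)"
proof (induction n arbitrary: s t)
  case 0 then show ?case by simp
next
  case (Suc n)
  have w: "word_prod G (alternating n s t) \<in> carrier G" "word_prod G (alternating n t s) \<in> carrier G"
    using Suc.prems by (simp_all add: alternating_lists)
  have comm: "(s \<otimes> t) [^] n \<otimes> s = s \<otimes> (t \<otimes> s) [^] n"
  proof (induction n)
    case 0 then show ?case using Suc.prems by simp
  next
    case (Suc k)
    have "(s \<otimes> t) [^] Suc k \<otimes> s = ((s \<otimes> t) [^] k \<otimes> s) \<otimes> (t \<otimes> s)"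
      using Suc.prems \<open>s \<in> S\<close> \<open>t \<in> S\<close> by (simp add: m_assoc)
    then show ?case using Suc \<open>s \<in> S\<close> \<open>t \<in> S\<close> by (simp add: m_assoc)
  qed
  have "(s \<otimes> t) [^] Suc n \<otimes> (t \<otimes> word_prod G (alternating n s t))
     = (s \<otimes> t) [^] n \<otimes> s \<otimes> word_prod G (alternating n s t)"
    using Suc.prems w by (simp add: m_assoc)
  also have "\<dots> = s \<otimes> word_prod G (alternating n t s)"
    using comm Suc.IH[OF Suc.prems(2,1)] Suc.prems w by (simp add: m_assoc)
  finally show ?case by simp
qed

lemma pow_eq_one_iff: "s \<in> S \<Longrightarrow> t \<in> S \<Longrightarrow> (s \<otimes> t) [^] n = \<one> \<longleftrightarrow> cox_m G s t dvd n"
  unfolding cox_m_def by (intro pow_eq_id) simp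

lemma cox_m_commute: 
  assumes "s \<in> S" "t \<in> S" shows "cox_m G s t = cox_m G t s"
proof -
  have "t \<otimes> s = inv (s \<otimes> t)" using assms by (simp add: inv_mult_group)
  then show ?thesis using assms unfolding cox_m_def by simp
qed

end

section \<open>The strong exchange property\<close>

text \<open>\<open>odd_inv G u r\<close> says that \<open>r\<close> occurs an odd number of times among the reflections
  \<open>s\<^sub>1 \<cdots> s\<^sub>i \<cdots> s\<^sub>1\<close> of the word \<open>u = s\<^sub>1 \<cdots> s\<^sub>n\<close>.\<close>

fun odd_inv :: "('a, 'b) monoid_scheme \<Rightarrow> 'a list \<Rightarrow> 'a \<Rightarrow> bool" where
  "odd_inv G [] r = False"
| "odd_inv G (s # u) r = ((r = s) \<noteq> odd_inv G u (s \<otimes>\<^bsub>G\<^esub> r \<otimes>\<^bsub>G\<^esub> s))"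

context coxeter_system
begin

lemma S_conj_eq_iff:
  assumes "s \<in> S" "r \<in> carrier G" "g \<in> carrier G" 
  shows "s \<otimes> r \<otimes> s = g \<longleftrightarrow> r = s \<otimes> g \<otimes> s"
proof
  assume "s \<otimes> r \<otimes> s = g"
  then have "s \<otimes> g \<otimes> s = s \<otimes> (s \<otimes> r \<otimes> s) \<otimes> s" by simp
  also have "\<dots> = r" using assms by (simp add: m_assoc)
  finally show "r = s \<otimes> g \<otimes> s" by simp
next
  assume "r = s \<otimes> g \<otimes> s"
  then have "s \<otimes> r \<otimes> s = s \<otimes> (s \<otimes> g \<otimes> s) \<otimes> s" by simp
  also have "\<dots> = g" using assms by (simp add: m_assoc)
  finally show "s \<otimes> r \<otimes> s = g" .
qed

text \<open>The cocycle rule for inversions: the reflections of \<open>u @ v\<close> are those of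
  \<open>u\<close> followed by those of \<open>v\<close> conjugated by the product of
  \<open>u\<close>, and parities add.\<close>

lemma odd_inv_append:
  "u \<in> lists S \<Longrightarrow> r \<in> carrier G \<Longrightarrow>
     odd_inv G (u @ v) r = (odd_inv G u r \<noteq> odd_inv G v (inv (word_prod G u) \<otimes> r \<otimes> word_prod G u))"
proof (induction u arbitrary: r)
  case (Cons s u)
  then show ?case by (simp add: inv_mult_group m_assoc) blast
qed simp

text \<open>The reflections read off from the word (st)^n are, in this order, (st)^j s for j <
  2n.\<close>

lemma odd_inv_power:
  assumes st: "s \<in> S" "t \<in> S"
  shows "r \<in> carrier G \<Longrightarrow> odd_inv G (concat (replicate n [s, t])) r =
     odd (\<Sum>j<2*n. if r = (s \<otimes> t) [^] j \<otimes> s then 1 else 0 :: nat)"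
proof (induction n arbitrary: r)
  case (Suc n)
  let ?r = "t \<otimes> (s \<otimes> r \<otimes> s) \<otimes> t"
  have inv: "inv (s \<otimes> t) = t \<otimes> s" using st by (simp add: inv_mult_group)
  \<comment> \<open>Conjugation by st carries (st)^j s to (st)^{j+2} s; the shift by two accounts
    for the two letters split off in front.\<close>
  have eq: "?r = (s \<otimes> t) [^] j \<otimes> s \<longleftrightarrow> r = (s \<otimes> t) [^] Suc (Suc j) \<otimes> s" for j
  proof -
    have pw: "(s \<otimes> t) [^] j \<otimes> s \<otimes> t = s \<otimes> t \<otimes> (s \<otimes> t) [^] j"
      using nat_pow_Suc2[of "s \<otimes> t" j] st by (simp add: m_assoc)
    have "?r = (s \<otimes> t) [^] j \<otimes> s \<longleftrightarrow> r = s \<otimes> (t \<otimes> ((s \<otimes> t) [^] j \<otimes> s) \<otimes> t) \<otimes> s"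
      using st Suc.prems by (simp add: S_conj_eq_iff)
    also have "s \<otimes> (t \<otimes> ((s \<otimes> t) [^] j \<otimes> s) \<otimes> t) \<otimes> s = s \<otimes> t \<otimes> ((s \<otimes> t) [^] j \<otimes> s \<otimes> t) \<otimes> s"
      using st by (simp add: m_assoc)
    also have "\<dots> = (s \<otimes> t \<otimes> (s \<otimes> t) [^] Suc j) \<otimes> s" using st by (simp add: m_assoc)
    also have "\<dots> = (s \<otimes> t) [^] Suc (Suc j) \<otimes> s"
      using nat_pow_Suc2[of "s \<otimes> t" "Suc j"] st by simp
    finally show ?thesis .
  qed
  have "s \<otimes> r \<otimes> s = t \<longleftrightarrow> r = s \<otimes> t \<otimes> s" using st Suc.prems by (simp add: S_conj_eq_iff)
  moreover have "odd_inv G (concat (replicate n [s, t])) ?r =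
      odd (\<Sum>j<2*n. if r = (s \<otimes> t) [^] Suc (Suc j) \<otimes> s then 1 else 0 :: nat)"
    using Suc.IH[of ?r] st Suc.prems eq by (simp del: nat_pow_Suc)
  moreover have "(\<Sum>j<2 * Suc n. if r = (s \<otimes> t) [^] j \<otimes> s then 1 else 0 :: nat)
      = (if r = s then 1 else 0) + ((if r = s \<otimes> t \<otimes> s then 1 else 0) +
        (\<Sum>j<2*n. if r = (s \<otimes> t) [^] Suc (Suc j) \<otimes> s then 1 else 0))"
  proof -
    have "2 * Suc n = Suc (Suc (2 * n))" by simp
    then show ?thesis using st unfolding \<open>2 * Suc n = Suc (Suc (2 * n))\<close> sum.lessThan_Suc_shift by simp
  qed
  moreover have "odd_inv G (concat (replicate (Suc n) [s, t])) r
      = ((r = s) \<noteq> ((s \<otimes> r \<otimes> s = t) \<noteq> odd_inv G (concat (replicate n [s, t])) ?r))"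
    by simp
  ultimately show ?case by (auto simp del: nat_pow_Suc)
qed simp

text \<open>As (st)^m = 1, the sequence (st)^j s has period m, and the 2m reflections of the relator
  run through a period twice. For m encoded as 0 the relator is empty.\<close>

lemma odd_inv_relator:
  assumes "s \<in> S" "t \<in> S" "r \<in> carrier G"
  shows "\<not> odd_inv G (concat (replicate (cox_m G s t) [s, t])) r"
proof -
  let ?m = "cox_m G s t"
  let ?f = "\<lambda>j. if r = (s \<otimes> t) [^] j \<otimes> s then 1 else 0 :: nat"
  have "(s \<otimes> t) [^] ?m = \<one>" using pow_eq_one_iff assms by simp
  then have "?f (j + ?m) = ?f j" for j using assms by (simp flip: nat_pow_mult)
  moreover have "(\<Sum>j<2 * ?m. ?f j) = (\<Sum>j<?m. ?f j) + (\<Sum>j<?m. ?f (j + ?m))"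
    using sum.atLeastLessThan_concat[of 0 ?m "2 * ?m" ?f] sum.shift_bounds_nat_ivl[of ?f 0 ?m ?m]
    by (simp add: lessThan_atLeast0 mult_2)
  ultimately have "(\<Sum>j<2 * ?m. ?f j) = 2 * (\<Sum>j<?m. ?f j)" by (simp add: mult_2)
  then show ?thesis using odd_inv_power[OF assms] by simp
qed

text \<open>By the cocycle rule, inserting a relator changes no parity: its own parities are even
  and its product is trivial, so the reflections after it are conjugated as before.\<close>

lemma odd_inv_cox_eq:
  "coxeter_eq G S u v \<Longrightarrow> r \<in> carrier G \<Longrightarrow>
     odd_inv G u r = odd_inv G v r \<and> word_prod G u = word_prod G v"
proof (induction arbitrary: r rule: coxeter_eq.induct)
  case (relator u v s t)
  let ?w = "concat (replicate (cox_m G s t) [s, t])"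
  have w: "?w \<in> lists S" "word_prod G ?w = \<one>"
    using relator pow_eq_one_iff[of s t "cox_m G s t"] by (simp_all add: concat_replicate_lists word_prod_replicate)
  then show ?case using relator by (simp add: odd_inv_append odd_inv_relator)
qed auto

lemma odd_inv_rev:
  assumes "u \<in> lists S" "r \<in> carrier G"
  shows "odd_inv G (rev u) (inv (word_prod G u) \<otimes> r \<otimes> word_prod G u) = odd_inv G u r"
proof -
  have "coxeter_eq G S (u @ rev u) []" using word_eq_cox_eq[of u u] assms by simp
  from odd_inv_cox_eq[OF this assms(2)] show ?thesis using assms by (simp add: odd_inv_append)
qed

lemma odd_inv_word_eq:
  assumes "u \<in> lists S" "v \<in> lists S" "word_prod G u = word_prod G v" "r \<in> carrier G"
  shows "odd_inv G u r = odd_inv G v r"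
proof -
  have "\<not> odd_inv G (u @ rev v) r" using odd_inv_cox_eq[OF word_eq_cox_eq[OF assms(1-3)] assms(4)] by simp
  then show ?thesis using assms odd_inv_rev[of v r] by (simp add: odd_inv_append)
qed

text \<open>The parity depends only on the group element, so the palindromic word
  \<open>v @ [s] @ rev v\<close> may be used for r: the contributions of \<open>v\<close> and
  \<open>rev v\<close> cancel, and the middle letter counts once.\<close>

lemma odd_inv_self:
  assumes "r \<in> reflections G S" "u \<in> lists S" "word_prod G u = r"
  shows "odd_inv G u r"
proof -
  obtain w s where w: "w \<in> carrier G" "s \<in> S" "r = w \<otimes> s \<otimes> inv w"
    using assms by (auto simp: reflections_def)
  obtain v where v: "v \<in> lists S" "word_prod G v = w" using ex_word w by blast
  have "r = word_prod G (v @ [s] @ rev v)" using w v by (simp add: word_rev rev_lists m_assoc)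
  then have "odd_inv G u r = odd_inv G (v @ [s] @ rev v) r"
    using assms v w by (intro odd_inv_word_eq) (auto simp: reflection_closed)
  also have "\<dots> = (odd_inv G v r \<noteq> odd_inv G (s # rev v) s)"
    using v w by (simp add: odd_inv_append m_assoc) (simp flip: m_assoc)
  also have "odd_inv G (s # rev v) s = (\<not> odd_inv G (rev v) s)" using w by simp
  also have "odd_inv G (rev v) s = odd_inv G v r"
    using odd_inv_rev[of v r] v w by (simp add: m_assoc) (simp flip: m_assoc)
  finally show ?thesis by simp
qed

text \<open>If r is the reflection belonging to a letter of \<open>u\<close>, multiplication by r
  deletes that letter.\<close>

lemma odd_inv_shortens:
  "u \<in> lists S \<Longrightarrow> r \<in> carrier G \<Longrightarrow> odd_inv G u r \<Longrightarrow>
     \<exists>v\<in>lists S. length v < length u \<and> word_prod G v = r \<otimes> word_prod G u"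
proof (induction u arbitrary: r)
  case (Cons s u)
  show ?case
  proof (cases "r = s")
    case True
    then show ?thesis using Cons.prems by (intro bexI[of _ u]) auto
  next
    case False
    then have "odd_inv G u (s \<otimes> r \<otimes> s)" using Cons.prems by simp
    then obtain v where v: "v \<in> lists S" "length v < length u" "word_prod G v = s \<otimes> r \<otimes> s \<otimes> word_prod G u"
      using Cons.IH[of "s \<otimes> r \<otimes> s"] Cons.prems by auto
    then show ?thesis using Cons.prems by (intro bexI[of _ "s # v"]) (auto simp: m_assoc)
  qed
qed simp

lemma strong_exchange:
  assumes r: "r \<in> reflections G S" and u: "u \<in> lists S" and less: "len (r \<otimes> word_prod G u) < len (word_prod G u)"
  shows "odd_inv G u r"
proof (rule ccontr)
  assume no: "\<not> odd_inv G u r"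
  have rc: "r \<in> carrier G" using r reflection_closed by simp
  obtain v where v: "v \<in> lists S" "word_prod G v = r \<otimes> word_prod G u" "length v = len (r \<otimes> word_prod G u)"
    using ex_reduced[of "r \<otimes> word_prod G u"] u rc by (auto simp: reduced_word_def)
  obtain w where w: "w \<in> lists S" "word_prod G w = r" using ex_word rc by blast
  have inv: "inv r = r" using reflection_square[OF r] rc by (simp add: inv_equality)
  have "odd_inv G v r = odd_inv G (w @ u) r" using v w u rc by (intro odd_inv_word_eq) auto
  \<comment> \<open>As r is odd for itself, passing from \<open>u\<close> to its product with r
    flips the parity of r. Hence r shortens \<open>v\<close> and leads back to the product of
    \<open>u\<close> with too few letters.\<close>
  also have "\<dots> = (odd_inv G w r \<noteq> odd_inv G u r)"
    using w rc inv reflection_square[OF r] by (simp add: odd_inv_append)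
  finally have "odd_inv G v r" using no odd_inv_self[OF r w] by simp
  then obtain v' where "v' \<in> lists S" "length v' < length v" "word_prod G v' = r \<otimes> word_prod G v"
    using odd_inv_shortens v rc by blast
  moreover have "r \<otimes> word_prod G v = word_prod G u"
    using v u rc reflection_square[OF r] by (simp flip: m_assoc)
  ultimately show False using len_le[of v'] v less by simp
qed

text \<open>This is (QP2) for W acting on itself. By \<open>down\<close>, srs is an inversion of
  \<open>s # u\<close>; if it is not s, it comes from \<open>u\<close>, where it appears as r, so r
  shortens w, against \<open>up\<close>.\<close>

lemma reflection_exchange:
  assumes r: "r \<in> reflections G S" and w: "w \<in> carrier G" and s: "s \<in> S"
    and up: "len w < len (r \<otimes> w)" and down: "len (s \<otimes> (r \<otimes> w)) < len (s \<otimes> w)"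
  shows "r = s"
proof (rule ccontr)
  assume ne: "r \<noteq> s"
  have rc: "r \<in> carrier G" using r reflection_closed by simp
  obtain u where u: "u \<in> lists S" "word_prod G u = w" "length u = len w"
    using ex_reduced[OF w] by (auto simp: reduced_word_def)
  have "s \<otimes> (r \<otimes> w) = (s \<otimes> r \<otimes> s) \<otimes> (s \<otimes> w)" using s rc w by (simp add: m_assoc)
  then have "odd_inv G (s # u) (s \<otimes> r \<otimes> s)"
    using down u s by (intro strong_exchange reflection_conj r) auto
  moreover have "s \<otimes> r \<otimes> s \<noteq> s" using ne s rc S_conj_eq_iff[of s r s] by simp
  ultimately have "odd_inv G u r" using s rc by (simp add: m_assoc)
  then obtain v where "v \<in> lists S" "length v < length u" "word_prod G v = r \<otimes> w"
    using odd_inv_shortens u rc by blast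
  then show False using up u len_le[of v] by simp
qed

end

section \<open>Dihedral orbits in an even quasiparabolic quotient\<close>

locale even_quasiparabolic = coxeter_system G S for G (structure) and S +
  fixes H :: "'a set"
  assumes quasiparabolic: "quasiparabolic_subgroup G S H"
    and even: "even_subgroup G S H"
begin

abbreviation X where "X \<equiv> lcosets H"
abbreviation coset where "coset g \<equiv> g <#\<^bsub>G\<^esub> H"
abbreviation act where "act \<equiv> coset_action G H"
abbreviation ht where "ht \<equiv> coset_ht G S"
abbreviation verts where "verts \<equiv> Gamma_verts G S H"

lemma subgroup_H: "subgroup H G"
  using quasiparabolic by (simp add: quasiparabolic_subgroup_def)

lemma H_carrier: "H \<subseteq> carrier G"
  using subgroup_H subgroup.subset by blast

lemma qp_set: "quasiparabolic_set G S X act ht"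
  using quasiparabolic by (simp add: quasiparabolic_subgroup_def)

lemma coset_in_X [simp]: "g \<in> carrier G \<Longrightarrow> coset g \<in> X"
  by (auto simp: LCOSETS_def)

lemma X_cases: assumes "x \<in> X" obtains g where "g \<in> carrier G" "x = coset g"
  using assms by (auto simp: LCOSETS_def)

lemma act_coset [simp]: "g \<in> carrier G \<Longrightarrow> h \<in> carrier G \<Longrightarrow> act g (coset h) = coset (g \<otimes> h)"
  by (simp add: coset_action_def lcos_m_assoc H_carrier)

lemma act_closed [simp]: "g \<in> carrier G \<Longrightarrow> x \<in> X \<Longrightarrow> act g x \<in> X"
  by (elim X_cases) simp

lemma act_act [simp]:
  "g \<in> carrier G \<Longrightarrow> h \<in> carrier G \<Longrightarrow> x \<in> X \<Longrightarrow> act g (act h x) = act (g \<otimes> h) x"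
  by (elim X_cases) (simp add: m_assoc)

lemma act_one [simp]: "x \<in> X \<Longrightarrow> act \<one> x = x"
  by (elim X_cases) simp

lemma H_in_X [simp]: "H \<in> X"
  using coset_in_X[of \<one>] lcos_mult_one[OF H_carrier] by simp

lemma act_eq_iff: "g \<in> carrier G \<Longrightarrow> x \<in> X \<Longrightarrow> y \<in> X \<Longrightarrow> act g x = y \<longleftrightarrow> x = act (inv g) y"
  by auto

lemma act_S_cancel [simp]: "s \<in> S \<Longrightarrow> g \<in> carrier G \<Longrightarrow> x \<in> X \<Longrightarrow> act s (act (s \<otimes> g) x) = act g x"
  by simp

lemma mem_X_coset: "x \<in> X \<Longrightarrow> w \<in> x \<Longrightarrow> w \<in> carrier G \<and> x = coset w"
proof -
  assume "x \<in> X" and w: "w \<in> x"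
  then obtain g where g: "g \<in> carrier G" "x = coset g" by (elim X_cases)
  have "w \<in> carrier G" using l_coset_subset_G[OF H_carrier g(1)] w g(2) by blast
  moreover have "coset g = coset w" using l_repr_independence[OF _ g(1) subgroup_H] w g(2) by blast
  ultimately show ?thesis using g(2) by blast
qed

lemma ht_le: "w \<in> x \<Longrightarrow> ht x \<le> int (len w)"
  unfolding coset_ht_def by (simp add: Least_le)

lemma ht_attained:
  assumes "x \<in> X" obtains w where "w \<in> carrier G" "x = coset w" "int (len w) = ht x"
proof -
  obtain g where "g \<in> x" using assms lcos_self[OF _ subgroup_H] by (elim X_cases) blast
  then have "(LEAST n. n \<in> len ` x) \<in> len ` x" by (intro LeastI) auto
  then obtain w where "w \<in> x" "int (len w) = ht x" by (auto simp: coset_ht_def)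
  then show ?thesis using mem_X_coset[OF assms] that by blast
qed

lemma ht_coset_le: "w \<in> carrier G \<Longrightarrow> ht (coset w) \<le> int (len w)"
  by (intro ht_le lcos_self subgroup_H)

lemma ht_nonneg: "0 \<le> ht x"
  by (simp add: coset_ht_def)

lemma ht_H [simp]: "ht H = 0"
  using ht_coset_le[of \<one>] ht_nonneg[of H] lcos_mult_one[OF H_carrier] by simp

text \<open>Representatives of one coset differ by an element of \<open>H\<close>, whose length is
  even, so a minimal one has the parity of any other.\<close>

lemma ht_parity:
  assumes "w \<in> carrier G" shows "even (ht (coset w) + int (len w))"
proof -
  obtain v where v: "v \<in> carrier G" "coset w = coset v" "int (len v) = ht (coset w)"
    using ht_attained[OF coset_in_X[OF assms]] by metis
  then have "v \<in> coset w" using lcos_self[OF _ subgroup_H] by blast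
  then obtain h where h: "h \<in> H" "v = w \<otimes> h" by (auto simp: l_coset_def)
  then have "even (len h)" "h \<in> carrier G" using even H_carrier by (auto simp: even_subgroup_def)
  then have "even (len v + len w)" using len_mult_parity[of w h] h assms by simp
  then have "even (int (len v) + int (len w))" by presburger
  then show ?thesis using v by simp
qed

lemma ht_act_parity:
  assumes "g \<in> carrier G" "x \<in> X" shows "even (ht (act g x) + ht x + int (len g))"
  using assms(2)
proof (rule X_cases)
  fix w assume w: "w \<in> carrier G" "x = coset w"
  then show ?thesis
    using assms ht_parity[of w] ht_parity[of "g \<otimes> w"] len_mult_parity[of g w] by simp presburger
qed

lemma ht_step_cases: 
  assumes "s \<in> S" "x \<in> X" shows "ht (act s x) = ht x + 1 \<or> ht (act s x) = ht x - 1"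
proof -
  have "odd (ht (act s x) + ht x)" using ht_act_parity[of s x] assms by simp
  moreover have "\<bar>ht (act s x) - ht x\<bar> \<le> 1" using quasiparabolic_set.ht_step[OF qp_set assms] .
  ultimately show ?thesis by presburger
qed

text \<open>The last letter of the word acts first, so for n > 0 the path from x to
  \<open>alt n s t x\<close> ends with the step s, and applying s again goes back one step.\<close>

definition alt :: "nat \<Rightarrow> 'a \<Rightarrow> 'a \<Rightarrow> 'a set \<Rightarrow> 'a set" where
  "alt n s t x = act (word_prod G (alternating n s t)) x"

lemma alt_0 [simp]: "x \<in> X \<Longrightarrow> alt 0 s t x = x"
  by (simp add: alt_def)

lemma alt_Suc: "s \<in> S \<Longrightarrow> t \<in> S \<Longrightarrow> x \<in> X \<Longrightarrow> alt (Suc n) s t x = act s (alt n t s x)"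
  by (simp add: alt_def alternating_lists)

lemma alt_closed [simp]: "s \<in> S \<Longrightarrow> t \<in> S \<Longrightarrow> x \<in> X \<Longrightarrow> alt n s t x \<in> X"
  by (simp add: alt_def alternating_lists)

lemma act_alt_Suc: "s \<in> S \<Longrightarrow> t \<in> S \<Longrightarrow> x \<in> X \<Longrightarrow> act s (alt (Suc n) s t x) = alt n t s x"
  by (simp add: alt_Suc)

text \<open>In a dihedral orbit at most one edge of each colour joins two given consecutive levels:
  two such edges would be interchanged by a reflection violating (QP2).\<close>

lemma level_unique:
  assumes st: "s \<in> S" "t \<in> S" and a: "a \<in> {s, t}" and u: "u \<in> lists {s, t}" and z: "z \<in> X"
    and eq: "ht (act (word_prod G u) z) = ht z"
    and up: "ht z < ht (act a z)" "ht z < ht (act a (act (word_prod G u) z))"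
  shows "act (word_prod G u) z = z"
proof -
  have uS: "u \<in> lists S" and aS: "a \<in> S" using st a u by auto
  \<comment> \<open>Equal heights force an even length; the additional letter \<open>a\<close> makes
    it odd, so (QP2) applies to the resulting reflection at \<open>z\<close>, with \<open>a\<close>
    as the simple reflection.\<close>
  have "even (len (word_prod G u))" using ht_act_parity[of "word_prod G u" z] eq uS z by simp
  then have "odd (length (a # u))" using len_parity[OF uS] by simp
  then have r: "a \<otimes> word_prod G u \<in> reflections G S"
    using dihedral_reflection[OF st, of "a # u"] a u by simp
  have "act (a \<otimes> word_prod G u) z = act a z"
    using up eq z uS aS by (intro quasiparabolic_set.QP2[OF qp_set r]) auto
  then have "act a (act (a \<otimes> word_prod G u) z) = act a (act a z)" by simp
  then show ?thesis using z uS aS by (simp del: act_act add: act_S_cancel) (simp add: z)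
qed

text \<open>Only the heights along the two chains and their meeting point are recorded; that the
  chains are disjoint in between and exhaust the orbit is derived below. The case s = t is allowed
  and forces k = 1.\<close>

definition dihedral_max :: "'a \<Rightarrow> 'a \<Rightarrow> 'a set \<Rightarrow> nat \<Rightarrow> bool" where
  "dihedral_max s t x k \<longleftrightarrow> s \<in> S \<and> t \<in> S \<and> x \<in> X \<and> 0 < k \<and>
     (\<forall>i\<le>k. ht (alt i s t x) = ht x - int i \<and> ht (alt i t s x) = ht x - int i) \<and>
     alt k s t x = alt k t s x"

lemma dihedral_max_sym: "dihedral_max s t x k \<Longrightarrow> dihedral_max t s x k"
  by (auto simp: dihedral_max_def)

lemma verts_iff: "s \<in> verts x \<longleftrightarrow> s \<in> S \<and> ht (act s x) = ht x - 1"
  by (simp add: Gamma_verts_def)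

lemma verts_S: "s \<in> verts x \<Longrightarrow> s \<in> S"
  by (simp add: verts_iff)

text \<open>Heights are nonnegative, so the chains cannot descend forever. Where one of them first
  fails to descend, by a letter a, this letter leads upwards from the ends of both chains, and the
  uniqueness of such edges identifies the two ends.\<close>

lemma ex_dihedral_max:
  assumes x: "x \<in> X" and s: "s \<in> verts x" and t: "t \<in> verts x"
  shows "\<exists>k. dihedral_max s t x k"
proof -
  let ?D = "\<lambda>i. ht (alt i s t x) = ht x - int i \<and> ht (alt i t s x) = ht x - int i"
  have st: "s \<in> S" "t \<in> S" using s t by (auto simp: verts_iff)
  have "\<not> ?D (Suc (nat (ht x)))" using ht_nonneg[of "alt (Suc (nat (ht x))) s t x"] ht_nonneg[of x] by auto
  moreover have "?D 0" using x by simp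
  ultimately obtain k where k: "\<And>i. i \<le> k \<Longrightarrow> ?D i" and nk: "\<not> ?D (Suc k)"
    using ex_least_nat_less[of "\<lambda>i. \<not> ?D i" "Suc (nat (ht x))"] by auto
  have "?D 1" using s t st x by (simp add: alt_Suc verts_iff)
  then have "k \<noteq> 0" using nk by (cases k) auto
  then obtain j where j: "k = Suc j" by (cases k) auto
  have eq: "alt k a b x = alt k b a x"
    if ab: "a \<in> S" "b \<in> S" "{s, t} = {a, b}" and ne: "ht (alt (Suc k) a b x) \<noteq> ht x - int (Suc k)" for a b
  proof -
    let ?z = "alt k b a x" and ?z' = "alt k a b x"
    \<comment> \<open>This word leads from \<open>?z\<close> back up to \<open>x\<close> and then
      down the other chain to \<open>?z'\<close>.\<close>
    let ?u = "alternating k a b @ rev (alternating k b a)"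
    have l: "alternating k a b \<in> lists {a, b}" "alternating k b a \<in> lists {a, b}"
      by (simp_all add: alternating_lists)
    have lS: "alternating k a b \<in> lists S" "alternating k b a \<in> lists S"
      using ab by (simp_all add: alternating_lists)
    have u: "act (word_prod G ?u) ?z = ?z'"
      using lS x by (simp add: alt_def rev_lists word_rev m_assoc)
    have D: "ht ?z = ht x - int k" "ht ?z' = ht x - int k" "ht (alt j b a x) = ht x - int j"
      using k[of k] k[of j] j ab(3) by (auto simp: doubleton_eq_iff)
    have "act (word_prod G ?u) ?z = ?z"
    proof (rule level_unique[of a b a ?u ?z])
      show "ht ?z < ht (act a ?z)"
        using ne ht_step_cases[of a ?z] D ab x by (auto simp: alt_Suc)
      show "ht ?z < ht (act a (act (word_prod G ?u) ?z))"
        unfolding u using D j ab x by (simp add: act_alt_Suc)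
    qed (use ab x l u D in \<open>simp_all add: rev_lists\<close>)
    then show ?thesis using u by simp
  qed
  have "alt k s t x = alt k t s x"
    using nk eq[of s t] eq[of t s] st by (auto simp: insert_commute)
  then show ?thesis using k st x j unfolding dihedral_max_def by blast
qed

context
  fixes s t x k assumes max: "dihedral_max s t x k"
begin

lemma dihedral_max_facts: "s \<in> S" "t \<in> S" "x \<in> X" "0 < k"
  using max by (auto simp: dihedral_max_def)

lemma dihedral_max_ht: 
  "i \<le> k \<Longrightarrow> ht (alt i s t x) = ht x - int i" "i \<le> k \<Longrightarrow> ht (alt i t s x) = ht x - int i"
  using max by (auto simp: dihedral_max_def)

lemma dihedral_max_bottom: "alt k s t x = alt k t s x"
  using max by (auto simp: dihedral_max_def)

lemma dihedral_max_verts: "s \<in> verts x" "t \<in> verts x"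
  using dihedral_max_ht[of 1] dihedral_max_facts by (auto simp: verts_iff alt_Suc)

text \<open>From a common interior point the letter s would lead up, as the last step of one chain,
  and also down, as the next step of the other.\<close>

lemma dihedral_max_distinct:
  assumes "0 < i" "i < k" shows "alt i s t x \<noteq> alt i t s x"
proof
  assume eq: "alt i s t x = alt i t s x"
  obtain j where j: "i = Suc j" using assms by (cases i) auto
  have "alt j t s x = act s (alt i t s x)"
    using eq act_alt_Suc[of s t x j] dihedral_max_facts j by simp
  also have "\<dots> = alt (Suc i) s t x" using dihedral_max_facts by (simp add: alt_Suc)
  finally have "ht (alt j t s x) = ht (alt (Suc i) s t x)" by simp
  then show False using dihedral_max_ht[of j] dihedral_max_ht[of "Suc i"] assms j by simp
qed

lemma alt_from_bottom:
  "i \<le> k \<Longrightarrow> alt i s t (alt k s t x) = alt (k - i) t s x \<and> alt i t s (alt k s t x) = alt (k - i) s t x"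
proof (induction i)
  case 0
  then show ?case using dihedral_max_facts dihedral_max_bottom by simp
next
  case (Suc i)
  then have "k - i = Suc (k - Suc i)" by simp
  then show ?case using Suc dihedral_max_facts by (simp add: alt_Suc)
qed

lemma dihedral_max_orbit:
  "dihedral_orbit G H s t x = (\<lambda>i. alt i s t x) ` {..k} \<union> (\<lambda>i. alt i t s x) ` {..k}" (is "_ = ?O")
proof -
  note f = dihedral_max_facts
  have gen: "generate G {s, t} = word_prod G ` lists {s, t}" using generate_words f by simp
  \<comment> \<open>Stated for one letter of a pair in either order; \<open>bot\<close> closes the
    set at its lower end, where \<open>a\<close> no longer leads down.\<close>
  have closed: "act a z \<in> (\<lambda>i. alt i a b x) ` {..k} \<union> (\<lambda>i. alt i b a x) ` {..k}"
    if ab: "a \<in> S" "b \<in> S" and bot: "alt k a b x = alt k b a x"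
      and z: "z \<in> (\<lambda>i. alt i a b x) ` {..k} \<union> (\<lambda>i. alt i b a x) ` {..k}" for a b z
  proof -
    have up: "act a (alt (Suc i) a b x) \<in> (\<lambda>i. alt i b a x) ` {..k}" if "Suc i \<le> k" for i
      using that ab f act_alt_Suc[of a b x i] by (intro image_eqI[of _ _ i]) auto
    have down: "act a (alt i b a x) \<in> (\<lambda>i. alt i a b x) ` {..k}" if "i < k" for i
      using that ab f by (intro image_eqI[of _ _ "Suc i"]) (auto simp: alt_Suc)
    have first: "act a (alt i a b x) \<in> (\<lambda>i. alt i a b x) ` {..k} \<union> (\<lambda>i. alt i b a x) ` {..k}"
      if "i \<le> k" for i
      using that up[of "i - 1"] down[of 0] f ab by (cases i) auto
    have second: "act a (alt i b a x) \<in> (\<lambda>i. alt i a b x) ` {..k} \<union> (\<lambda>i. alt i b a x) ` {..k}"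
      if "i \<le> k" for i
      using that down[of i] first[of k] bot by (cases "i = k") auto
    from z show ?thesis by (elim UnE imageE) (use first second in auto)
  qed
  have "act (word_prod G u) x \<in> ?O" if "u \<in> lists {s, t}" for u
    using that
  proof (induction u)
    case Nil
    show ?case using f by (intro UnI1 image_eqI[of _ _ 0]) auto
  next
    case (Cons a u)
    then have "u \<in> lists S" and aS: "a \<in> S" and a: "a = s \<or> a = t" using f by auto
    then have "act (word_prod G (a # u)) x = act a (act (word_prod G u) x)" using f by simp
    moreover have "act a (act (word_prod G u) x) \<in> ?O"
      using a closed[OF f(1,2) dihedral_max_bottom Cons.IH]
        closed[OF f(2,1) dihedral_max_bottom[symmetric]] Cons.IH by (auto simp only: Un_commute)
    ultimately show ?case by simp
  qed
  moreover have "alt i s t x \<in> dihedral_orbit G H s t x" "alt i t s x \<in> dihedral_orbit G H s t x" for i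
    by (auto simp: dihedral_orbit_def orbit_def gen alt_def alternating_lists intro!: exI[of _ "word_prod G (alternating i _ _)"])
  ultimately show ?thesis by (auto simp: dihedral_orbit_def orbit_def gen)
qed

lemma dihedral_max_card: "finite (dihedral_orbit G H s t x)" "card (dihedral_orbit G H s t x) = 2 * k"
proof -
  \<comment> \<open>\<open>?B\<close> omits the two ends, which already belong to \<open>?A\<close>;
    the sizes k + 1 and k - 1 add up to 2k.\<close>
  let ?A = "(\<lambda>i. alt i s t x) ` {..k}" and ?B = "(\<lambda>i. alt i t s x) ` {0<..<k}"
  have "(\<lambda>i. alt i t s x) ` {..k} = insert x (insert (alt k s t x) ?B)"
  proof -
    have "{..k} = insert 0 (insert k {0<..<k})" by auto
    then show ?thesis using dihedral_max_facts dihedral_max_bottom by simp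
  qed
  moreover have "x \<in> ?A" using dihedral_max_facts by (intro image_eqI[of _ _ 0]) auto
  ultimately have O: "dihedral_orbit G H s t x = ?A \<union> ?B" unfolding dihedral_max_orbit by auto
  then show "finite (dihedral_orbit G H s t x)" by simp
  have "i = j" if "i \<le> k" "j \<le> k" "alt i s t x = alt j s t x" for i j
    using dihedral_max_ht(1)[OF that(1)] dihedral_max_ht(1)[OF that(2)] arg_cong[OF that(3), of ht] by linarith
  moreover have "i = j" if "i \<le> k" "j \<le> k" "alt i t s x = alt j t s x" for i j
    using dihedral_max_ht(2)[OF that(1)] dihedral_max_ht(2)[OF that(2)] arg_cong[OF that(3), of ht] by linarith
  ultimately have "inj_on (\<lambda>i. alt i s t x) {..k}" "inj_on (\<lambda>i. alt i t s x) {0<..<k}"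
    by (simp_all add: inj_on_def)
  moreover have "?A \<inter> ?B = {}"
  proof -
    have False if "i \<le> k" "0 < j" "j < k" "alt i s t x = alt j t s x" for i j
      using that dihedral_max_ht(1)[of i] dihedral_max_ht(2)[of j] dihedral_max_distinct[of j] by auto
    then show ?thesis by auto
  qed
  ultimately show "card (dihedral_orbit G H s t x) = 2 * k"
    unfolding O using dihedral_max_facts by (simp add: card_Un_disjoint card_image)
qed

lemma dihedral_max_bottom_least:
  "z \<in> dihedral_orbit G H s t x \<Longrightarrow> z \<noteq> alt k s t x \<Longrightarrow> ht (alt k s t x) < ht z"
  unfolding dihedral_max_orbit using dihedral_max_ht dihedral_max_bottom by (auto simp: le_less)

end

section \<open>Rotations of a dihedral orbit and divisibility of its size\<close>

lemma S_conj_pow: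
  assumes "s \<in> S" "t \<in> S" "a \<in> {s, t}"
  shows "a \<otimes> (s \<otimes> t) [^] (n::nat) \<otimes> a = inv ((s \<otimes> t) [^] n)"
proof (induction n)
  case 0 then show ?case using assms by auto
next
  case (Suc n)
  have a: "a \<in> S" using assms by auto
  have one: "a \<otimes> (s \<otimes> t) \<otimes> a = inv (s \<otimes> t)" using assms by (auto simp: inv_mult_group m_assoc)
  have "a \<otimes> (s \<otimes> t) [^] Suc n \<otimes> a = (a \<otimes> (s \<otimes> t) [^] n \<otimes> a) \<otimes> (a \<otimes> (s \<otimes> t) \<otimes> a)"
    using assms a by (simp add: m_assoc)
  also have "\<dots> = inv ((s \<otimes> t) \<otimes> (s \<otimes> t) [^] n)" unfolding Suc one using assms by (simp add: inv_mult_group)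
  finally show ?case using nat_pow_Suc2[of "s \<otimes> t" n] assms by (simp del: nat_pow_Suc)
qed

text \<open>Conjugation by \<open>a\<close> inverts the rotation, and an element and its inverse
  have the same fixed points.\<close>

lemma fixed_act:
  assumes "s \<in> S" "t \<in> S" "a \<in> {s, t}" "z \<in> X"
  shows "act ((s \<otimes> t) [^] (n::nat)) (act a z) = act a z \<longleftrightarrow> act ((s \<otimes> t) [^] n) z = z"
proof -
  let ?g = "(s \<otimes> t) [^] n"
  have a: "a \<in> S" and g: "?g \<in> carrier G" using assms by auto
  have "act ?g (act a z) = act a z \<longleftrightarrow> act a (act ?g (act a z)) = z"
    using act_eq_iff[of a "act ?g (act a z)" z] a g assms by (simp del: act_act)
  also have "act a (act ?g (act a z)) = act (inv ?g) z"
    using S_conj_pow[OF assms(1-3), of n] a g assms by (simp flip: m_assoc)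
  also have "act (inv ?g) z = z \<longleftrightarrow> act ?g z = z" using act_eq_iff[of ?g z z] g assms by auto
  finally show ?thesis .
qed

text \<open>By \<open>alternating_swap\<close> the two ends agree exactly when (st)^n fixes one of
  them, and being fixed by (st)^n propagates along a chain in both directions.\<close>

lemma alt_eq_iff:
  assumes "s \<in> S" "t \<in> S" "x \<in> X"
  shows "alt n s t x = alt n t s x \<longleftrightarrow> act ((s \<otimes> t) [^] n) x = x"
proof -
  let ?g = "(s \<otimes> t) [^] n"
  have "(act ?g (alt j t s x) = alt j t s x) = (act ?g x = x) \<and>
      (act ?g (alt j s t x) = alt j s t x) = (act ?g x = x)" for j
    by (induction j) (use assms in \<open>simp_all add: alt_Suc fixed_act del: act_act\<close>)
  moreover have "alt n s t x = act ?g (alt n t s x)"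
    unfolding alt_def using assms alternating_swap[of s t n] by (simp add: alternating_lists)
  ultimately show ?thesis by auto
qed

lemma act_pow_fixed: 
  assumes "g \<in> carrier G" "x \<in> X" "act g x = x" shows "act (g [^] (n::nat)) x = x"
proof (induction n)
  case (Suc n)
  then show ?case using assms act_act[of "g [^] n" g x] by simp
qed (use assms in simp)

text \<open>The power (st)^j fixes \<open>x\<close> for j = k but for no j strictly between 0 and k,
  so the remainder of m(s,t) modulo k vanishes. Infinite order, encoded by 0, is divisible by every
  k.\<close>

lemma dihedral_max_dvd:
  assumes "dihedral_max s t x k" shows "k dvd cox_m G s t"
proof -
  let ?g = "s \<otimes> t" and ?m = "cox_m G s t"
  note f = dihedral_max_facts[OF assms]
  have g: "?g \<in> carrier G" using f by simp
  have "act (?g [^] k) x = x" using alt_eq_iff dihedral_max_bottom[OF assms] f by simp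
  then have fixed: "act ((?g [^] k) [^] (?m div k)) x = x" using act_pow_fixed f g by simp
  have "(?g [^] k) [^] (?m div k) = ?g [^] (k * (?m div k))" using g by (simp add: nat_pow_pow)
  then have "?g [^] (?m mod k) \<otimes> (?g [^] k) [^] (?m div k) = ?g [^] ?m"
    using g by (simp add: nat_pow_mult)
  also have "\<dots> = \<one>" using pow_eq_one_iff f by simp
  finally have "act (?g [^] (?m mod k)) (act ((?g [^] k) [^] (?m div k)) x) = x"
    using f g by simp
  then have "alt (?m mod k) s t x = alt (?m mod k) t s x" using fixed alt_eq_iff f by simp
  then have "?m mod k = 0" using dihedral_max_distinct[OF assms, of "?m mod k"] f by auto
  then show ?thesis by auto
qed

text \<open>The orbit has size 2k with k > 0, so it never gives an edge when m(s,t) is infinite,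
  encoded by 0.\<close>

lemma edges_iff:
  assumes "dihedral_max s t x k"
  shows "(s, t) \<in> Gamma_edges G S H x \<longleftrightarrow> s \<noteq> t \<and> k = cox_m G s t"
  using dihedral_max_verts[OF assms] dihedral_max_card[OF assms] by (auto simp: Gamma_edges_def)

lemma edges_verts: "(s, t) \<in> Gamma_edges G S H x \<Longrightarrow> s \<in> verts x \<and> t \<in> verts x"
  by (auto simp: Gamma_edges_def)

lemma edges_sym:
  assumes "x \<in> X" "(s, t) \<in> Gamma_edges G S H x" shows "(t, s) \<in> Gamma_edges G S H x"
proof -
  obtain k where "dihedral_max s t x k" using ex_dihedral_max edges_verts assms by blast
  then show ?thesis
    using assms edges_iff[of s t x k] edges_iff[OF dihedral_max_sym] cox_m_commute dihedral_max_facts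
    by metis
qed

text \<open>The size of the orbit determines k and minimality of the height determines y, so both
  can be replaced by the data of the chains.\<close>

lemma dihedral_generator_iff:
  assumes "x \<in> X"
  shows "dihedral_generator G S H x a \<longleftrightarrow>
    (\<exists>s t k w. dihedral_max s t x k \<and> s \<noteq> t \<and> k \<noteq> cox_m G s t \<and>
       w \<in> carrier G \<and> alt k s t x = coset w \<and> int (len w) = ht x - int k \<and>
       a = hecke_T G S (word_prod G (alternating k s t) \<otimes> w)
              \<ominus>\<^bsub>hecke G S\<^esub> hecke_T G S (word_prod G (alternating k t s) \<otimes> w))"
    (is "?L \<longleftrightarrow> (\<exists>s t k w. ?P s t k w)")
proof
  assume ?L
  then obtain s t k y w where *: "s \<in> verts x" "t \<in> verts x" "s \<noteq> t"
        "(s, t) \<notin> Gamma_edges G S H x" "card (dihedral_orbit G H s t x) = 2 * k"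
        "y \<in> dihedral_orbit G H s t x"
        "\<forall>z \<in> dihedral_orbit G H s t x. z \<noteq> y \<longrightarrow> ht y < ht z"
        "w \<in> carrier G" "y = coset w" "int (len w) = ht y"
        "a = hecke_T G S (word_prod G (alternating k s t) \<otimes> w)
              \<ominus>\<^bsub>hecke G S\<^esub> hecke_T G S (word_prod G (alternating k t s) \<otimes> w)"
    unfolding dihedral_generator_def by (elim exE conjE) (rule that)
  obtain l where l: "dihedral_max s t x l" using ex_dihedral_max[OF assms *(1,2)] by blast
  then have "l = k" using dihedral_max_card[OF l] *(5) by simp
  with l have l: "dihedral_max s t x k" by simp
  have "alt k s t x \<in> dihedral_orbit G H s t x" unfolding dihedral_max_orbit[OF l] by auto
  then have "y = alt k s t x" using dihedral_max_bottom_least[OF l *(6)] *(7) less_asym by blast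
  then have "?P s t k w"
    using *(3,4,8-11) l edges_iff[OF l] dihedral_max_ht(1)[OF l order.refl] by simp
  then show "\<exists>s t k w. ?P s t k w" by (intro exI)
next
  assume "\<exists>s t k w. ?P s t k w"
  then obtain s t k w where m: "dihedral_max s t x k" and P: "s \<noteq> t" "k \<noteq> cox_m G s t"
      "w \<in> carrier G" "alt k s t x = coset w" "int (len w) = ht x - int k"
      "a = hecke_T G S (word_prod G (alternating k s t) \<otimes> w)
              \<ominus>\<^bsub>hecke G S\<^esub> hecke_T G S (word_prod G (alternating k t s) \<otimes> w)"
    by (elim exE conjE) (rule that)
  have y: "alt k s t x \<in> dihedral_orbit G H s t x" unfolding dihedral_max_orbit[OF m] by auto
  show ?L
    unfolding dihedral_generator_def
  proof (intro exI conjI ballI impI)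
    show "s \<in> verts x" "t \<in> verts x" by (rule dihedral_max_verts[OF m])+
    show "finite (dihedral_orbit G H s t x)" "card (dihedral_orbit G H s t x) = 2 * k"
      by (rule dihedral_max_card[OF m])+
    show "(s, t) \<notin> Gamma_edges G S H x" using P edges_iff[OF m] by simp
    show "ht (alt k s t x) < ht z" if "z \<in> dihedral_orbit G H s t x" "z \<noteq> alt k s t x" for z
      by (rule dihedral_max_bottom_least[OF m that])
    show "int (len w) = ht (alt k s t x)" using P dihedral_max_ht(1)[OF m order.refl] by simp
  qed (fact y P)+
qed

end

section \<open>The regular representation as a quasiparabolic set\<close>

context coxeter_system
begin

lemma one_coset: "g \<in> carrier G \<Longrightarrow> l_coset G g {\<one>} = {g}"
  by (simp add: l_coset_def)

lemma one_cosets: "lcosets {\<one>} = (\<lambda>g. {g}) ` carrier G"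
  by (auto simp: LCOSETS_def one_coset)

lemma ht_singleton [simp]: "coset_ht G S {g} = int (len g)"
  by (auto simp: coset_ht_def intro: Least_equality)

lemma coset_action_singleton [simp]:
  "g \<in> carrier G \<Longrightarrow> h \<in> carrier G \<Longrightarrow> coset_action G {\<one>} g {h} = {g \<otimes> h}"
  by (simp add: coset_action_def one_cosets l_coset_def)

text \<open>(QP1) is vacuous, since reflections have odd length and never preserve the length of an
  element; (QP2) is \<open>reflection_exchange\<close>.\<close>

lemma one_even_quasiparabolic: "even_quasiparabolic G S {\<one>}"
proof -
  have sub: "subgroup {\<one>} G" by (rule triv_subgroup)
  interpret group_action G "lcosets {\<one>}" "coset_action G {\<one>}" by (rule coset_group_action[OF sub])
  have "quasiparabolic_set G S (lcosets {\<one>}) (coset_action G {\<one>}) (coset_ht G S)"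
  proof
    fix s x assume "s \<in> S" "x \<in> lcosets {\<one>}"
    then obtain g where g: "g \<in> carrier G" "x = {g}" by (auto simp: one_cosets)
    show "\<bar>coset_ht G S (coset_action G {\<one>} s x) - coset_ht G S x\<bar> \<le> 1"
      using len_step[of s g] len_step[of s "s \<otimes> g"] g \<open>s \<in> S\<close> by simp
  next
    fix r x assume r: "r \<in> reflections G S" "x \<in> lcosets {\<one>}"
      and eq: "coset_ht G S (coset_action G {\<one>} r x) = coset_ht G S x"
    then obtain g where g: "g \<in> carrier G" "x = {g}" by (auto simp: one_cosets)
    then have "len (r \<otimes> g) = len g" using eq reflection_closed[OF r(1)] by simp
    then have "even (len r)" using len_mult_parity[of r g] g reflection_closed[OF r(1)] by simp blast
    then show "coset_action G {\<one>} r x = x" using reflection_len_odd r by blast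
  next
    fix r x s assume r: "r \<in> reflections G S" "x \<in> lcosets {\<one>}" and s: "s \<in> S"
      and less: "coset_ht G S x < coset_ht G S (coset_action G {\<one>} r x)"
        "coset_ht G S (coset_action G {\<one>} s (coset_action G {\<one>} r x)) < coset_ht G S (coset_action G {\<one>} s x)"
    then obtain g where g: "g \<in> carrier G" "x = {g}" by (auto simp: one_cosets)
    then have "r = s"
      using reflection_exchange[of r g s] less r s reflection_closed[OF r(1)] by simp
    then show "coset_action G {\<one>} r x = coset_action G {\<one>} s x" by simp
  qed
  then show ?thesis
    by unfold_locales (simp_all add: quasiparabolic_subgroup_def even_subgroup_def sub)
qed

text \<open>The group acts freely on itself, so its dihedral orbits have the maximal size.\<close>

lemma one_dihedral_max:
  assumes "even_quasiparabolic.dihedral_max G S {\<one>} s t {g} k" "g \<in> carrier G"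
  shows "k = cox_m G s t"
proof -
  interpret one: even_quasiparabolic G S "{\<one>}" by (rule one_even_quasiparabolic)
  note f = one.dihedral_max_facts[OF assms(1)]
  have "coset_action G {\<one>} ((s \<otimes> t) [^] k) {g} = {g}"
    using one.alt_eq_iff[OF f(1-3)] one.dihedral_max_bottom[OF assms(1)] by simp
  then have "(s \<otimes> t) [^] k \<otimes> g = g" using f assms(2) by simp
  then have "(s \<otimes> t) [^] k = \<one>" using f assms(2) r_cancel_one' by simp
  then have "cox_m G s t dvd k" using pow_eq_one_iff f by simp
  then show ?thesis using one.dihedral_max_dvd[OF assms(1)] dvd_antisym by blast
qed

end

section \<open>Finitely supported functions and the free algebra\<close>

text \<open>One carrier for two purposes: words over \<open>S\<close> give the free algebra, and
  cosets give the module with basis T(x).\<close>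

definition fin_on :: "'x set \<Rightarrow> ('x \<Rightarrow> int poly) set" where
  "fin_on A = {f. finite {x. f x \<noteq> 0} \<and> {x. f x \<noteq> 0} \<subseteq> A}"

lemma fin_on_zero [simp]: "(\<lambda>_. 0) \<in> fin_on A"
  by (simp add: fin_on_def)

lemma fin_on_subset: "f \<in> fin_on A \<Longrightarrow> {x. g x \<noteq> 0} \<subseteq> {x. f x \<noteq> 0} \<Longrightarrow> g \<in> fin_on A"
  unfolding fin_on_def using finite_subset by blast

lemma fin_on_add [simp]:
  assumes "f \<in> fin_on A" "g \<in> fin_on A" shows "(\<lambda>x. f x + g x) \<in> fin_on A"
proof -
  have "{x. f x + g x \<noteq> 0} \<subseteq> {x. f x \<noteq> 0} \<union> {x. g x \<noteq> 0}" by auto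
  moreover have "finite ({x. f x \<noteq> 0} \<union> {x. g x \<noteq> 0})" using assms by (simp add: fin_on_def)
  ultimately show ?thesis using assms finite_subset unfolding fin_on_def by blast
qed

lemma fin_on_scale [simp]: "f \<in> fin_on A \<Longrightarrow> (\<lambda>x. c * f x) \<in> fin_on A"
  by (erule fin_on_subset) auto

lemma fin_on_uminus [simp]: "f \<in> fin_on A \<Longrightarrow> (\<lambda>x. - f x) \<in> fin_on A"
  by (erule fin_on_subset) auto

lemma fin_on_diff [simp]: "f \<in> fin_on A \<Longrightarrow> g \<in> fin_on A \<Longrightarrow> (\<lambda>x. f x - g x) \<in> fin_on A"
  using fin_on_add[OF _ fin_on_uminus, of f A g] by simp

lemma fin_on_single [simp]: "a \<in> A \<Longrightarrow> (\<lambda>x. if x = a then c else 0) \<in> fin_on A"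
  by (auto simp: fin_on_def)

text \<open>Points of the support are split off one at a time, so a linear statement needs to be
  checked only on single basis elements.\<close>

lemma fin_on_induct [consumes 1, case_names zero add]:
  assumes "f \<in> fin_on A" and zero: "P (\<lambda>_. 0)"
    and add: "\<And>g a c. g \<in> fin_on A \<Longrightarrow> a \<in> A \<Longrightarrow> P g \<Longrightarrow> P (\<lambda>x. g x + (if x = a then c else 0))"
  shows "P f"
proof -
  have "P f" if "finite B" "B \<subseteq> A" "{x. f x \<noteq> 0} \<subseteq> B" for B f
    using that
  proof (induction B arbitrary: f rule: finite_induct)
    case empty
    then have "f = (\<lambda>_. 0)" by auto
    then show ?case using zero by simp
  next
    case (insert a B)
    let ?g = "f(a := 0)"
    have supp: "{x. ?g x \<noteq> 0} \<subseteq> B" using insert.prems by auto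
    have g: "?g \<in> fin_on A"
      using supp insert.hyps(1) insert.prems(1) finite_subset unfolding fin_on_def by blast
    have "P ?g" using insert.IH[OF _ supp] insert.prems(1) by blast
    with insert.prems(1) have "P (\<lambda>x. ?g x + (if x = a then f a else 0))" by (intro add[OF g]) auto
    moreover have "(\<lambda>x. ?g x + (if x = a then f a else 0)) = f" by auto
    ultimately show ?case by simp
  qed
  then show ?thesis using assms(1) by (auto simp: fin_on_def)
qed

text \<open>Linear extension of \<open>k\<close> from basis elements. The action of a generator on
  the module and that of the free algebra on a fixed vector are both of this form.\<close>

definition lin :: "('x \<Rightarrow> 'y \<Rightarrow> int poly) \<Rightarrow> ('x \<Rightarrow> int poly) \<Rightarrow> 'y \<Rightarrow> int poly" where
  "lin k f = (\<lambda>z. \<Sum>x | f x \<noteq> 0. f x * k x z)"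

lemma lin_superset:
  assumes "finite B" "{x. f x \<noteq> 0} \<subseteq> B" shows "lin k f z = (\<Sum>x\<in>B. f x * k x z)"
  unfolding lin_def using assms by (intro sum.mono_neutral_left) auto

lemma lin_add:
  assumes "f \<in> fin_on A" "g \<in> fin_on A" shows "lin k (\<lambda>x. f x + g x) = (\<lambda>z. lin k f z + lin k g z)"
proof
  fix z
  let ?B = "{x. f x \<noteq> 0} \<union> {x. g x \<noteq> 0}"
  have B: "finite ?B" using assms by (simp add: fin_on_def)
  have "lin k (\<lambda>x. f x + g x) z = (\<Sum>x\<in>?B. (f x + g x) * k x z)" using B by (rule lin_superset) auto
  also have "\<dots> = lin k f z + lin k g z"
    using lin_superset[OF B, of f k z] lin_superset[OF B, of g k z] by (simp add: ring_distribs sum.distrib)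
  finally show "lin k (\<lambda>x. f x + g x) z = lin k f z + lin k g z" .
qed

lemma lin_zero [simp]: "lin k (\<lambda>_. 0) = (\<lambda>_. 0)"
  by (simp add: lin_def)

lemma lin_scale:
  assumes "f \<in> fin_on A" shows "lin k (\<lambda>x. c * f x) = (\<lambda>z. c * lin k f z)"
proof
  fix z
  have "finite {x. f x \<noteq> 0}" using assms by (simp add: fin_on_def)
  then have "lin k (\<lambda>x. c * f x) z = (\<Sum>x | f x \<noteq> 0. c * f x * k x z)" by (rule lin_superset) auto
  then show "lin k (\<lambda>x. c * f x) z = c * lin k f z" by (simp add: lin_def sum_distrib_left mult.assoc)
qed

lemma lin_single [simp]: "lin k (\<lambda>x. if x = a then c else 0) = (\<lambda>z. c * k a z)"
proof
  show "lin k (\<lambda>x. if x = a then c else 0) z = c * k a z" for z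
    by (subst lin_superset[of "{a}"]) auto
qed

lemma lin_closed:
  assumes "f \<in> fin_on A" and "\<And>a. a \<in> A \<Longrightarrow> k a \<in> fin_on B" shows "lin k f \<in> fin_on B"
  using assms(1)
proof (induction rule: fin_on_induct)
  case (add g a c)
  then show ?case using assms(2)[of a] lin_add[of g A "\<lambda>x. if x = a then c else 0" k] by simp
qed simp

lemma carrier_free_algebra [simp]: "carrier (free_algebra S) = fin_on (lists S)"
  by (simp add: free_algebra_def fin_on_def)

lemma add_free_algebra [simp]: "f \<oplus>\<^bsub>free_algebra S\<^esub> g = (\<lambda>w. f w + g w)"
  by (simp add: free_algebra_def)

lemma zero_free_algebra [simp]: "\<zero>\<^bsub>free_algebra S\<^esub> = (\<lambda>w. 0)"
  by (simp add: free_algebra_def)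

lemma one_free_algebra: "\<one>\<^bsub>free_algebra S\<^esub> = word_monom 1 []"
  by (simp add: free_algebra_def word_monom_def)

lemma uminus_free_algebra:
  assumes "f \<in> fin_on (lists S)" shows "\<ominus>\<^bsub>free_algebra S\<^esub> f = (\<lambda>w. - f w)"
proof -
  interpret ring "free_algebra S" by (rule free_algebra_ring)
  show ?thesis by (rule minus_equality) (use assms in simp_all)
qed

lemma minus_free_algebra:
  "g \<in> fin_on (lists S) \<Longrightarrow> f \<ominus>\<^bsub>free_algebra S\<^esub> g = (\<lambda>w. f w - g w)"
  by (simp add: a_minus_def uminus_free_algebra)

lemma word_monom_fin_on [simp]: "u \<in> lists S \<Longrightarrow> word_monom c u \<in> fin_on (lists S)"
  using word_monom_closed by simp

lemma word_monom_mult: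
  "word_monom c u \<otimes>\<^bsub>free_algebra S\<^esub> g =
     (\<lambda>w. if take (length u) w = u then c * g (drop (length u) w) else 0)"
proof
  fix w
  have "(word_monom c u \<otimes>\<^bsub>free_algebra S\<^esub> g) w =
      (\<Sum>k\<le>length w. (if take k w = u then c else 0) * g (drop k w))"
    by (simp add: free_algebra_def word_monom_def)
  \<comment> \<open>If \<open>w\<close> is shorter than \<open>u\<close>, no \<open>k\<close> in the
    range equals \<open>length u\<close>, and \<open>take (length u) w = u\<close> fails as
    well.\<close>
  also have "\<dots> = (\<Sum>k\<le>length w. if k = length u then
      (if take (length u) w = u then c * g (drop (length u) w) else 0) else 0)"
    by (intro sum.cong) auto
  also have "\<dots> = (if take (length u) w = u then c * g (drop (length u) w) else 0)"
    by (auto simp: sum.delta)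
  finally show "(word_monom c u \<otimes>\<^bsub>free_algebra S\<^esub> g) w =
      (if take (length u) w = u then c * g (drop (length u) w) else 0)" .
qed

lemma word_monom_mult_word_monom [simp]:
  "word_monom c u \<otimes>\<^bsub>free_algebra S\<^esub> word_monom d v = word_monom (c * d) (u @ v)"
proof -
  have "(take (length u) w = u \<and> drop (length u) w = v) = (w = u @ v)" for w
    by (metis append_eq_conv_conj append_take_drop_id)
  then show ?thesis unfolding word_monom_mult by (auto simp: word_monom_def fun_eq_iff)
qed

lemma scalar_mult [simp]: "word_monom c [] \<otimes>\<^bsub>free_algebra S\<^esub> g = (\<lambda>w. c * g w)"
  unfolding word_monom_mult by simp

text \<open>Since \<open>q\<close> abbreviates \<open>[:0, 1:]\<close>, these rules would multiply
  out every product with \<open>q\<close>; without them \<open>q\<close> behaves as an atom.\<close>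

declare mult_pCons_left [simp del] mult_pCons_right [simp del]

section \<open>The action on the module of a quotient\<close>

lemma module_basis_fin_on [simp]: "x \<in> A \<Longrightarrow> module_basis x \<in> fin_on A"
  unfolding module_basis_def by simp

lemma gen_act_lin: "gen_act G S H s = lin (gen_act_basis G S H s)"
  by (simp add: gen_act_def lin_def fun_eq_iff)

lemma free_act_lin: "free_act G S H f v = lin (\<lambda>u. foldr (gen_act G S H) u v) f"
  by (simp add: free_act_def lin_def)

lemma alternating_even: "alternating (2 * n) s t = concat (replicate n [s, t])"
  by (induction n) auto

context coxeter_system
begin

lemma hecke_relators_carrier: "hecke_relators G S \<subseteq> carrier (free_algebra S)"
proof -
  interpret F: ring "free_algebra S" by (rule free_algebra_ring)
  show ?thesis
    unfolding hecke_relators_def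
    by (intro Un_least subsetI; elim CollectE exE conjE)
      (simp_all only:, (intro F.minus_closed F.m_closed F.a_closed F.one_closed word_monom_closed;
        simp add: alternating_lists)+)
qed

lemma hecke_ideal_ideal: "ideal (hecke_ideal G S) (free_algebra S)"
  unfolding hecke_ideal_def using ring.genideal_ideal[OF free_algebra_ring hecke_relators_carrier] .

end

context even_quasiparabolic
begin

abbreviation V where "V \<equiv> fin_on X"
abbreviation gact where "gact \<equiv> gen_act G S H"
abbreviation fr_act where "fr_act \<equiv> free_act G S H"
abbreviation T where "T u \<equiv> foldr gact u"

lemma gact_basis: "gact s (module_basis x) = gen_act_basis G S H s x"
  by (simp add: gen_act_lin module_basis_def)

lemma gact_up: 
  "s \<in> S \<Longrightarrow> x \<in> X \<Longrightarrow> ht (act s x) = ht x + 1 \<Longrightarrow> gact s (module_basis x) = module_basis (act s x)"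
  by (simp add: gact_basis gen_act_basis_def)

lemma gact_down: 
  "s \<in> S \<Longrightarrow> x \<in> X \<Longrightarrow> ht (act s x) = ht x - 1 \<Longrightarrow>
    gact s (module_basis x) = (\<lambda>z. (q - 1) * module_basis x z + q * module_basis (act s x) z)"
  by (simp add: gact_basis gen_act_basis_def)

lemma gen_act_basis_closed: 
  assumes "s \<in> S" "x \<in> X" shows "gen_act_basis G S H s x \<in> V"
  using ht_step_cases[OF assms] gact_up[OF assms] gact_down[OF assms] assms
  unfolding gact_basis by auto

lemma gact_closed [simp]: "s \<in> S \<Longrightarrow> v \<in> V \<Longrightarrow> gact s v \<in> V"
  unfolding gen_act_lin by (erule lin_closed) (rule gen_act_basis_closed)

lemma gact_add: "v \<in> V \<Longrightarrow> w \<in> V \<Longrightarrow> gact s (\<lambda>x. v x + w x) = (\<lambda>z. gact s v z + gact s w z)"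
  unfolding gen_act_lin by (rule lin_add)

lemma gact_scale: "v \<in> V \<Longrightarrow> gact s (\<lambda>x. c * v x) = (\<lambda>z. c * gact s v z)"
  unfolding gen_act_lin by (rule lin_scale)

lemma T_closed [simp]: "u \<in> lists S \<Longrightarrow> v \<in> V \<Longrightarrow> T u v \<in> V"
  by (induction u) auto

lemma T_add: "u \<in> lists S \<Longrightarrow> v \<in> V \<Longrightarrow> w \<in> V \<Longrightarrow> T u (\<lambda>x. v x + w x) = (\<lambda>z. T u v z + T u w z)"
  by (induction u) (auto simp: gact_add)

lemma T_scale: "u \<in> lists S \<Longrightarrow> v \<in> V \<Longrightarrow> T u (\<lambda>x. c * v x) = (\<lambda>z. c * T u v z)"
  by (induction u) (auto simp: gact_scale)

lemma T_zero: "u \<in> lists S \<Longrightarrow> T u (\<lambda>_. 0) = (\<lambda>_. 0)"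
  by (induction u) (auto simp: gen_act_lin)

lemma single_eq: "(if x = a then c else 0) = c * module_basis a x"
  by (auto simp: module_basis_def)

text \<open>On a basis vector T(x) only x and sx are involved, and one of them is one level above
  the other.\<close>

lemma gact_quadratic:
  assumes s: "s \<in> S" and "v \<in> V"
  shows "gact s (gact s v) = (\<lambda>z. (q - 1) * gact s v z + q * v z)"
  using assms(2)
proof (induction rule: fin_on_induct)
  case zero
  then show ?case by (simp add: gen_act_lin)
next
  case (add g x c)
  let ?b = "module_basis x"
  have "gact s (gact s ?b) = (\<lambda>z. (q - 1) * gact s ?b z + q * ?b z)"
    using ht_step_cases[OF s add(2)]
  proof
    assume up: "ht (act s x) = ht x + 1"
    then show ?thesis using s add(2) by (simp add: gact_up gact_down)
  next
    assume down: "ht (act s x) = ht x - 1"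
    then show ?thesis using s add(2) by (simp add: gact_up gact_down gact_add gact_scale)
  qed
  then show ?case unfolding single_eq using add s by (simp add: gact_add gact_scale algebra_simps)
qed

text \<open>The vectors on which the two sides of a braid relation agree form a submodule for the two
  generators involved; hence it suffices to check the relation at the bottom of a dihedral orbit.\<close>

lemma braid_step:
  assumes S: "c \<in> S" "d \<in> S" and v: "v \<in> V"
    and last: "alternating (Suc n) c d = alternating n c d @ [a]"
    and eq: "T (alternating (Suc n) c d) v = T (alternating (Suc n) d c) v"
  shows "T (alternating (Suc n) c d) (gact a v) = T (alternating (Suc n) d c) (gact a v)"
proof -
  define E where "E = alternating n c d"
  have E: "E \<in> lists S" using S by (simp add: E_def alternating_lists)
  have "a \<in> set (alternating (Suc n) c d)" unfolding last by simp
  then have a: "a \<in> S" using set_alternating[of "Suc n" c d] S by blast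
  have F: "alternating (Suc n) d c = d # E" by (simp add: E_def)
  note E' = last[folded E_def]
  \<comment> \<open>Read in this way, the hypothesis lets \<open>T E\<close> turn the letter
    \<open>a\<close> on the right into \<open>d\<close> on the left; the quadratic relations of
    \<open>a\<close> and \<open>d\<close> have the same coefficients.\<close>
  have eq': "T E (gact a v) = gact d (T E v)" using eq unfolding E' F by simp
  have "T (alternating (Suc n) c d) (gact a v) = T E (gact a (gact a v))" unfolding E' by simp
  also have "\<dots> = (\<lambda>z. (q - 1) * T E (gact a v) z + q * T E v z)"
    using E a v by (simp add: gact_quadratic T_add T_scale)
  also have "\<dots> = (\<lambda>z. (q - 1) * gact d (T E v) z + q * T E v z)" unfolding eq' ..
  also have "\<dots> = gact d (gact d (T E v))" using E S v by (simp add: gact_quadratic)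
  also have "\<dots> = T (alternating (Suc n) d c) (gact a v)" unfolding F by (simp add: eq')
  finally show ?thesis .
qed

lemma braid_stable:
  assumes S: "s \<in> S" "t \<in> S" and v: "v \<in> V" and a: "a \<in> {s, t}"
    and eq: "T (alternating k s t) v = T (alternating k t s) v"
  shows "T (alternating k s t) (gact a v) = T (alternating k t s) (gact a v)"
proof (cases k)
  case (Suc n)
  \<comment> \<open>One of the two words ends with s and the other with t, so one of them ends with
    \<open>a\<close>.\<close>
  have "alternating (Suc n) s t = alternating n s t @ [a] \<or> alternating (Suc n) t s = alternating n t s @ [a]"
    using alternating_snoc[of n s t] alternating_snoc[of n t s] a by (auto split: if_splits)
  then show ?thesis
    using braid_step[OF S v, of n a] braid_step[OF S(2,1) v, of n a] eq Suc by metis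
qed simp

lemma braid_stable_word:
  assumes S: "s \<in> S" "t \<in> S" and v: "v \<in> V"
    and eq: "T (alternating k s t) v = T (alternating k t s) v"
  shows "u \<in> lists {s, t} \<Longrightarrow> T (alternating k s t) (T u v) = T (alternating k t s) (T u v)"
proof (induction u)
  case (Cons a u)
  then have "u \<in> lists S" using S by auto
  then show ?case using Cons braid_stable[OF S, of "T u v" a k] v by simp
qed (use eq in simp)

text \<open>Blocks of length k are exchanged one by one. For odd k the next block starts with the
  other letter, which the induction hypothesis makes harmless.\<close>

lemma braid_multiple:
  assumes S: "s \<in> S" "t \<in> S" and v: "v \<in> V"
    and eq: "T (alternating k s t) v = T (alternating k t s) v"
  shows "T (alternating (k * j) s t) v = T (alternating (k * j) t s) v"
proof (induction j)
  case (Suc j)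
  have "T (alternating (k + k * j) s t) v = T (alternating k s t) (T (alternating (k * j) s t) v)"
    using Suc by (simp add: alternating_add)
  also have "\<dots> = T (alternating k t s) (T (alternating (k * j) s t) v)"
    by (rule braid_stable_word[OF S v eq]) (simp add: alternating_lists)
  also have "\<dots> = T (alternating (k + k * j) t s) v" using Suc by (simp add: alternating_add)
  finally show ?case by simp
qed simp

text \<open>Every letter raises the height by one, so no coefficients in \<open>q\<close> arise and
  the result is a single basis vector.\<close>

lemma T_from_bottom:
  assumes max: "dihedral_max s t x k" and "i \<le> k"
  shows "T (alternating i s t) (module_basis (alt k s t x)) = module_basis (alt (k - i) t s x) \<and>
         T (alternating i t s) (module_basis (alt k s t x)) = module_basis (alt (k - i) s t x)"
  using assms(2)
proof (induction i)
  case 0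
  then show ?case using dihedral_max_bottom[OF max] by simp
next
  case (Suc i)
  note f = dihedral_max_facts[OF max]
  have ki: "k - i = Suc (k - Suc i)" using Suc.prems by simp
  have up: "gact a (module_basis (alt (Suc j) a b x)) = module_basis (alt j b a x)"
    if "a \<in> S" "b \<in> S" "ht (alt (Suc j) a b x) + 1 = ht (alt j b a x)" for a b j
    using that f gact_up[of a "alt (Suc j) a b x"] by (simp add: act_alt_Suc)
  have "gact s (module_basis (alt (k - i) s t x)) = module_basis (alt (k - Suc i) t s x)"
    "gact t (module_basis (alt (k - i) t s x)) = module_basis (alt (k - Suc i) s t x)"
    unfolding ki using f dihedral_max_ht[OF max, of "k - i"] dihedral_max_ht[OF max, of "k - Suc i"] ki
    by (intro up; simp)+
  then show ?case using Suc by simp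
qed

text \<open>At the bottom both words of length k give T(x) for the top x. Stability carries this
  relation to the whole orbit, and divisibility of m(s,t) by k turns it into the braid
  relation.\<close>

lemma braid_on_orbit:
  assumes max: "dihedral_max s t x k" and z: "z \<in> dihedral_orbit G H s t x"
  shows "T (alternating (cox_m G s t) s t) (module_basis z) = T (alternating (cox_m G s t) t s) (module_basis z)"
proof -
  note f = dihedral_max_facts[OF max]
  let ?y = "alt k s t x"
  have eq: "T (alternating k s t) (module_basis ?y) = T (alternating k t s) (module_basis ?y)"
    using T_from_bottom[OF max, of k] f by simp
  obtain i where i: "i \<le> k" "z = alt i s t x \<or> z = alt i t s x"
    using z unfolding dihedral_max_orbit[OF max] by auto
  have "\<exists>u\<in>lists {s, t}. T u (module_basis ?y) = module_basis z"
    using i(2)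
  proof
    assume "z = alt i s t x"
    then show ?thesis using T_from_bottom[OF max, of "k - i"] i(1)
      by (intro bexI[of _ "alternating (k - i) t s"] alternating_lists) simp_all
  next
    assume "z = alt i t s x"
    then show ?thesis using T_from_bottom[OF max, of "k - i"] i(1)
      by (intro bexI[of _ "alternating (k - i) s t"] alternating_lists) simp_all
  qed
  then obtain u where "u \<in> lists {s, t}" "T u (module_basis ?y) = module_basis z" by blast
  then have "T (alternating k s t) (module_basis z) = T (alternating k t s) (module_basis z)"
    using braid_stable_word[OF f(1,2) _ eq] f by force
  from braid_multiple[OF f(1,2) _ this, of "cox_m G s t div k"]
  show ?thesis using dihedral_max_dvd[OF max] z i f by auto
qed

text \<open>Without a top in the orbit an ascent from \<open>z\<close> could always be continued:
  the letter just used is a descent, so the other one leads up. But (st)^m = 1 brings the path back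
  to \<open>z\<close> after 2m steps.\<close>

lemma ex_orbit_max:
  assumes S: "s \<in> S" "t \<in> S" and m: "cox_m G s t \<noteq> 0" and z: "z \<in> X"
  shows "\<exists>x k. dihedral_max s t x k \<and> z \<in> dihedral_orbit G H s t x"
proof -
  have "\<exists>x. x \<in> X \<and> s \<in> verts x \<and> t \<in> verts x \<and> (\<exists>u\<in>lists {s, t}. x = act (word_prod G u) z)"
  proof (rule ccontr)
    assume no: "\<not> ?thesis"
    have notop: "\<not> (s \<in> verts (alt n a b z) \<and> t \<in> verts (alt n a b z))" if "{a, b} = {s, t}" for n a b
    proof -
      have "a \<in> {s, t}" "b \<in> {s, t}" using that by auto
      then have "alternating n a b \<in> lists {s, t}" "a \<in> S" "b \<in> S" using S by (auto simp: alternating_lists)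
      then show ?thesis using no z unfolding alt_def by (metis act_closed word_closed alternating_lists)
    qed
    have step: "ht (act a y) = ht y + 1 \<and> a \<in> verts (act a y)" if "a \<in> S" "y \<in> X" "a \<notin> verts y" for a y
      using that ht_step_cases[of a y] by (auto simp: verts_iff)
    have "\<exists>a b. {a, b} = {s, t} \<and> ht (alt n a b z) = ht z + int n \<and> (n \<noteq> 0 \<longrightarrow> a \<in> verts (alt n a b z))" for n
    proof (induction n)
      case 0
      show ?case using z by (intro exI[of _ s] exI[of _ t]) simp
    next
      case (Suc n)
      then obtain a b where ab: "{a, b} = {s, t}" "ht (alt n a b z) = ht z + int n"
        "n \<noteq> 0 \<longrightarrow> a \<in> verts (alt n a b z)" by blast
      have abS: "a \<in> S" "b \<in> S" using ab(1) S by auto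
      \<comment> \<open>Only at the start is the ascending letter undetermined, which is why the
        order of the pair is existentially quantified in the induction.\<close>
      have "\<exists>c d. {c, d} = {s, t} \<and> alt n d c z = alt n a b z \<and> c \<notin> verts (alt n a b z)"
      proof (cases "n = 0")
        case True
        then have "alt n a b z = z" using z by simp
        then have "s \<notin> verts z \<or> t \<notin> verts z" using notop[OF ab(1), of n] by simp
        then show ?thesis
        proof
          assume "s \<notin> verts z"
          then show ?thesis using True z by (intro exI[of _ s] exI[of _ t]) simp
        next
          assume "t \<notin> verts z"
          then show ?thesis using True z by (intro exI[of _ t] exI[of _ s]) auto
        qed
      next
        case False
        then have "b \<notin> verts (alt n a b z)" using notop[OF ab(1), of n] ab by (auto simp: doubleton_eq_iff)
        moreover have "{b, a} = {s, t}" using ab(1) by (simp add: insert_commute)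
        ultimately show ?thesis by blast
      qed
      then obtain c d where cd: "{c, d} = {s, t}" "alt n d c z = alt n a b z" "c \<notin> verts (alt n a b z)" by blast
      then have cS: "c \<in> S" "d \<in> S" using S by auto
      then have "alt (Suc n) c d z = act c (alt n a b z)" using cd(2) z by (simp add: alt_Suc)
      with step[OF cS(1) _ cd(3)] show ?case using cd(1) ab(2) abS z
        by (intro exI[of _ c] exI[of _ d]) simp
    qed
    from this[of "2 * cox_m G s t"] obtain a b where ab: "{a, b} = {s, t}"
        "ht (alt (2 * cox_m G s t) a b z) = ht z + int (2 * cox_m G s t)"
      by (elim exE conjE)
    then have S': "a \<in> S" "b \<in> S" "cox_m G a b = cox_m G s t"
      using S cox_m_commute by (auto simp: doubleton_eq_iff)
    then have "(a \<otimes> b) [^] cox_m G s t = \<one>" using pow_eq_one_iff by simp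
    then have "alt (2 * cox_m G s t) a b z = z"
      using S' z by (simp add: alt_def alternating_even word_prod_replicate)
    then show False using ab m by simp
  qed
  then obtain x u where x: "x \<in> X" "s \<in> verts x" "t \<in> verts x" "u \<in> lists {s, t}" "x = act (word_prod G u) z"
    by blast
  have u: "u \<in> lists S" using x S by auto
  then have "z = act (word_prod G (rev u)) x" using x z by (simp add: word_rev)
  moreover have "word_prod G (rev u) \<in> generate G {s, t}"
    using generate_words[of "{s, t}"] S x(4) rev_lists[of u] by blast
  ultimately have "z \<in> dihedral_orbit G H s t x" by (auto simp: dihedral_orbit_def orbit_def)
  then show ?thesis using ex_dihedral_max[OF x(1-3)] by blast
qed

lemma braid_relation:
  assumes S: "s \<in> S" "t \<in> S" and m: "cox_m G s t \<noteq> 0" and "v \<in> V"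
  shows "T (alternating (cox_m G s t) s t) v = T (alternating (cox_m G s t) t s) v"
  using assms(4)
proof (induction rule: fin_on_induct)
  case zero
  then show ?case using S by (simp add: T_zero alternating_lists)
next
  case (add g z c)
  have "T (alternating (cox_m G s t) s t) (module_basis z) = T (alternating (cox_m G s t) t s) (module_basis z)"
    using ex_orbit_max[OF S m add(2)] braid_on_orbit by blast
  then show ?case unfolding single_eq using add S by (simp add: T_add T_scale alternating_lists)
qed

section \<open>The action of the free algebra and of its quotient\<close>

lemma fr_act_monom [simp]: "fr_act (word_monom c u) v = (\<lambda>z. c * T u v z)"
  by (simp add: free_act_lin word_monom_def)

lemma fr_act_add: 
  "f \<in> fin_on (lists S) \<Longrightarrow> g \<in> fin_on (lists S) \<Longrightarrow> fr_act (\<lambda>w. f w + g w) v = (\<lambda>z. fr_act f v z + fr_act g v z)"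
  unfolding free_act_lin by (rule lin_add)

lemma fr_act_zero [simp]: "fr_act (\<lambda>_. 0) v = (\<lambda>_. 0)"
  by (simp add: free_act_lin)

lemma fr_act_scale: 
  "f \<in> fin_on (lists S) \<Longrightarrow> fr_act (\<lambda>w. c * f w) v = (\<lambda>z. c * fr_act f v z)"
  unfolding free_act_lin by (rule lin_scale)

lemma fr_act_diff: 
  "f \<in> fin_on (lists S) \<Longrightarrow> g \<in> fin_on (lists S) \<Longrightarrow> fr_act (\<lambda>w. f w - g w) v = (\<lambda>z. fr_act f v z - fr_act g v z)"
  using fr_act_add[of f "\<lambda>w. (- 1) * g w" v] fr_act_scale[of g "-1" v] by simp

lemma fr_act_closed [simp]: "f \<in> fin_on (lists S) \<Longrightarrow> v \<in> V \<Longrightarrow> fr_act f v \<in> V"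
  unfolding free_act_lin by (erule lin_closed) simp

lemma single_monom: "(if w = u then c else 0) = word_monom c u w"
  by (simp add: word_monom_def)

lemma fr_act_null: "f \<in> fin_on (lists S) \<Longrightarrow> fr_act f (\<lambda>_. 0) = (\<lambda>_. 0)"
  by (induction rule: fin_on_induct) (simp_all add: single_monom fr_act_add T_zero)

lemma fr_act_monom_mult:
  assumes u: "u \<in> lists S" and v: "v \<in> V" and "g \<in> fin_on (lists S)"
  shows "fr_act (word_monom c u \<otimes>\<^bsub>free_algebra S\<^esub> g) v = (\<lambda>z. c * T u (fr_act g v) z)"
  using assms(3)
proof (induction rule: fin_on_induct)
  case zero
  interpret F: ring "free_algebra S" by (rule free_algebra_ring)
  show ?case using F.r_null[of "word_monom c u"] u by (simp add: T_zero)
next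
  case (add g w d)
  interpret F: ring "free_algebra S" by (rule free_algebra_ring)
  have "word_monom c u \<otimes>\<^bsub>free_algebra S\<^esub> (\<lambda>x. g x + word_monom d w x) =
      (\<lambda>x. (word_monom c u \<otimes>\<^bsub>free_algebra S\<^esub> g) x + word_monom (c * d) (u @ w) x)"
    using F.r_distr[of g "word_monom d w" "word_monom c u"] add u by simp
  moreover have "word_monom c u \<otimes>\<^bsub>free_algebra S\<^esub> g \<in> fin_on (lists S)"
    using F.m_closed[of "word_monom c u" g] add u by simp
  ultimately show ?case unfolding single_monom using add u v
    by (simp add: fr_act_add T_add T_scale algebra_simps)
qed

lemma fr_act_mult:
  assumes "f \<in> fin_on (lists S)" and g: "g \<in> fin_on (lists S)" and v: "v \<in> V" 
  shows "fr_act (f \<otimes>\<^bsub>free_algebra S\<^esub> g) v = fr_act f (fr_act g v)"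
  using assms(1)
proof (induction rule: fin_on_induct)
  case zero
  interpret F: ring "free_algebra S" by (rule free_algebra_ring)
  show ?case using F.l_null[of g] g by simp
next
  case (add f u c)
  interpret F: ring "free_algebra S" by (rule free_algebra_ring)
  have "(\<lambda>x. f x + word_monom c u x) \<otimes>\<^bsub>free_algebra S\<^esub> g =
      (\<lambda>x. (f \<otimes>\<^bsub>free_algebra S\<^esub> g) x + (word_monom c u \<otimes>\<^bsub>free_algebra S\<^esub> g) x)"
    using F.l_distr[of f "word_monom c u" g] add g by simp
  moreover have "f \<otimes>\<^bsub>free_algebra S\<^esub> g \<in> fin_on (lists S)" "word_monom c u \<otimes>\<^bsub>free_algebra S\<^esub> g \<in> fin_on (lists S)"
    using F.m_closed[of _ g] add g by simp_all
  ultimately show ?case unfolding single_monom using add g v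
    by (simp add: fr_act_add fr_act_monom_mult)
qed

text \<open>The elements killing all of \<open>V\<close> form the kernel of a representation, hence
  a two-sided ideal, and it contains the relators. Killing one fixed vector would give a left ideal
  only.\<close>

lemma hecke_ideal_acts_trivially:
  assumes "f \<in> hecke_ideal G S" "v \<in> V" shows "fr_act f v = (\<lambda>_. 0)"
proof -
  interpret F: ring "free_algebra S" by (rule free_algebra_ring)
  let ?K = "{f \<in> fin_on (lists S). \<forall>v\<in>V. fr_act f v = (\<lambda>_. 0)}"
  have "ideal ?K (free_algebra S)"
  proof (rule idealI)
    show "subgroup ?K (add_monoid (free_algebra S))"
    proof (rule F.add.subgroupI)
      have "(\<lambda>_. 0) \<in> ?K" by simp
      then show "?K \<noteq> {}" by blast
    next
      fix f assume f: "f \<in> ?K"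
      then have "\<ominus>\<^bsub>free_algebra S\<^esub> f = (\<lambda>w. 0 - f w)"
        using uminus_free_algebra[of f S] by simp
      moreover have "fr_act (\<lambda>w. 0 - f w) v = (\<lambda>_. 0)" if "v \<in> V" for v
        using fr_act_diff[of "\<lambda>_. 0" f v] f that by simp
      moreover have "(\<lambda>w. 0 - f w) \<in> fin_on (lists S)" using f by simp
      ultimately show "\<ominus>\<^bsub>free_algebra S\<^esub> f \<in> ?K" by simp
    qed (auto simp: fr_act_add)
  next
    fix f g assume "f \<in> ?K" "g \<in> carrier (free_algebra S)"
    then show "g \<otimes>\<^bsub>free_algebra S\<^esub> f \<in> ?K" "f \<otimes>\<^bsub>free_algebra S\<^esub> g \<in> ?K"
      using F.m_closed[of g f] F.m_closed[of f g] by (simp_all add: fr_act_mult fr_act_null)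
  qed (rule free_algebra_ring)
  moreover have "hecke_relators G S \<subseteq> ?K"
  proof
    fix f assume f: "f \<in> hecke_relators G S"
    have "fr_act f v = (\<lambda>_. 0)" if v: "v \<in> V" for v
      using f unfolding hecke_relators_def
    proof (elim UnE CollectE exE conjE)
      fix s t assume "s \<in> S" "t \<in> S" "cox_m G s t \<noteq> 0"
        "f = word_monom 1 (alternating (cox_m G s t) s t) \<ominus>\<^bsub>free_algebra S\<^esub> word_monom 1 (alternating (cox_m G s t) t s)"
      then show ?thesis using v braid_relation[of s t v]
        by (simp add: minus_free_algebra fr_act_diff alternating_lists)
    next
      fix s assume s: "s \<in> S" and f: "f = (word_monom 1 [s] \<ominus>\<^bsub>free_algebra S\<^esub> word_monom q [])
        \<otimes>\<^bsub>free_algebra S\<^esub> (word_monom 1 [s] \<oplus>\<^bsub>free_algebra S\<^esub> \<one>\<^bsub>free_algebra S\<^esub>)"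
      have "fr_act f v = fr_act (\<lambda>w. word_monom 1 [s] w - word_monom q [] w)
          (fr_act (\<lambda>w. word_monom 1 [s] w + word_monom 1 [] w) v)"
        unfolding f using s v by (simp add: fr_act_mult minus_free_algebra one_free_algebra)
      also have "\<dots> = (\<lambda>_. 0)"
        using s v by (simp add: fr_act_diff fr_act_add gact_add gact_quadratic algebra_simps)
      finally show ?thesis .
    qed
    then show "f \<in> ?K" using f hecke_relators_carrier by auto
  qed
  ultimately have "hecke_ideal G S \<subseteq> ?K" unfolding hecke_ideal_def by (rule F.genideal_minimal)
  then show ?thesis using assms by blast
qed

end

section \<open>Left ideals of the Hecke algebra\<close>

context coxeter_system
begin

abbreviation R where "R \<equiv> hecke G S"
abbreviation F where "F \<equiv> free_algebra S"
abbreviation words where "words \<equiv> lists S"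

definition cl :: "('a list \<Rightarrow> int poly) \<Rightarrow> ('a list \<Rightarrow> int poly) set" where
  "cl f = hecke_ideal G S +>\<^bsub>F\<^esub> f"

lemma cl_hom: "ring_hom_ring F R cl"
  using ideal.rcos_ring_hom_ring[OF hecke_ideal_ideal] unfolding cl_def hecke_def .

lemma cl_closed [simp]: "f \<in> fin_on words \<Longrightarrow> cl f \<in> carrier R"
  using ring_hom_ring.homh[OF cl_hom] by (simp add: ring_hom_closed)

lemma cl_add: "f \<in> fin_on words \<Longrightarrow> g \<in> fin_on words \<Longrightarrow> cl (\<lambda>w. f w + g w) = cl f \<oplus>\<^bsub>R\<^esub> cl g"
  using ring_hom_add[OF ring_hom_ring.homh[OF cl_hom], of f g] by simp

lemma cl_mult: "f \<in> fin_on words \<Longrightarrow> g \<in> fin_on words \<Longrightarrow> cl (f \<otimes>\<^bsub>F\<^esub> g) = cl f \<otimes>\<^bsub>R\<^esub> cl g"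
  using ring_hom_mult[OF ring_hom_ring.homh[OF cl_hom], of f g] by simp

lemma cl_one: "cl (word_monom 1 []) = \<one>\<^bsub>R\<^esub>"
  using ring_hom_one[OF ring_hom_ring.homh[OF cl_hom]] by (simp add: one_free_algebra)

lemma cl_zero: "cl (\<lambda>_. 0) = \<zero>\<^bsub>R\<^esub>"
  using ring_hom_zero[OF ring_hom_ring.homh[OF cl_hom] free_algebra_ring hecke_ring] by simp

lemma cl_diff:
  assumes "f \<in> fin_on words" "g \<in> fin_on words" 
  shows "cl (\<lambda>w. f w - g w) = cl f \<ominus>\<^bsub>R\<^esub> cl g"
proof -
  interpret R: ring R by (rule hecke_ring)
  have "cl (\<lambda>w. f w - g w) \<oplus>\<^bsub>R\<^esub> cl g = cl f"
    using cl_add[of "\<lambda>w. f w - g w" g] assms by simp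
  then have "cl f \<ominus>\<^bsub>R\<^esub> cl g = cl (\<lambda>w. f w - g w) \<oplus>\<^bsub>R\<^esub> cl g \<ominus>\<^bsub>R\<^esub> cl g" by simp
  also have "\<dots> = cl (\<lambda>w. f w - g w)"
    using cl_closed[OF fin_on_diff[OF assms]] cl_closed[OF assms(2)]
    by (simp only: R.minus_eq R.a_assoc R.a_inv_closed R.r_neg R.r_zero)
  finally show ?thesis by simp
qed

lemma carrier_hecke:
  assumes "a \<in> carrier R" obtains f where "f \<in> fin_on words" "a = cl f"
  using assms by (auto simp: hecke_def FactRing_def A_RCOSETS_def' cl_def)

lemma cl_ideal_eq_0: "f \<in> hecke_ideal G S \<Longrightarrow> cl f = \<zero>\<^bsub>R\<^esub>"
proof -
  assume f: "f \<in> hecke_ideal G S"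
  interpret ideal "hecke_ideal G S" F by (rule hecke_ideal_ideal)
  show ?thesis using a_rcos_const[OF f] by (simp add: cl_def hecke_def FactRing_def)
qed

lemma relator_in_ideal: "f \<in> hecke_relators G S \<Longrightarrow> f \<in> hecke_ideal G S"
  unfolding hecke_ideal_def
  using ring.genideal_self[OF free_algebra_ring hecke_relators_carrier] by blast

lemma cl_eqI:
  assumes "f \<in> fin_on words" "g \<in> fin_on words" "cl (\<lambda>w. f w - g w) = \<zero>\<^bsub>R\<^esub>" 
  shows "cl f = cl g"
proof -
  interpret R: ring R by (rule hecke_ring)
  have "cl f \<ominus>\<^bsub>R\<^esub> cl g = \<zero>\<^bsub>R\<^esub>" using assms(3) unfolding cl_diff[OF assms(1,2)] .
  then show ?thesis using R.r_right_minus_eq[OF cl_closed cl_closed] assms(1,2) by blast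
qed

lemma cl_braid:
  assumes "s \<in> S" "t \<in> S" "s \<noteq> t" "cox_m G s t \<noteq> 0"
  shows "cl (word_monom 1 (alternating (cox_m G s t) s t)) = cl (word_monom 1 (alternating (cox_m G s t) t s))"
    (is "cl ?f = cl ?g")
proof (rule cl_eqI)
  show f: "?f \<in> fin_on words" and g: "?g \<in> fin_on words" using assms by (simp_all add: alternating_lists)
  have "?f \<ominus>\<^bsub>F\<^esub> ?g \<in> hecke_relators G S" unfolding hecke_relators_def using assms by blast
  then show "cl (\<lambda>w. ?f w - ?g w) = \<zero>\<^bsub>R\<^esub>"
    using cl_ideal_eq_0[OF relator_in_ideal] minus_free_algebra[OF g] by simp
qed

lemma cl_quadratic:
  assumes s: "s \<in> S"
  shows "cl (word_monom 1 [s, s]) = cl (\<lambda>w. (q - 1) * word_monom 1 [s] w + q * word_monom 1 [] w)"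
proof (rule cl_eqI)
  show "word_monom 1 [s, s] \<in> fin_on words"
    "(\<lambda>w. (q - 1) * word_monom 1 [s] w + q * word_monom 1 [] w) \<in> fin_on words" using s by simp_all
  interpret F: ring F by (rule free_algebra_ring)
  let ?r = "(word_monom 1 [s] \<ominus>\<^bsub>F\<^esub> word_monom q []) \<otimes>\<^bsub>F\<^esub> (word_monom 1 [s] \<oplus>\<^bsub>F\<^esub> \<one>\<^bsub>F\<^esub>)"
  have "?r \<in> hecke_relators G S" unfolding hecke_relators_def using s by blast
  then have "cl ?r = \<zero>\<^bsub>R\<^esub>" by (intro cl_ideal_eq_0 relator_in_ideal)
  moreover have "?r = (\<lambda>w. word_monom 1 [s, s] w - ((q - 1) * word_monom 1 [s] w + q * word_monom 1 [] w))"
  proof -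
    have c: "word_monom c u \<in> carrier F" if "u \<in> words" for c u using that by simp
    have "word_monom 1 [s] \<ominus>\<^bsub>F\<^esub> word_monom q [] = (\<lambda>w. word_monom 1 [s] w + word_monom (- q) [] w)"
      using s by (auto simp: minus_free_algebra word_monom_def)
    then have "?r = (word_monom 1 [s] \<oplus>\<^bsub>F\<^esub> word_monom (- q) []) \<otimes>\<^bsub>F\<^esub> (word_monom 1 [s] \<oplus>\<^bsub>F\<^esub> word_monom 1 [])"
      by (simp add: one_free_algebra)
    also have "\<dots> = word_monom 1 [s] \<otimes>\<^bsub>F\<^esub> word_monom 1 [s] \<oplus>\<^bsub>F\<^esub> word_monom (- q) [] \<otimes>\<^bsub>F\<^esub> word_monom 1 [s]
        \<oplus>\<^bsub>F\<^esub> (word_monom 1 [s] \<otimes>\<^bsub>F\<^esub> word_monom 1 [] \<oplus>\<^bsub>F\<^esub> word_monom (- q) [] \<otimes>\<^bsub>F\<^esub> word_monom 1 [])"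
      using c s by (simp only: F.r_distr F.l_distr F.a_closed Cons_in_lists_iff lists.Nil simp_thms)
    also have "\<dots> = (\<lambda>w. word_monom 1 [s, s] w - ((q - 1) * word_monom 1 [s] w + q * word_monom 1 [] w))"
      by (simp only: word_monom_mult_word_monom add_free_algebra) (auto simp: word_monom_def algebra_simps)
    finally show ?thesis .
  qed
  ultimately show "cl (\<lambda>w. word_monom 1 [s, s] w - ((q - 1) * word_monom 1 [s] w + q * word_monom 1 [] w)) = \<zero>\<^bsub>R\<^esub>"
    by simp
qed

lemma word_prod_hecke: "u \<in> words \<Longrightarrow> word_prod R (map (hecke_gen G S) u) = cl (word_monom 1 u)"
proof (induction u)
  case (Cons s u)
  then have "cl (word_monom 1 (s # u)) = cl (word_monom 1 [s]) \<otimes>\<^bsub>R\<^esub> cl (word_monom 1 u)"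
    using cl_mult[of "word_monom 1 [s]" "word_monom 1 u"] by simp
  then show ?case using Cons by (simp add: hecke_gen_def cl_def)
qed (simp add: cl_one)

text \<open>Congruence modulo \<open>L\<close>, expressed on representatives in the free algebra,
  where sums and scalar multiples are pointwise. It is stable under multiplication from the
  left.\<close>

definition lcong :: "('a list \<Rightarrow> int poly) set set \<Rightarrow> ('a list \<Rightarrow> int poly) \<Rightarrow> ('a list \<Rightarrow> int poly) \<Rightarrow> bool" where
  "lcong L f g \<longleftrightarrow> f \<in> fin_on words \<and> g \<in> fin_on words \<and> cl (\<lambda>w. f w - g w) \<in> L"

context
  fixes L assumes L: "left_ideal L R"
begin

lemma left_ideal_add: "a \<in> L \<Longrightarrow> b \<in> L \<Longrightarrow> a \<oplus>\<^bsub>R\<^esub> b \<in> L"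
  using L additive_subgroup.a_closed by (auto simp: left_ideal_def)

lemma left_ideal_zero: "\<zero>\<^bsub>R\<^esub> \<in> L"
  using L additive_subgroup.zero_closed by (auto simp: left_ideal_def)

lemma left_ideal_mult: "r \<in> carrier R \<Longrightarrow> a \<in> L \<Longrightarrow> r \<otimes>\<^bsub>R\<^esub> a \<in> L"
  using L by (auto simp: left_ideal_def)

lemma lcong_eq: "f \<in> fin_on words \<Longrightarrow> g \<in> fin_on words \<Longrightarrow> cl f = cl g \<Longrightarrow> lcong L f g"
proof -
  assume a: "f \<in> fin_on words" "g \<in> fin_on words" "cl f = cl g"
  interpret R: ring R by (rule hecke_ring)
  have "cl (\<lambda>w. f w - g w) = \<zero>\<^bsub>R\<^esub>" using a by (simp add: cl_diff R.r_neg R.minus_eq)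
  then show ?thesis using a left_ideal_zero by (simp add: lcong_def)
qed

lemma lcong_refl: "f \<in> fin_on words \<Longrightarrow> lcong L f f"
  by (simp add: lcong_eq)

lemma lcong_trans: "lcong L f g \<Longrightarrow> lcong L g h \<Longrightarrow> lcong L f h"
  using cl_add[of "\<lambda>w. f w - g w" "\<lambda>w. g w - h w"] left_ideal_add
  unfolding lcong_def by (simp add: algebra_simps)

lemma lcong_add: "lcong L f g \<Longrightarrow> lcong L f' g' \<Longrightarrow> lcong L (\<lambda>w. f w + f' w) (\<lambda>w. g w + g' w)"
proof -
  assume a: "lcong L f g" "lcong L f' g'"
  then have "cl (\<lambda>w. (f w - g w) + (f' w - g' w)) \<in> L"
    using cl_add[of "\<lambda>w. f w - g w" "\<lambda>w. f' w - g' w"] left_ideal_add by (simp add: lcong_def)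
  then show ?thesis using a by (simp add: lcong_def algebra_simps)
qed

lemma lcong_mult:
  assumes "lcong L f g" and h: "h \<in> fin_on words" shows "lcong L (h \<otimes>\<^bsub>F\<^esub> f) (h \<otimes>\<^bsub>F\<^esub> g)"
proof -
  interpret F: ring F by (rule free_algebra_ring)
  interpret R: ring R by (rule hecke_ring)
  have f: "f \<in> fin_on words" "g \<in> fin_on words" "cl (\<lambda>w. f w - g w) \<in> L" using assms by (auto simp: lcong_def)
  have hf: "h \<otimes>\<^bsub>F\<^esub> f \<in> fin_on words" "h \<otimes>\<^bsub>F\<^esub> g \<in> fin_on words"
    using F.m_closed[of h f] F.m_closed[of h g] f h by simp_all
  have "cl (\<lambda>w. (h \<otimes>\<^bsub>F\<^esub> f) w - (h \<otimes>\<^bsub>F\<^esub> g) w) = cl h \<otimes>\<^bsub>R\<^esub> cl (\<lambda>w. f w - g w)"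
    using f h hf by (simp add: cl_diff cl_mult R.r_minus R.minus_eq R.r_distr)
  then show ?thesis using f h hf left_ideal_mult[of "cl h"] by (simp add: lcong_def)
qed

lemma lcong_scale: "lcong L f g \<Longrightarrow> lcong L (\<lambda>w. c * f w) (\<lambda>w. c * g w)"
  using lcong_mult[of f g "word_monom c []"] by simp

lemma lcong_sym: "lcong L f g \<Longrightarrow> lcong L g f"
  using lcong_scale[of f g "-1"] by (simp add: lcong_def algebra_simps)

lemma lcong_Cons:
  "s \<in> S \<Longrightarrow> lcong L (word_monom 1 u) (word_monom 1 v) \<Longrightarrow> lcong L (word_monom 1 (s # u)) (word_monom 1 (s # v))"
  using lcong_mult[of "word_monom 1 u" "word_monom 1 v" "word_monom 1 [s]"] by simp

end

end

section \<open>Minimal words of cosets\<close>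

context even_quasiparabolic
begin

text \<open>These are the reduced words of the shortest representatives of \<open>x\<close>: the
  length cannot drop below the height of the coset.\<close>

definition minword :: "'a set \<Rightarrow> 'a list \<Rightarrow> bool" where
  "minword x u \<longleftrightarrow> u \<in> words \<and> coset (word_prod G u) = x \<and> int (length u) = ht x"

lemma minword_words [simp]: "minword x u \<Longrightarrow> u \<in> words"
  by (simp add: minword_def)

lemma minword_X: "minword x u \<Longrightarrow> x \<in> X"
  unfolding minword_def using coset_in_X[OF word_closed] by blast

text \<open>Without \<open>s\<close> the word represents an element of sx, so the height of sx is at
  most that of x minus one, and it cannot be smaller.\<close>

lemma minword_Cons:
  assumes "minword x (s # u)" shows "s \<in> verts x" "minword (act s x) u"
proof -
  have s: "s \<in> S" and u: "u \<in> words" and x: "x = coset (s \<otimes> word_prod G u)" and l: "ht x = int (length u) + 1"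
    using assms by (auto simp: minword_def)
  have sx: "act s x = coset (word_prod G u)" using s u x by simp
  then have "ht (act s x) \<le> int (length u)"
    using ht_coset_le[OF word_closed[OF u]] len_le[OF u] by simp
  then have "ht (act s x) = ht x - 1" using ht_step_cases[OF s minword_X[OF assms]] l by auto
  then show "s \<in> verts x" "minword (act s x) u" using s u sx l by (simp_all add: verts_iff minword_def)
qed

lemma minword_ConsI:
  assumes "s \<in> S" "minword y u" "ht (act s y) = ht y + 1" shows "minword (act s y) (s # u)"
proof -
  have u: "u \<in> words" "int (length u) = ht y" and y: "y = coset (word_prod G u)"
    using assms(2) by (simp_all add: minword_def)
  have "act s y = coset (s \<otimes> word_prod G u)" unfolding y using assms(1) u by simp
  then show ?thesis using assms(1,3) u by (simp add: minword_def)
qed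

lemma ex_minword: 
  assumes "x \<in> X" shows "\<exists>u. minword x u"
proof -
  obtain w where w: "w \<in> carrier G" "x = coset w" "int (len w) = ht x" using ht_attained[OF assms] by metis
  then obtain u where "reduced_word G S u w" using ex_reduced by blast
  then show ?thesis using w by (auto simp: minword_def reduced_word_def)
qed

lemma ex_minword_vert:
  assumes "x \<in> X" "s \<in> verts x" shows "\<exists>u. minword x (s # u)"
proof -
  have s: "s \<in> S" "ht (act s x) = ht x - 1" using assms by (simp_all add: verts_iff)
  obtain u where u: "minword (act s x) u" using ex_minword[of "act s x"] s assms by auto
  have "act s (act s x) = x" using s assms by simp
  then show ?thesis using minword_ConsI[OF s(1) u] s(2) by auto
qed

text \<open>A minimal word of the bottom is prolonged along a chain to the top. The two chains give
  the two words of a braid move or of a dihedral generator.\<close>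

lemma minword_alternating:
  assumes max: "dihedral_max s t x k" and w: "minword (alt k s t x) w"
  shows "minword x (alternating k s t @ w)"
proof -
  note f = dihedral_max_facts[OF max]
  have "alt k s t (alt k s t x) = x" using alt_from_bottom[OF max, of k] f by simp
  moreover have y: "alt k s t x = coset (word_prod G w)" and "w \<in> words" using w by (simp_all add: minword_def)
  moreover have "alt k s t (coset (word_prod G w)) = coset (word_prod G (alternating k s t) \<otimes> word_prod G w)"
    unfolding alt_def using f w by (simp add: alternating_lists)
  ultimately have "coset (word_prod G (alternating k s t) \<otimes> word_prod G w) = x" by simp
  then show ?thesis using w f dihedral_max_ht(1)[OF max order.refl]
    by (simp add: minword_def alternating_lists)
qed

lemma minword_alternating':
  assumes max: "dihedral_max s t x k" and w: "minword (alt k s t x) w"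
  shows "minword x (alternating k t s @ w)"
  using minword_alternating[OF dihedral_max_sym[OF max]] w dihedral_max_bottom[OF max] by simp

lemma minword_reduced: "minword x u \<Longrightarrow> reduced_word G S u (word_prod G u)"
  using ht_coset_le[OF word_closed, of u] len_le[of u] by (auto simp: minword_def reduced_word_def)

lemma T_minword: "minword x u \<Longrightarrow> T u (module_basis H) = module_basis x"
proof (induction u arbitrary: x)
  case Nil
  then show ?case using lcos_mult_one[OF H_carrier] by (simp add: minword_def)
next
  case (Cons s u)
  note c = minword_Cons[OF Cons.prems]
  have s: "s \<in> S" "ht (act s x) = ht x - 1" using c by (simp_all add: verts_iff)
  have x: "x \<in> X" by (rule minword_X[OF Cons.prems])
  then have "act s (act s x) = x" using s by simp
  then show ?case using Cons.IH[OF c(2)] gact_up[of s "act s x"] s x by simp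
qed

lemma verts_nonempty:
  assumes "x \<in> X" "x \<noteq> H" shows "verts x \<noteq> {}"
proof -
  obtain u where u: "minword x u" using ex_minword[OF assms(1)] by blast
  have "u \<noteq> []" using u assms lcos_mult_one[OF H_carrier] by (auto simp: minword_def)
  then show ?thesis using minword_Cons(1)[of x "hd u" "tl u"] u by auto
qed

text \<open>A single congruent pair of words is enough in the second part, because words with the
  same first letter are identified by induction.\<close>

definition linked :: "('a list \<Rightarrow> int poly) set set \<Rightarrow> 'a set \<Rightarrow> ('a \<times> 'a) set" where
  "linked L x = Gamma_edges G S H x \<union>
     {(s, t). \<exists>u v. minword x (s # u) \<and> minword x (t # v) \<and> lcong L (word_monom 1 (s # u)) (word_monom 1 (t # v))}"

lemma linked_verts: "(s, t) \<in> linked L x \<Longrightarrow> s \<in> verts x"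
  using edges_verts minword_Cons(1) by (auto simp: linked_def)

text \<open>At an edge the chains have length m(s,t), so the two words over the bottom differ by a
  braid move and are equal already in the Hecke algebra.\<close>

lemma edge_lcong:
  assumes L: "left_ideal L R" and x: "x \<in> X" and e: "(s, t) \<in> Gamma_edges G S H x"
  shows "\<exists>u v. minword x (s # u) \<and> minword x (t # v) \<and> lcong L (word_monom 1 (s # u)) (word_monom 1 (t # v))"
proof -
  obtain k where max: "dihedral_max s t x k" using ex_dihedral_max[OF x] edges_verts[OF e] by blast
  note f = dihedral_max_facts[OF max]
  have k: "k = cox_m G s t" "s \<noteq> t" using e edges_iff[OF max] by auto
  obtain w where w: "minword (alt k s t x) w" using ex_minword[of "alt k s t x"] f by auto
  let ?u = "alternating k s t @ w" and ?v = "alternating k t s @ w"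
  have mw: "minword x ?u" "minword x ?v" using minword_alternating[OF max w] minword_alternating'[OF max w] .
  have split: "cl (word_monom 1 (alternating k a b @ w)) = cl (word_monom 1 (alternating k a b)) \<otimes>\<^bsub>R\<^esub> cl (word_monom 1 w)"
    if "a \<in> S" "b \<in> S" for a b
    using that w cl_mult[of "word_monom 1 (alternating k a b)" "word_monom 1 w"] by (simp add: alternating_lists)
  have "cl (word_monom 1 (alternating k s t)) = cl (word_monom 1 (alternating k t s))"
    using f k cl_braid[of s t] by simp
  then have "cl (word_monom 1 ?u) = cl (word_monom 1 ?v)" using split f by simp
  then have "lcong L (word_monom 1 ?u) (word_monom 1 ?v)"
    using lcong_eq[OF L word_monom_fin_on[OF minword_words[OF mw(1)]] word_monom_fin_on[OF minword_words[OF mw(2)]]]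
    by simp
  moreover obtain j where "k = Suc j" using f by (cases k) auto
  ultimately show ?thesis using mw by (intro exI[of _ "alternating j t s @ w"] exI[of _ "alternating j s t @ w"]) simp
qed

lemma minword_lcong:
  assumes L: "left_ideal L R"
    and conn: "\<And>x. x \<in> X \<Longrightarrow> x \<noteq> H \<Longrightarrow> \<exists>s. \<forall>t\<in>verts x. (s, t) \<in> (linked L x)\<^sup>*"
  shows "minword x u \<Longrightarrow> minword x v \<Longrightarrow> lcong L (word_monom 1 u) (word_monom 1 v)"
proof (induction "length u" arbitrary: x u v)
  case 0
  then have "u = []" "v = []" by (auto simp: minword_def)
  then show ?case using lcong_refl[OF L] by simp
next
  case (Suc n)
  note trans = lcong_trans[OF L]
  have x: "x \<in> X" using minword_X Suc.prems by blast
  have n: "ht x = int (Suc n)" using Suc by (simp add: minword_def)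
  let ?B = "\<lambda>s t. \<forall>u v. minword x (s # u) \<longrightarrow> minword x (t # v) \<longrightarrow> lcong L (word_monom 1 (s # u)) (word_monom 1 (t # v))"
  have same: "?B s s" for s
  proof (intro allI impI)
    fix u v assume uv: "minword x (s # u)" "minword x (s # v)"
    have "n = length u" using uv(1) n by (simp add: minword_def)
    then have "lcong L (word_monom 1 u) (word_monom 1 v)"
      using Suc.hyps(1)[OF _ minword_Cons(2)[OF uv(1)] minword_Cons(2)[OF uv(2)]] by simp
    then show "lcong L (word_monom 1 (s # u)) (word_monom 1 (s # v))"
      using lcong_Cons[OF L] verts_S[OF minword_Cons(1)[OF uv(1)]] by simp
  qed
  have link: "?B s t" if e: "(s, t) \<in> linked L x" for s t
  proof -
    obtain u v where uv: "minword x (s # u)" "minword x (t # v)" "lcong L (word_monom 1 (s # u)) (word_monom 1 (t # v))"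
      using e edge_lcong[OF L x] unfolding linked_def by blast
    show ?thesis
    proof (intro allI impI)
      fix u' v' assume uv': "minword x (s # u')" "minword x (t # v')"
      have "lcong L (word_monom 1 (s # u')) (word_monom 1 (s # u))" using same uv uv' by blast
      moreover have "lcong L (word_monom 1 (t # v)) (word_monom 1 (t # v'))" using same uv uv' by blast
      ultimately show "lcong L (word_monom 1 (s # u')) (word_monom 1 (t # v'))" using uv(3) trans by blast
    qed
  qed
  have path: "?B s t" if "(s, t) \<in> (linked L x)\<^sup>*" for s t
    using that
  proof (induction rule: rtrancl_induct)
    case base
    then show ?case by (rule same)
  next
    case (step b c)
    obtain w where w: "minword x (b # w)" using ex_minword_vert[OF x linked_verts[OF step(2)]] by blast
    show ?case
    proof (intro allI impI)
      fix u v assume uv: "minword x (s # u)" "minword x (c # v)"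
      have "lcong L (word_monom 1 (s # u)) (word_monom 1 (b # w))" using step.IH uv w by blast
      moreover have "lcong L (word_monom 1 (b # w)) (word_monom 1 (c # v))" using link[OF step(2)] uv w by blast
      ultimately show "lcong L (word_monom 1 (s # u)) (word_monom 1 (c # v))" by (rule trans)
    qed
  qed
  have "x \<noteq> H" using n by auto
  then obtain s0 where s0: "\<And>t. t \<in> verts x \<Longrightarrow> (s0, t) \<in> (linked L x)\<^sup>*" using conn[OF x] by blast
  obtain s u1 where u: "u = s # u1" using Suc.hyps(2) by (cases u) auto
  obtain t v1 where v: "v = t # v1" using Suc.prems n by (cases v) (auto simp: minword_def)
  have s: "s \<in> verts x" and t: "t \<in> verts x" using Suc.prems minword_Cons(1) unfolding u v by blast+
  \<comment> \<open>A path from \<open>s0\<close> to \<open>s\<close> is either trivial or leaves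
    \<open>s0\<close> along a link, and links start at vertices.\<close>
  have "s0 \<in> verts x" using s0[OF s] s linked_verts by (metis converse_rtranclE)
  then obtain w where w: "minword x (s0 # w)" using ex_minword_vert x by blast
  have "lcong L (word_monom 1 (s0 # w)) (word_monom 1 u)" "lcong L (word_monom 1 (s0 # w)) (word_monom 1 v)"
    using path[OF s0[OF s]] path[OF s0[OF t]] w Suc.prems unfolding u v by blast+
  then show ?case using trans lcong_sym[OF L] by blast
qed

end

context coxeter_system
begin

lemma one_minword_iff:
  "w \<in> carrier G \<Longrightarrow> even_quasiparabolic.minword G S {\<one>} {w} u \<longleftrightarrow> reduced_word G S u w"
proof -
  assume w: "w \<in> carrier G"
  interpret one: even_quasiparabolic G S "{\<one>}" by (rule one_even_quasiparabolic)
  have "l_coset G (word_prod G u) {\<one>} = {word_prod G u}" if "u \<in> words"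
    using that by (simp add: one_coset)
  then show ?thesis
    unfolding one.minword_def reduced_word_def ht_singleton of_nat_eq_iff by (metis singleton_inject)
qed

text \<open>Matsumoto's theorem: for the trivial subgroup all pairs of descents are edges.\<close>

lemma hecke_T_eq:
  assumes u: "reduced_word G S u w" shows "hecke_T G S w = cl (word_monom 1 u)"
proof -
  interpret one: even_quasiparabolic G S "{\<one>}" by (rule one_even_quasiparabolic)
  interpret R: ring R by (rule hecke_ring)
  have w: "w \<in> carrier G" using u word_closed unfolding reduced_word_def by blast
  \<comment> \<open>Congruence modulo the zero ideal is equality in the Hecke algebra.\<close>
  have L: "left_ideal {\<zero>\<^bsub>R\<^esub>} R"
    using R.zeroideal by (auto simp: left_ideal_def ideal_def)
  have edge: "(s, t) \<in> (one.linked {\<zero>\<^bsub>R\<^esub>} x)\<^sup>*" if x: "x \<in> one.X" and st: "s \<in> one.verts x" "t \<in> one.verts x" for x s t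
  proof (cases "s = t")
    case False
    obtain k where k: "one.dihedral_max s t x k" using one.ex_dihedral_max[OF x st] by blast
    obtain g where "g \<in> carrier G" "x = {g}" using x by (auto simp: one_cosets)
    then have "k = cox_m G s t" using one_dihedral_max k by blast
    then have "(s, t) \<in> Gamma_edges G S {\<one>} x" using one.edges_iff[OF k] False by simp
    then show ?thesis by (auto simp: one.linked_def)
  qed simp
  have "cl (word_monom 1 u) = cl (word_monom 1 v)" if v: "reduced_word G S v w" for v
  proof -
    have "lcong {\<zero>\<^bsub>R\<^esub>} (word_monom 1 u) (word_monom 1 v)"
    proof (rule one.minword_lcong[OF L])
      show "one.minword {w} u" "one.minword {w} v" using u v w by (simp_all add: one_minword_iff)
      fix x assume "x \<in> one.X" "x \<noteq> {\<one>}"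
      then show "\<exists>s. \<forall>t\<in>one.verts x. (s, t) \<in> (one.linked {\<zero>\<^bsub>R\<^esub>} x)\<^sup>*"
        using edge one.verts_nonempty by blast
    qed
    then show ?thesis using cl_eqI by (auto simp: lcong_def)
  qed
  then have const: "word_prod R (map (hecke_gen G S) v) = cl (word_monom 1 u)" if "reduced_word G S v w" for v
    using that word_prod_hecke[of v] by (simp add: reduced_word_def)
  have "(\<lambda>v. word_prod R (map (hecke_gen G S) v)) ` {v. reduced_word G S v w} =
      (\<lambda>v. cl (word_monom 1 u)) ` {v. reduced_word G S v w}"
    by (rule image_cong) (use const in simp_all)
  also have "\<dots> = {cl (word_monom 1 u)}" using u by blast
  finally show ?thesis by (simp add: hecke_T_def)
qed

end

section \<open>The annihilator of the base point\<close>

context even_quasiparabolic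
begin

abbreviation e where "e \<equiv> module_basis H"

lemma fr_act_cl_cong:
  assumes "f \<in> fin_on words" "g \<in> fin_on words" "cl f = cl g" "v \<in> V"
  shows "fr_act f v = fr_act g v"
proof -
  interpret ideal "hecke_ideal G S" F by (rule hecke_ideal_ideal)
  have "f \<in> hecke_ideal G S +>\<^bsub>F\<^esub> g" using a_rcos_self[of f] assms by (simp add: cl_def)
  then obtain i where i: "i \<in> hecke_ideal G S" "f = i \<oplus>\<^bsub>F\<^esub> g"
    unfolding a_r_coset_def' by blast
  have "i \<in> fin_on words" using i(1) a_subset by auto
  then have "fr_act f v = (\<lambda>z. fr_act i v z + fr_act g v z)"
    unfolding i(2) add_free_algebra using assms(2) by (rule fr_act_add)
  then show ?thesis using hecke_ideal_acts_trivially[OF i(1) assms(4)] by simp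
qed

text \<open>Representatives of one class act alike, so the image to which \<open>the_elem\<close> is
  applied is a singleton.\<close>

lemma hecke_act_cl:
  assumes f: "f \<in> fin_on words" and v: "v \<in> V" shows "hecke_act G S H (cl f) v = fr_act f v"
proof -
  interpret ideal "hecke_ideal G S" F by (rule hecke_ideal_ideal)
  have eq: "fr_act g v = fr_act f v" if gf: "g \<in> cl f" for g
  proof -
    interpret R: ring R by (rule hecke_ring)
    obtain i where i: "i \<in> hecke_ideal G S" "g = (\<lambda>w. i w + f w)"
      using gf unfolding cl_def a_r_coset_def' by auto
    have iF: "i \<in> fin_on words" using i(1) a_subset by auto
    then have g: "g \<in> fin_on words" using i(2) f by simp
    have "cl g = cl f" using f iF i cl_add[of i f] cl_ideal_eq_0[OF i(1)] by simp
    then show ?thesis using fr_act_cl_cong g f v by blast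
  qed
  have "f \<in> cl f" using a_rcos_self[of f] f by (simp add: cl_def)
  have "(\<lambda>g. fr_act g v) ` cl f = (\<lambda>g. fr_act f v) ` cl f" by (rule image_cong) (use eq in simp_all)
  also have "\<dots> = {fr_act f v}" using \<open>f \<in> cl f\<close> by blast
  finally show ?thesis by (simp add: hecke_act_def)
qed

lemma cl_in_ann: "f \<in> fin_on words \<Longrightarrow> cl f \<in> ann_ideal G S H \<longleftrightarrow> fr_act f e = (\<lambda>_. 0)"
  by (simp add: ann_ideal_def hecke_act_cl)

lemma ann_cases:
  assumes "a \<in> ann_ideal G S H"
  obtains f where "f \<in> fin_on words" "a = cl f" "fr_act f e = (\<lambda>_. 0)"
proof -
  have "a \<in> carrier R" using assms by (simp add: ann_ideal_def)
  then obtain f where "f \<in> fin_on words" "a = cl f" by (rule carrier_hecke)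
  then show ?thesis using that assms cl_in_ann by simp
qed

lemma ann_left_ideal: "left_ideal (ann_ideal G S H) R"
proof -
  interpret R: ring R by (rule hecke_ring)
  interpret F: ring F by (rule free_algebra_ring)
  have mult: "r \<otimes>\<^bsub>R\<^esub> a \<in> ann_ideal G S H" if a: "a \<in> ann_ideal G S H" and r: "r \<in> carrier R" for r a
  proof -
    obtain f where f: "f \<in> fin_on words" "a = cl f" "fr_act f e = (\<lambda>_. 0)" using a by (rule ann_cases)
    obtain g where g: "g \<in> fin_on words" "r = cl g" using r by (rule carrier_hecke)
    have "g \<otimes>\<^bsub>F\<^esub> f \<in> fin_on words" using F.m_closed[of g f] f g by simp
    moreover have "fr_act (g \<otimes>\<^bsub>F\<^esub> f) e = (\<lambda>_. 0)" using f g by (simp add: fr_act_mult fr_act_null)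
    ultimately have "cl (g \<otimes>\<^bsub>F\<^esub> f) \<in> ann_ideal G S H" using cl_in_ann by blast
    then show ?thesis using f g by (simp add: cl_mult)
  qed
  have minus: "\<ominus>\<^bsub>R\<^esub> a \<in> ann_ideal G S H" if a: "a \<in> ann_ideal G S H" for a
  proof -
    have "a \<in> carrier R" using a by (simp add: ann_ideal_def)
    then have "\<ominus>\<^bsub>R\<^esub> a = (\<ominus>\<^bsub>R\<^esub> \<one>\<^bsub>R\<^esub>) \<otimes>\<^bsub>R\<^esub> a" by (simp add: R.l_minus)
    then show ?thesis using mult[OF a] by simp
  qed
  have add: "a \<oplus>\<^bsub>R\<^esub> b \<in> ann_ideal G S H" if a: "a \<in> ann_ideal G S H" "b \<in> ann_ideal G S H" for a b
  proof -
    obtain f where f: "f \<in> fin_on words" "a = cl f" "fr_act f e = (\<lambda>_. 0)" using a(1) by (rule ann_cases)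
    obtain g where g: "g \<in> fin_on words" "b = cl g" "fr_act g e = (\<lambda>_. 0)" using a(2) by (rule ann_cases)
    have "cl (\<lambda>w. f w + g w) \<in> ann_ideal G S H" using f g by (simp add: cl_in_ann fr_act_add)
    then show ?thesis using f g by (simp add: cl_add)
  qed
  have zero: "\<zero>\<^bsub>R\<^esub> \<in> ann_ideal G S H" using cl_in_ann[of "\<lambda>_. 0"] by (simp add: cl_zero)
  have "subgroup (ann_ideal G S H) (add_monoid R)"
    by (rule R.add.subgroupI) (use zero minus add in \<open>auto simp: ann_ideal_def\<close>)
  then show ?thesis using mult by (auto simp: left_ideal_def additive_subgroup_def)
qed

text \<open>A \<open>\<int>[q]\<close>-linear section of \<open>f \<mapsto> f T(H)\<close>, sending each \<open>T(x)\<close> to a chosen minimal word of \<open>x\<close>.\<close>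

definition mword :: "'a set \<Rightarrow> 'a list" where
  "mword x = (SOME u. minword x u)"

text \<open>Given pointwise instead of as a sum over X: \<open>u\<close> receives the coefficient of
  its own coset, provided it is the word chosen there. Linearity then needs no finiteness.\<close>

definition section_map :: "('a set \<Rightarrow> int poly) \<Rightarrow> 'a list \<Rightarrow> int poly" where
  "section_map v u = (if u \<in> words \<and> u = mword (coset (word_prod G u)) then v (coset (word_prod G u)) else 0)"

lemma minword_mword: "x \<in> X \<Longrightarrow> minword x (mword x)"
  unfolding mword_def using ex_minword by (rule someI_ex)

lemma section_map_zero [simp]: "section_map (\<lambda>_. 0) = (\<lambda>_. 0)"
  by (simp add: section_map_def fun_eq_iff)

lemma section_map_add: "section_map (\<lambda>x. v x + w x) = (\<lambda>u. section_map v u + section_map w u)"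
  by (simp add: section_map_def fun_eq_iff)

lemma section_map_scale: "section_map (\<lambda>x. c * v x) = (\<lambda>u. c * section_map v u)"
  by (simp add: section_map_def fun_eq_iff)

lemma section_map_basis:
  assumes "x \<in> X" shows "section_map (module_basis x) = word_monom 1 (mword x)"
proof
  fix u
  have m: "mword x \<in> words" "coset (word_prod G (mword x)) = x"
    using minword_mword[OF assms] by (simp_all add: minword_def)
  show "section_map (module_basis x) u = word_monom 1 (mword x) u"
  proof (cases "u = mword x")
    case True
    then show ?thesis using m by (simp add: section_map_def word_monom_def module_basis_def)
  next
    case False
    then show ?thesis unfolding section_map_def word_monom_def module_basis_def by metis
  qed
qed

lemma section_map_closed: "v \<in> V \<Longrightarrow> section_map v \<in> fin_on words"
proof (induction rule: fin_on_induct)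
  case (add g x c)
  then show ?case using minword_words[OF minword_mword[OF add(2)]]
    by (simp add: single_eq section_map_add section_map_scale section_map_basis)
qed simp

section \<open>Reduction to chosen words modulo a left ideal\<close>

context
  fixes L assumes L: "left_ideal L R"
    and words_cong: "\<And>x u v. minword x u \<Longrightarrow> minword x v \<Longrightarrow> lcong L (word_monom 1 u) (word_monom 1 v)"
begin

text \<open>If s leads up, \<open>s # mword x\<close> is itself a minimal word of sx. If s leads
  down, the chosen word of x is exchanged for one starting with s, and the quadratic relation
  reduces the double letter.\<close>

lemma section_map_gact_basis:
  assumes s: "s \<in> S" and x: "x \<in> X"
  shows "lcong L (word_monom 1 (s # mword x)) (section_map (gact s (module_basis x)))"
  using ht_step_cases[OF s x]
proof
  assume up: "ht (act s x) = ht x + 1"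
  have "minword (act s x) (s # mword x)" using minword_ConsI[OF s minword_mword[OF x] up] .
  moreover have "minword (act s x) (mword (act s x))" using s x by (intro minword_mword) simp
  ultimately show ?thesis using words_cong s x by (simp add: gact_up[OF s x up] section_map_basis)
next
  assume down: "ht (act s x) = ht x - 1"
  let ?y = "act s x"
  have y: "?y \<in> X" "act s ?y = x" using s x by simp_all
  let ?u = "mword ?y"
  have u: "?u \<in> words" using minword_mword[OF y(1)] by simp
  have "minword (act s ?y) (s # ?u)" using down y by (intro minword_ConsI[OF s minword_mword[OF y(1)]]) simp
  then have xu: "lcong L (word_monom 1 (mword x)) (word_monom 1 (s # ?u))"
    using words_cong minword_mword[OF x] unfolding y(2) by blast
  have 1: "lcong L (word_monom 1 (s # mword x)) (word_monom 1 (s # s # ?u))" by (rule lcong_Cons[OF L s xu])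
  have 2: "lcong L (word_monom 1 (s # s # ?u)) (\<lambda>w. (q - 1) * word_monom 1 (s # ?u) w + q * word_monom 1 ?u w)"
  proof (rule lcong_eq[OF L])
    interpret F: ring F by (rule free_algebra_ring)
    have "cl (word_monom 1 (s # s # ?u)) = cl (word_monom 1 [s, s]) \<otimes>\<^bsub>R\<^esub> cl (word_monom 1 ?u)"
      using s u cl_mult[of "word_monom 1 [s, s]" "word_monom 1 ?u"] by simp
    also have "\<dots> = cl ((\<lambda>w. (q - 1) * word_monom 1 [s] w + q * word_monom 1 [] w) \<otimes>\<^bsub>F\<^esub> word_monom 1 ?u)"
      unfolding cl_quadratic[OF s] using s u by (simp add: cl_mult)
    also have "(\<lambda>w. (q - 1) * word_monom 1 [s] w + q * word_monom 1 [] w) = word_monom (q - 1) [s] \<oplus>\<^bsub>F\<^esub> word_monom q []"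
      by (auto simp: word_monom_def)
    also have "(word_monom (q - 1) [s] \<oplus>\<^bsub>F\<^esub> word_monom q []) \<otimes>\<^bsub>F\<^esub> word_monom 1 ?u =
        word_monom (q - 1) (s # ?u) \<oplus>\<^bsub>F\<^esub> word_monom q ?u"
      using s u F.l_distr[of "word_monom (q - 1) [s]" "word_monom q []" "word_monom 1 ?u"]
      by (simp del: add_free_algebra)
    also have "\<dots> = (\<lambda>w. (q - 1) * word_monom 1 (s # ?u) w + q * word_monom 1 ?u w)"
      by (auto simp: word_monom_def)
    finally show "cl (word_monom 1 (s # s # ?u)) = cl (\<lambda>w. (q - 1) * word_monom 1 (s # ?u) w + q * word_monom 1 ?u w)" .
  qed (use s u in simp_all)
  have 3: "lcong L (\<lambda>w. (q - 1) * word_monom 1 (s # ?u) w + q * word_monom 1 ?u w)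
      (\<lambda>w. (q - 1) * word_monom 1 (mword x) w + q * word_monom 1 ?u w)"
    using u by (intro lcong_add[OF L] lcong_scale[OF L] lcong_sym[OF L xu] lcong_refl[OF L]) simp
  have 4: "section_map (gact s (module_basis x)) = (\<lambda>w. (q - 1) * word_monom 1 (mword x) w + q * word_monom 1 ?u w)"
    using y x by (simp add: gact_down[OF s x down] section_map_add section_map_scale section_map_basis)
  show ?thesis unfolding 4 by (rule lcong_trans[OF L lcong_trans[OF L 1 2] 3])
qed

lemma section_map_gact:
  assumes s: "s \<in> S" and "v \<in> V"
  shows "lcong L (word_monom 1 [s] \<otimes>\<^bsub>F\<^esub> section_map v) (section_map (gact s v))"
  using assms(2)
proof (induction rule: fin_on_induct)
  case zero
  interpret F: ring F by (rule free_algebra_ring)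
  show ?case using F.r_null[of "word_monom 1 [s]"] s lcong_refl[OF L] by (simp add: gen_act_lin)
next
  case (add v x c)
  interpret F: ring F by (rule free_algebra_ring)
  have m: "mword x \<in> words" using minword_mword[OF add(2)] by simp
  have "section_map (\<lambda>z. v z + c * module_basis x z) = section_map v \<oplus>\<^bsub>F\<^esub> word_monom c (mword x)"
    using add(2) by (auto simp: section_map_add section_map_scale section_map_basis word_monom_def)
  then have "word_monom 1 [s] \<otimes>\<^bsub>F\<^esub> section_map (\<lambda>z. v z + c * module_basis x z)
      = word_monom 1 [s] \<otimes>\<^bsub>F\<^esub> section_map v \<oplus>\<^bsub>F\<^esub> word_monom c (s # mword x)"
    using F.r_distr[of "section_map v" "word_monom c (mword x)" "word_monom 1 [s]"] m s section_map_closed[OF add(1)]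
    by (simp del: add_free_algebra)
  also have "\<dots> = (\<lambda>w. (word_monom 1 [s] \<otimes>\<^bsub>F\<^esub> section_map v) w + c * word_monom 1 (s # mword x) w)"
    by (auto simp: word_monom_def[of c] word_monom_def[of 1 "s # mword x"])
  finally have lhs: "word_monom 1 [s] \<otimes>\<^bsub>F\<^esub> section_map (\<lambda>z. v z + c * module_basis x z) = \<dots>" .
  have rhs: "section_map (gact s (\<lambda>z. v z + c * module_basis x z)) =
      (\<lambda>w. section_map (gact s v) w + c * section_map (gact s (module_basis x)) w)"
    using add s by (simp add: gact_add gact_scale section_map_add section_map_scale)
  show ?case unfolding single_eq lhs rhs
    by (intro lcong_add[OF L add(3)] lcong_scale[OF L] section_map_gact_basis s add(2))
qed

lemma section_map_T:
  "u \<in> words \<Longrightarrow> lcong L (word_monom 1 u) (section_map (T u e))"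
proof (induction u)
  case Nil
  have "minword H []" using lcos_mult_one[OF H_carrier] by (simp add: minword_def)
  then show ?case using words_cong[OF _ minword_mword] by (simp add: section_map_basis)
next
  case (Cons s u)
  then have "lcong L (word_monom 1 [s] \<otimes>\<^bsub>F\<^esub> word_monom 1 u) (word_monom 1 [s] \<otimes>\<^bsub>F\<^esub> section_map (T u e))"
    by (intro lcong_mult[OF L]) simp_all
  moreover have "lcong L (word_monom 1 [s] \<otimes>\<^bsub>F\<^esub> section_map (T u e)) (section_map (gact s (T u e)))"
    using Cons by (intro section_map_gact) simp_all
  ultimately have "lcong L (word_monom 1 [s] \<otimes>\<^bsub>F\<^esub> word_monom 1 u) (section_map (gact s (T u e)))"
    by (rule lcong_trans[OF L])
  then show ?case by simp
qed

text \<open>Modulo \<open>L\<close> an element is thus determined by its value on T(H); one that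
  annihilates T(H) is congruent to 0.\<close>

lemma section_map_fr_act:
  "f \<in> fin_on words \<Longrightarrow> lcong L f (section_map (fr_act f e))"
proof (induction rule: fin_on_induct)
  case zero
  then show ?case using lcong_refl[OF L] by simp
next
  case (add f u c)
  have "(\<lambda>w. f w + (if w = u then c else 0)) = (\<lambda>w. f w + c * word_monom 1 u w)"
    by (auto simp: word_monom_def)
  moreover have "section_map (fr_act (\<lambda>w. f w + (if w = u then c else 0)) e) =
      (\<lambda>w. section_map (fr_act f e) w + c * section_map (T u e) w)"
    using add by (simp add: single_monom fr_act_add section_map_add section_map_scale)
  ultimately show ?case
    using lcong_add[OF L add(3) lcong_scale[OF L section_map_T[OF add(2)]]] by simp
qed

lemma ann_subset: "ann_ideal G S H \<subseteq> L"
proof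
  fix a assume "a \<in> ann_ideal G S H"
  then obtain f where "f \<in> fin_on words" "a = cl f" "fr_act f e = (\<lambda>_. 0)" by (rule ann_cases)
  then show "a \<in> L" using section_map_fr_act[of f] by (simp add: lcong_def)
qed

end

end

section \<open>Choosing the dihedral generators\<close>

context coxeter_system
begin

text \<open>Evaluating in the regular representation recovers the two words of a difference.\<close>

lemma word_monom_diff_inj:
  assumes red: "reduced_word G S u a" "reduced_word G S v b" "reduced_word G S u' a'" "reduced_word G S v' b'"
    and eq: "cl (word_monom 1 u) \<ominus>\<^bsub>R\<^esub> cl (word_monom 1 v) = cl (word_monom 1 u') \<ominus>\<^bsub>R\<^esub> cl (word_monom 1 v')"
    and ne: "a \<noteq> b"
  shows "a = a'" "b = b'"
proof -
  interpret one: even_quasiparabolic G S "{\<one>}" by (rule one_even_quasiparabolic)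
  have w: "u \<in> words" "v \<in> words" "u' \<in> words" "v' \<in> words" 
    and c: "a \<in> carrier G" "b \<in> carrier G" "a' \<in> carrier G" "b' \<in> carrier G"
    using red word_closed unfolding reduced_word_def by blast+
  have act: "one.fr_act (word_monom 1 u) (module_basis {\<one>}) = module_basis {a}"
    if "reduced_word G S u a" "a \<in> carrier G" for u a
    using one.T_minword[of "{a}" u] that by (simp add: one_minword_iff)
  have diff: "one.fr_act (\<lambda>w. word_monom 1 u w - word_monom 1 v w) (module_basis {\<one>})
      = (\<lambda>z. module_basis {a} z - module_basis {b} z)"
    if "reduced_word G S u a" "reduced_word G S v b" "u \<in> words" "v \<in> words" "a \<in> carrier G" "b \<in> carrier G" for u v a b
    using that act by (simp add: one.fr_act_diff)
  have "cl (\<lambda>w. word_monom 1 u w - word_monom 1 v w) = cl (\<lambda>w. word_monom 1 u' w - word_monom 1 v' w)"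
    using eq w by (simp add: cl_diff)
  then have "one.fr_act (\<lambda>w. word_monom 1 u w - word_monom 1 v w) (module_basis {\<one>}) =
      one.fr_act (\<lambda>w. word_monom 1 u' w - word_monom 1 v' w) (module_basis {\<one>})"
    using w by (intro one.fr_act_cl_cong) simp_all
  then have "(\<lambda>z. module_basis {a} z - module_basis {b} z) = (\<lambda>z. module_basis {a'} z - module_basis {b'} z)"
    using diff red w c by simp
  then have "module_basis {a} z - module_basis {b} z = module_basis {a'} z - module_basis {b'} z" for z
    by meson
  \<comment> \<open>As a and b differ, the left side is 1 at \<open>{a}\<close> and -1 at
    \<open>{b}\<close>; the right side can take these values only at \<open>{a'}\<close> and
    \<open>{b'}\<close>.\<close>
  from this[of "{a}"] this[of "{b}"] show "a = a'" "b = b'"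
    using ne by (auto simp: module_basis_def split: if_splits)
qed

end

context even_quasiparabolic
begin

text \<open>If a minimal representative of \<open>x\<close> has the two descents \<open>s\<close> and \<open>t\<close>, then it lies above the
  longest element of \<open>\<langle>s, t\<rangle>\<close>, so the orbit of \<open>x\<close> is as large as possible.\<close>

lemma common_descent_edge:
  assumes u: "minword x (s # u)" and v: "minword x (t # v)" and ne: "s \<noteq> t"
    and eq: "word_prod G (s # u) = word_prod G (t # v)"
  shows "(s, t) \<in> Gamma_edges G S H x"
proof -
  interpret one: even_quasiparabolic G S "{\<one>}" by (rule one_even_quasiparabolic)
  define g where "g = word_prod G (s # u)"
  have g: "g \<in> carrier G" unfolding g_def using minword_words[OF u] by (rule word_closed)
  have xg: "x = coset g" using u by (simp add: minword_def g_def)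
  have red: "reduced_word G S (s # u) g" "reduced_word G S (t # v) g"
    using minword_reduced[OF u] minword_reduced[OF v] unfolding g_def eq by simp_all
  have len: "int (len g) = ht x" using u red(1) by (simp add: minword_def reduced_word_def)
  have "s \<in> one.verts {g}" "t \<in> one.verts {g}"
    using red g by (auto intro: one.minword_Cons(1) simp: one_minword_iff)
  moreover have "{g} \<in> one.X" using g by (simp add: one_cosets)
  ultimately obtain m where m: "one.dihedral_max s t {g} m" using one.ex_dihedral_max by blast
  have mm: "m = cox_m G s t" using one_dihedral_max[OF m g] .
  obtain l where l: "dihedral_max s t x l"
    using ex_dihedral_max[OF minword_X[OF u] minword_Cons(1)[OF u] minword_Cons(1)[OF v]] by blast
  note f = dihedral_max_facts[OF l]
  let ?p = "word_prod G (alternating m s t)"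
  have p: "?p \<in> carrier G" using f by (simp add: alternating_lists)
  have "int (len (?p \<otimes> g)) = int (len g) - int m"
    using one.dihedral_max_ht(1)[OF m order.refl] p g by (simp add: one.alt_def)
  moreover have "alt m s t x = coset (?p \<otimes> g)" unfolding alt_def xg using p g by simp
  \<comment> \<open>The orbit of x therefore reaches at least m levels down, whereas its bottom lies
    exactly l levels down.\<close>
  ultimately have h: "ht (alt m s t x) \<le> ht x - int m"
    using ht_coset_le[of "?p \<otimes> g"] p g len by simp
  have "?p \<in> generate G {s, t}" using generate_words[of "{s, t}"] f by (simp add: alternating_lists)
  then have "alt m s t x \<in> dihedral_orbit G H s t x"
    by (auto simp: dihedral_orbit_def orbit_def alt_def)
  then have "ht (alt l s t x) \<le> ht (alt m s t x)"
    using dihedral_max_bottom_least[OF l] by (cases "alt m s t x = alt l s t x") (simp_all add: less_imp_le)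
  then have "m \<le> l" using h dihedral_max_ht(1)[OF l order.refl] by simp
  \<comment> \<open>Divisibility gives the bound because m > 0, being the length of a chain in the
    regular representation.\<close>
  moreover have "l \<le> m" using dihedral_max_dvd[OF l] one.dihedral_max_facts(4)[OF m] mm by (simp add: dvd_imp_le)
  ultimately show ?thesis using edges_iff[OF l] ne mm by simp
qed

lemma minword_hecke_T: "minword x u \<Longrightarrow> hecke_T G S (word_prod G u) = cl (word_monom 1 u)"
  by (rule hecke_T_eq[OF minword_reduced])

lemma dihedral_generator_words:
  assumes x: "x \<in> X" and gen: "dihedral_generator G S H x a"
  shows "\<exists>s t u v. minword x (s # u) \<and> minword x (t # v) \<and> s \<noteq> t \<and> (s, t) \<notin> Gamma_edges G S H x \<and>
    a = cl (word_monom 1 (s # u)) \<ominus>\<^bsub>R\<^esub> cl (word_monom 1 (t # v))"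
proof -
  obtain s t k w where max: "dihedral_max s t x k" and *: "s \<noteq> t" "k \<noteq> cox_m G s t"
      "w \<in> carrier G" "alt k s t x = coset w" "int (len w) = ht x - int k"
      "a = hecke_T G S (word_prod G (alternating k s t) \<otimes> w)
              \<ominus>\<^bsub>R\<^esub> hecke_T G S (word_prod G (alternating k t s) \<otimes> w)"
    using gen unfolding dihedral_generator_iff[OF x] by (elim exE conjE) (rule that)
  note f = dihedral_max_facts[OF max]
  obtain u where "reduced_word G S u w" using ex_reduced[OF *(3)] by blast
  then have u: "u \<in> words" "word_prod G u = w" "length u = len w" by (simp_all add: reduced_word_def)
  have mu: "minword (alt k s t x) u"
    using u * dihedral_max_ht(1)[OF max order.refl] by (simp add: minword_def)
  have m: "minword x (alternating k s t @ u)" "minword x (alternating k t s @ u)"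
    using minword_alternating[OF max mu] minword_alternating'[OF max mu] .
  have "a = cl (word_monom 1 (alternating k s t @ u)) \<ominus>\<^bsub>R\<^esub> cl (word_monom 1 (alternating k t s @ u))"
    using minword_hecke_T[OF m(1)] minword_hecke_T[OF m(2)] u f *(6) by (simp add: alternating_lists)
  moreover obtain j where j: "k = Suc j" using f by (cases k) auto
  ultimately show ?thesis using m *(1,2) edges_iff[OF max]
    by (intro exI[of _ s] exI[of _ t] exI[of _ "alternating j t s @ u"] exI[of _ "alternating j s t @ u"]) simp
qed

lemma ex_dihedral_generator:
  assumes x: "x \<in> X" and st: "s \<in> verts x" "t \<in> verts x" "s \<noteq> t" "(s, t) \<notin> Gamma_edges G S H x"
  shows "\<exists>u v. minword x (s # u) \<and> minword x (t # v) \<and>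
    dihedral_generator G S H x (cl (word_monom 1 (s # u)) \<ominus>\<^bsub>R\<^esub> cl (word_monom 1 (t # v)))"
proof -
  obtain k where max: "dihedral_max s t x k" using ex_dihedral_max[OF x st(1,2)] by blast
  note f = dihedral_max_facts[OF max]
  have "alt k s t x \<in> X" using f by simp
  then obtain w where w: "minword (alt k s t x) w" using ex_minword by blast
  have m: "minword x (alternating k s t @ w)" "minword x (alternating k t s @ w)"
    using minword_alternating[OF max w] minword_alternating'[OF max w] .
  let ?a = "cl (word_monom 1 (alternating k s t @ w)) \<ominus>\<^bsub>R\<^esub> cl (word_monom 1 (alternating k t s @ w))"
  have "dihedral_generator G S H x ?a"
    unfolding dihedral_generator_iff[OF x]
  proof (intro exI conjI)
    show "dihedral_max s t x k" "s \<noteq> t" using max st by simp_all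
    show "k \<noteq> cox_m G s t" using st edges_iff[OF max] by simp
    show "word_prod G w \<in> carrier G" using w by simp
    show "alt k s t x = coset (word_prod G w)" using w by (simp add: minword_def)
    show "int (len (word_prod G w)) = ht x - int k"
      using minword_reduced[OF w] w dihedral_max_ht(1)[OF max order.refl]
      by (simp add: minword_def reduced_word_def)
    show "?a = hecke_T G S (word_prod G (alternating k s t) \<otimes> word_prod G w)
        \<ominus>\<^bsub>R\<^esub> hecke_T G S (word_prod G (alternating k t s) \<otimes> word_prod G w)"
      using minword_hecke_T[OF m(1)] minword_hecke_T[OF m(2)] w f by (simp add: alternating_lists)
  qed
  moreover obtain j where j: "k = Suc j" using f by (cases k) auto
  ultimately show ?thesis using m
    by (intro exI[of _ "alternating j t s @ w"] exI[of _ "alternating j s t @ w"]) simp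
qed

text \<open>Both words of the difference send T(H) to T(x).\<close>

lemma dihedral_generator_in_ann:
  assumes x: "x \<in> X" and gen: "dihedral_generator G S H x a" shows "a \<in> ann_ideal G S H"
proof -
  obtain s t u v where *: "minword x (s # u)" "minword x (t # v)"
    "a = cl (word_monom 1 (s # u)) \<ominus>\<^bsub>R\<^esub> cl (word_monom 1 (t # v))"
    using dihedral_generator_words[OF x gen] by blast
  have w: "word_monom 1 (s # u) \<in> fin_on words" "word_monom 1 (t # v) \<in> fin_on words"
    by (rule word_monom_fin_on[OF minword_words[OF *(1)]] word_monom_fin_on[OF minword_words[OF *(2)]])+
  have "fr_act (\<lambda>w. word_monom 1 (s # u) w - word_monom 1 (t # v) w) e = (\<lambda>_. 0)"
    unfolding fr_act_diff[OF w] fr_act_monom T_minword[OF *(1)] T_minword[OF *(2)] by simp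
  then show ?thesis unfolding *(3) cl_diff[OF w, symmetric] using cl_in_ann[OF fin_on_diff[OF w]] by blast
qed

text \<open>The two words represent different elements of W, since otherwise their first letters
  would form an edge. Hence the first element can be recovered from the difference, and its coset is
  the base point.\<close>

lemma dihedral_generator_base_unique:
  assumes x: "x \<in> X" "dihedral_generator G S H x a" and y: "y \<in> X" "dihedral_generator G S H y a"
  shows "x = y"
proof -
  obtain s t u v where 1: "minword x (s # u)" "minword x (t # v)" "s \<noteq> t" "(s, t) \<notin> Gamma_edges G S H x"
    "a = cl (word_monom 1 (s # u)) \<ominus>\<^bsub>R\<^esub> cl (word_monom 1 (t # v))"
    using dihedral_generator_words[OF x] by (elim exE conjE) (rule that)
  obtain s' t' u' v' where 2: "minword y (s' # u')" "minword y (t' # v')"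
    "a = cl (word_monom 1 (s' # u')) \<ominus>\<^bsub>R\<^esub> cl (word_monom 1 (t' # v'))"
    using dihedral_generator_words[OF y] by (elim exE conjE) (rule that)
  have "word_prod G (s # u) \<noteq> word_prod G (t # v)" using common_descent_edge 1 by blast
  then have "word_prod G (s # u) = word_prod G (s' # u')"
    using word_monom_diff_inj(1)[OF minword_reduced[OF 1(1)] minword_reduced[OF 1(2)]
        minword_reduced[OF 2(1)] minword_reduced[OF 2(2)]] 1(5) 2(3) by simp
  moreover have "x = coset (word_prod G (s # u))" using 1(1) by (simp only: minword_def)
  moreover have "y = coset (word_prod G (s' # u'))" using 2(1) by (simp only: minword_def)
  ultimately show ?thesis by simp
qed

lemma no_dihedral_generator_at_H: "\<not> dihedral_generator G S H H a"
proof
  assume "dihedral_generator G S H H a"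
  then obtain s where "s \<in> verts H"
    using dihedral_generator_words minword_Cons(1) H_in_X by blast
  then show False using ht_nonneg[of "act s H"] by (simp add: verts_iff)
qed

section \<open>Components of the graph and the choice of a star\<close>

definition component_rel :: "'a set \<Rightarrow> ('a \<times> 'a) set" where
  "component_rel x = {(s, t). s \<in> verts x \<and> t \<in> verts x \<and> (s, t) \<in> (Gamma_edges G S H x)\<^sup>*}"

lemma components_eq: "Gamma_components G S H x = verts x // component_rel x"
  by (simp add: Gamma_components_def component_rel_def)

lemma component_rel_equiv:
  assumes "x \<in> X" shows "equiv (verts x) (component_rel x)"
proof (rule equivI)
  show "component_rel x \<subseteq> verts x \<times> verts x" by (auto simp: component_rel_def)
  show "refl_on (verts x) (component_rel x)" by (auto simp: refl_on_def component_rel_def)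
  have "sym ((Gamma_edges G S H x)\<^sup>*)" using edges_sym[OF assms] by (intro sym_rtrancl symI)
  then show "sym (component_rel x)" by (auto simp: component_rel_def sym_def)
  show "trans (component_rel x)" by (auto simp: component_rel_def trans_def)
qed

lemma finite_verts: "finite (verts x)"
  using finite_rank by (simp add: Gamma_verts_def)

text \<open>The generators at \<open>x\<close> join one vertex to a vertex of each other component, that is,
  they form a star on the set of components.\<close>

lemma ex_generator_star:
  assumes x: "x \<in> X" and xH: "x \<noteq> H"
  shows "\<exists>D. (\<forall>a\<in>D. dihedral_generator G S H x a) \<and> finite D \<and>
    card D + 1 = card (Gamma_components G S H x) \<and>
    (\<forall>L. left_ideal L R \<longrightarrow> D \<subseteq> L \<longrightarrow> (\<exists>s. \<forall>t\<in>verts x. (s, t) \<in> (linked L x)\<^sup>*))"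
proof -
  let ?E = "component_rel x"
  let ?Q = "verts x // ?E"
  note eqv = component_rel_equiv[OF x]
  obtain s0 where s0: "s0 \<in> verts x" using verts_nonempty[OF x xH] by blast
  let ?B = "?E `` {s0}"
  have finQ: "finite ?Q" using finite_verts eqv by (intro finite_quotient) (auto simp: equiv_def)
  have C0: "?B \<in> ?Q" using s0 by (rule quotientI)
  have "\<exists>t u v. t \<in> C \<and> minword x (s0 # u) \<and> minword x (t # v) \<and>
      dihedral_generator G S H x (cl (word_monom 1 (s0 # u)) \<ominus>\<^bsub>R\<^esub> cl (word_monom 1 (t # v)))"
    if C: "C \<in> ?Q - {?B}" for C
  proof -
    obtain t where t: "t \<in> verts x" "C = ?E `` {t}" using C by (auto elim: quotientE)
    then have tC: "t \<in> C" by (simp add: component_rel_def)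
    have nE: "(s0, t) \<notin> ?E" using C t equiv_class_eq[OF eqv] by auto
    then have "s0 \<noteq> t" "(s0, t) \<notin> Gamma_edges G S H x" using s0 t by (auto simp: component_rel_def)
    then obtain u v where "minword x (s0 # u)" "minword x (t # v)"
      "dihedral_generator G S H x (cl (word_monom 1 (s0 # u)) \<ominus>\<^bsub>R\<^esub> cl (word_monom 1 (t # v)))"
      using ex_dihedral_generator[OF x s0 t(1)] by blast
    then show ?thesis using tC by blast
  qed
  then obtain \<tau> \<mu> \<nu> where star: "\<And>C. C \<in> ?Q - {?B} \<Longrightarrow> \<tau> C \<in> C \<and> minword x (s0 # \<mu> C) \<and> minword x (\<tau> C # \<nu> C) \<and>
      dihedral_generator G S H x (cl (word_monom 1 (s0 # \<mu> C)) \<ominus>\<^bsub>R\<^esub> cl (word_monom 1 (\<tau> C # \<nu> C)))"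
    by metis
  define g where "g C = cl (word_monom 1 (s0 # \<mu> C)) \<ominus>\<^bsub>R\<^esub> cl (word_monom 1 (\<tau> C # \<nu> C))" for C
  let ?D = "g ` (?Q - {?B})"
  have cls: "C = ?E `` {t}" if "C \<in> ?Q" "t \<in> C" for C t
    using that eqv by (metis Image_singleton_iff equiv_class_eq quotientE)
  have in_E: "(s, t) \<in> ?E" if "(s, t) \<in> Gamma_edges G S H x" for s t
    using that edges_verts by (auto simp: component_rel_def)
  have inj: "inj_on g (?Q - {?B})"
  proof (rule inj_onI)
    fix C C' assume C: "C \<in> ?Q - {?B}" "C' \<in> ?Q - {?B}" and eq: "g C = g C'"
    note S = star[OF C(1)] star[OF C(2)]
    have "\<tau> C \<in> C" using S by blast
    then have "(s0, \<tau> C) \<notin> ?E" using cls[of C "\<tau> C"] C equiv_class_eq[OF eqv, of s0 "\<tau> C"] by auto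
    then have "s0 \<noteq> \<tau> C" "(s0, \<tau> C) \<notin> Gamma_edges G S H x"
      using in_E s0 by (auto simp: component_rel_def)
    then have ne: "word_prod G (s0 # \<mu> C) \<noteq> word_prod G (\<tau> C # \<nu> C)"
      using S common_descent_edge by blast
    have M: "minword x (s0 # \<mu> C)" "minword x (\<tau> C # \<nu> C)"
        "minword x (s0 # \<mu> C')" "minword x (\<tau> C' # \<nu> C')" using S by blast+
    \<comment> \<open>All generators of the star start with \<open>s0\<close>; the second words
      reveal the component. If two of them represent the same element, their first letters are equal
      or adjacent.\<close>
    have same: "word_prod G (\<tau> C # \<nu> C) = word_prod G (\<tau> C' # \<nu> C')"
      by (rule word_monom_diff_inj(2)[OF M[THEN minword_reduced] eq[unfolded g_def] ne])
    have "(\<tau> C, \<tau> C') \<in> ?E"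
    proof (cases "\<tau> C = \<tau> C'")
      case True
      have "\<tau> C \<in> verts x" using S minword_Cons(1) by blast
      then show ?thesis using True by (simp add: component_rel_def)
    next
      case False
      then show ?thesis using S same common_descent_edge in_E by blast
    qed
    then have "?E `` {\<tau> C} = ?E `` {\<tau> C'}" by (rule equiv_class_eq[OF eqv])
    then show "C = C'" using cls[of C "\<tau> C"] cls[of C' "\<tau> C'"] C S by simp
  qed
  have "card ?D + 1 = card ?Q"
    using card_image[OF inj] C0 finQ card_Suc_Diff1[OF finQ C0] by simp
  moreover have "\<exists>s. \<forall>t\<in>verts x. (s, t) \<in> (linked L x)\<^sup>*" if L: "left_ideal L R" and D: "?D \<subseteq> L" for L
  proof (intro exI ballI)
    fix t assume t: "t \<in> verts x"
    let ?C = "?E `` {t}"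
    have edges: "(Gamma_edges G S H x)\<^sup>* \<subseteq> (linked L x)\<^sup>*" by (intro rtrancl_mono) (auto simp: linked_def)
    have "?C \<in> ?Q" using t by (rule quotientI)
    moreover have "t \<in> ?C" using t by (simp add: component_rel_def)
    ultimately have tC: "?C \<in> ?Q" "t \<in> ?C" .
    show "(s0, t) \<in> (linked L x)\<^sup>*"
    proof (cases "?C = ?B")
      case True
      then have "(s0, t) \<in> ?E" using tC(2) by blast
      then show ?thesis using edges by (auto simp: component_rel_def)
    next
      case False
      then have C: "?C \<in> ?Q - {?B}" using tC by blast
      note S = star[OF C]
      have w: "word_monom 1 (s0 # \<mu> ?C) \<in> fin_on words" "word_monom 1 (\<tau> ?C # \<nu> ?C) \<in> fin_on words"
        using word_monom_fin_on[OF minword_words] S by blast+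
      have "g ?C \<in> L" using D C by blast
      then have "lcong L (word_monom 1 (s0 # \<mu> ?C)) (word_monom 1 (\<tau> ?C # \<nu> ?C))"
        using w by (simp add: lcong_def cl_diff g_def)
      then have "(s0, \<tau> ?C) \<in> linked L x" using S unfolding linked_def by blast
      moreover have "(\<tau> ?C, t) \<in> ?E" using S eqv by (auto simp: equiv_def sym_def)
      then have "(\<tau> ?C, t) \<in> (linked L x)\<^sup>*" using edges by (auto simp: component_rel_def)
      ultimately show ?thesis by (rule converse_rtrancl_into_rtrancl)
    qed
  qed
  moreover have "\<forall>a\<in>?D. dihedral_generator G S H x a" using star by (auto simp: g_def)
  ultimately show ?thesis unfolding components_eq using finQ by (intro exI[of _ ?D]) blast
qed

lemma ann_ideal_generators:
  "\<exists>D. (\<forall>a\<in>D. \<exists>x \<in> X. dihedral_generator G S H x a) \<and>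
       gen_left_ideal R D = ann_ideal G S H \<and>
       (\<forall>x \<in> X. x \<noteq> H \<longrightarrow>
          finite {a \<in> D. dihedral_generator G S H x a} \<and>
          card {a \<in> D. dihedral_generator G S H x a} + 1 = card (Gamma_components G S H x)) \<and>
       {a \<in> D. dihedral_generator G S H H a} = {}"
proof -
  have "\<forall>x\<in>X - {H}. \<exists>D. (\<forall>a\<in>D. dihedral_generator G S H x a) \<and> finite D \<and>
    card D + 1 = card (Gamma_components G S H x) \<and>
    (\<forall>L. left_ideal L R \<longrightarrow> D \<subseteq> L \<longrightarrow> (\<exists>s. \<forall>t\<in>verts x. (s, t) \<in> (linked L x)\<^sup>*))"
    using ex_generator_star by blast
  then obtain D where D: "\<forall>x\<in>X - {H}. (\<forall>a\<in>D x. dihedral_generator G S H x a) \<and> finite (D x) \<and>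
    card (D x) + 1 = card (Gamma_components G S H x) \<and>
    (\<forall>L. left_ideal L R \<longrightarrow> D x \<subseteq> L \<longrightarrow> (\<exists>s. \<forall>t\<in>verts x. (s, t) \<in> (linked L x)\<^sup>*))"
    unfolding bchoice_iff by (elim exE)
  let ?D = "\<Union>x\<in>X - {H}. D x"
  \<comment> \<open>The set counted at x could contain elements chosen at another point y;
    uniqueness of the base point excludes this.\<close>
  have based: "{a \<in> ?D. dihedral_generator G S H x a} = D x" if x: "x \<in> X" "x \<noteq> H" for x
  proof
    show "D x \<subseteq> {a \<in> ?D. dihedral_generator G S H x a}" using D x by blast
    show "{a \<in> ?D. dihedral_generator G S H x a} \<subseteq> D x"
    proof
      fix a assume "a \<in> {a \<in> ?D. dihedral_generator G S H x a}"
      then obtain y where y: "y \<in> X" "y \<noteq> H" "a \<in> D y" "dihedral_generator G S H x a" by blast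
      then have "dihedral_generator G S H y a" using D by blast
      then have "x = y" using dihedral_generator_base_unique[OF x(1) y(4) y(1)] by blast
      then show "a \<in> D x" using y(3) by simp
    qed
  qed
  have "ann_ideal G S H \<subseteq> L" if L: "left_ideal L R" and sub: "?D \<subseteq> L" for L
  proof (rule ann_subset[OF L])
    have conn: "\<exists>s. \<forall>t\<in>verts x. (s, t) \<in> (linked L x)\<^sup>*" if "x \<in> X" "x \<noteq> H" for x
    proof -
      have "D x \<subseteq> L" using sub that by blast
      then show ?thesis using D L that by blast
    qed
    fix x u v assume uv: "minword x u" "minword x v"
    show "lcong L (word_monom 1 u) (word_monom 1 v)"
      by (rule minword_lcong[OF L _ uv]) (rule conn)
  qed
  moreover have "?D \<subseteq> ann_ideal G S H" using D dihedral_generator_in_ann by blast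
  ultimately have "gen_left_ideal R ?D = ann_ideal G S H"
    unfolding gen_left_ideal_def using ann_left_ideal by blast
  moreover have "\<forall>a\<in>?D. \<exists>x \<in> X. dihedral_generator G S H x a" using D by blast
  moreover have "\<forall>x \<in> X. x \<noteq> H \<longrightarrow>
          finite {a \<in> ?D. dihedral_generator G S H x a} \<and>
          card {a \<in> ?D. dihedral_generator G S H x a} + 1 = card (Gamma_components G S H x)"
    using D based by simp
  moreover have "{a \<in> ?D. dihedral_generator G S H H a} = {}" using no_dihedral_generator_at_H by blast
  ultimately show ?thesis by (intro exI[of _ ?D] conjI)
qed

end

theorem theorem7p10:
  fixes G :: "('a, 'b) monoid_scheme" and S H :: "'a set"
  assumes "coxeter_system G S"
    and "quasiparabolic_subgroup G S H"
    and "even_subgroup G S H"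
  shows "\<exists>D. (\<forall>a\<in>D. \<exists>x \<in> lcosets\<^bsub>G\<^esub> H. dihedral_generator G S H x a) \<and>
           gen_left_ideal (hecke G S) D = ann_ideal G S H \<and>
           (\<forall>x \<in> lcosets\<^bsub>G\<^esub> H. x \<noteq> H \<longrightarrow>
              finite {a \<in> D. dihedral_generator G S H x a} \<and>
              card {a \<in> D. dihedral_generator G S H x a} + 1
                = card (Gamma_components G S H x)) \<and>
           {a \<in> D. dihedral_generator G S H H a} = {}"
proof -
  interpret even_quasiparabolic G S H
    using assms by (simp add: even_quasiparabolic_def even_quasiparabolic_axioms_def)
  show ?thesis by (rule ann_ideal_generators)
qed

end
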